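(* Let $Q\in\{P_{\mathrm L},P_{\mathrm D}\}$. Suppose that the system $dx_t=P(x_t)\,dt+\sigma\,dB_t$, $x_0=0$, is noise propagating and that the control system $\dot x=Q(x)+\sigma\dot f$ is component homogeneous. Suppose furthermore that the list of vector fields on $\mathbf R^n$ $$Z_{\ell_1}\ (\ell_1=1,\dots,n),\quad [Z_{\ell_1},Z_{\ell_2}]\ (\ell_1,\ell_2=0,\dots,n),\quad [[Z_{\ell_1},Z_{\ell_2}],Z_{\ell_3}]\ (\ell_1,\ell_2,\ell_3=0,\dots,n),\ \dots$$ spans the tangent space at $0\in\mathbf R^n$, where $Z_0=Q(y)\cdot\nabla_y$ and $Z_\ell=\sigma^\ell\partial_{y^\ell}$ for $\ell=1,\dots,n$, and that there exist $r_1>0$ and $t\in(0,1)$ such that $0\in A_t^2(x)$ for all $x\in B_{r_1}(0)$. Then for any $s>0$ small enough, there exists $r_2>0$ such that $A^1_{t+s}(0)\supset B_{r_2}(0)$.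
   Context: Setting. $n\ge1$, $I=\{1,\dots,n\}$, $P=(P^1,\dots,P^n):\mathbf R^n\to\mathbf R^n$ is a polynomial vector field, $\sigma=\mathrm{diag}(\sigma^1,\dots,\sigma^n)$ with constants $\sigma^i\ge0$, $B_t$ is a standard $n$-dimensional Brownian motion. $[\cdot,\cdot]$ is the commutator of vector fields, $B_r(x)$ the open ball. Scalings. $\mathcal S=\tfrac12\mathbf Z_{\ge0}\times\tfrac12\mathbf Z_{\ge0}$. For $a=(a^1,a^2),b=(b^1,b^2)\in\mathcal S$, $a\preceq b$ iff $a^1<b^1$, or $a^1=b^1$ and $a^2\ge b^2$. $\mathcal S_\infty=\mathcal S\cup\{\infty\}$, with $\infty$ strictly larger than every element of $\mathcal S$. Addition is componentwise in $\mathcal S$, and any sum involving $\infty$ is $\infty$; $\ell a$ ($\ell\in\mathbf Z_{\ge0}$) is componentwise for $a\in\mathcal S$, $\ell\infty=\infty$ if $\ell\ge1$, $0\cdot\infty=(0,0)$. $\mathrm{proj}_1$ is the first coordinate, $\mathrm{proj}_1\infty=\infty$. For a monomial $m(x)=\alpha(x^1)^{n_1}\cdots(x^n)^{n_n}$, $\alpha\neq0$, $m(a_1,\dots,a_n)=n_1a_1+\cdots+n_na_n$; the zero polynomial has value $\infty$; a nonzero polynomial in standard form (sum of a minimal number of monomials) has value the $\preceq$-minimum of the values of its monomials. Inductive procedure. $I_0=\{j:\sigma^j>0\}$; $a_{0,j}=(1/2,1/2)$ and $P^j_{\mathrm L}=P^j_{\mathrm D}\equiv0$ for $j\in I_0$;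 $a_{0,j}=\infty$ for $j\notin I_0$. For $\ell\ge0$, write $a_\ell=(a_{\ell,1},\dots,a_{\ell,n})$: if $I\setminus\bigcup_{k=0}^\ell I_k=\emptyset$ or $P^j(a_\ell)=\infty$ for all $j\in I\setminus\bigcup_{k=0}^\ell I_k$, stop and set $I_i=\emptyset$ for $i\ge\ell+1$. Otherwise let $m_{\ell+1}=\min\{\mathrm{proj}_1P^j(a_\ell):j\in I\setminus\bigcup_{k=0}^\ell I_k\}$, $I_{\ell+1}=\{j\in I\setminus\bigcup_{k=0}^\ell I_k:\mathrm{proj}_1P^j(a_\ell)=m_{\ell+1}\}$; $a_{\ell+1,j}=P^j(a_\ell)+(1,0)$ for $j\in I_{\ell+1}$, $a_{\ell+1,j}=a_{\ell,j}$ otherwise. For $j\in I_{\ell+1}$, $P^j_{\mathrm L}$ is the sum of the monomials $m$ in the standard form of $P^j$ with $m(a_\ell)=P^j(a_\ell)$, and $P^j_{\mathrm D}$ is the sum of the monomials $m$ in the standard form of $P^j$ with $\mathrm{proj}_1m(a_\ell)=m_{\ell+1}$. The system is noise propagating if $\bigcup_{k=0}^\ell I_k=I$ for some $\ell$; then $P_{\mathrm L}=(P_{\mathrm L}^j)_j$, $P_{\mathrm D}=(P_{\mathrm D}^j)_j$. Control sets. $\mathcal H$ is the set of absolutely continuous $h:[0,1]\to\mathbf R^n$ with $h_0=0$ and $\dot h\in L^2([0,1];\mathbf R^n)$; $\mathcal H_\alpha=\{f\in\mathcal H:\tfrac12\int_0^1|\dot f_s|^2ds\le\alpha^2\}$.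 $\varphi_t(Q,f)x$ is the solution on $[0,1]$ (which always exists) of $\dot x=Q(x)+\sigma\dot f$, $x_0=x$, and $\varphi^j_t$ its $j$th component. For $0<t\le1$: $A_t^1(x)=\{\varphi_t(Q,f)x:f\in\mathcal H_1\}$, $A_t^2(x)=\{\varphi_t(Q,f)x:f\in\mathcal H\}$. The control system is component homogeneous if for every $j$ there is a constant $\alpha_j\ge0$ such that $\varphi_t^j(Q,\epsilon f)0=\epsilon^{\alpha_j}\varphi_t^j(Q,f)0$ for all $\epsilon>0$, $f\in\mathcal H$, $t\in(0,1]$. *)

theory Defs
  imports "HOL-Analysis.Analysis" "HOL-Library.Poly_Mapping"
begin

section \<open>Scalings\<close>

text \<open>
  The coordinates should be half-integers; the datatype allows arbitrary reals. The scalings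
  that occur stay inside the half-integer grid: see \<open>scaling_in_S_inf\<close> below.
\<close>

datatype scaling = Scaling real real | Infty

definition S_inf :: "scaling set" where
  "S_inf = insert Infty {Scaling (real k / 2) (real l / 2) | k l. True}"

text \<open>
  The order on the second coordinate is reversed, so \<open>min\<close> and \<open>Min\<close> prefer the larger one.
\<close>

instantiation scaling :: linorder
begin

fun less_eq_scaling :: "scaling \<Rightarrow> scaling \<Rightarrow> bool" where
  "Scaling a1 a2 \<le> Scaling b1 b2 \<longleftrightarrow> a1 < b1 \<or> (a1 = b1 \<and> a2 \<ge> b2)"
| "x \<le> Infty \<longleftrightarrow> True"
| "Infty \<le> Scaling b1 b2 \<longleftrightarrow> False"

definition less_scaling :: "scaling \<Rightarrow> scaling \<Rightarrow> bool" where
  "a < b \<longleftrightarrow> a \<le> b \<and> \<not> b \<le> (a :: scaling)"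

instance
proof
  fix x y z :: scaling
  show "x < y \<longleftrightarrow> x \<le> y \<and> \<not> y \<le> x" by (rule less_scaling_def)
  show "x \<le> x" by (cases x) auto
  show "x \<le> y \<Longrightarrow> y \<le> z \<Longrightarrow> x \<le> z" by (cases x; cases y; cases z) auto
  show "x \<le> y \<Longrightarrow> y \<le> x \<Longrightarrow> x = y" by (cases x; cases y) auto
  show "x \<le> y \<or> y \<le> x" by (cases x; cases y) auto
qed

end

instantiation scaling :: comm_monoid_add
begin

definition zero_scaling :: scaling where "0 = Scaling 0 0"

fun plus_scaling :: "scaling \<Rightarrow> scaling \<Rightarrow> scaling" where
  "Scaling a1 a2 + Scaling b1 b2 = Scaling (a1 + b1) (a2 + b2)"
| "Infty + x = Infty"
| "x + Infty = Infty"

instance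
proof
  fix x y z :: scaling
  show "x + y + z = x + (y + z)" by (cases x; cases y; cases z) auto
  show "x + y = y + x" by (cases x; cases y) auto
  show "0 + x = x" by (cases x) (auto simp: zero_scaling_def)
qed

end

fun nat_scale :: "nat \<Rightarrow> scaling \<Rightarrow> scaling" where
  "nat_scale k (Scaling a1 a2) = Scaling (real k * a1) (real k * a2)"
| "nat_scale k Infty = (if k = 0 then 0 else Infty)"

fun proj1 :: "scaling \<Rightarrow> ereal" where
  "proj1 (Scaling a1 a2) = ereal a1"
| "proj1 Infty = \<infinity>"


section \<open>Polynomial vector fields\<close>

text \<open>
  A real polynomial in the variables \<open>(x\<^sup>j)\<close>, \<open>j :: 'n\<close>, is a finitely supported map from exponents to
  coefficients, so \<open>keys p\<close> lists exactly the monomials of its standard form.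
\<close>

type_synonym 'n rpoly = "('n \<Rightarrow>\<^sub>0 nat) \<Rightarrow>\<^sub>0 real"

definition poly_fun :: "'n::finite rpoly \<Rightarrow> real^'n \<Rightarrow> real" where
  "poly_fun p x =
     (\<Sum>m\<in>Poly_Mapping.keys p. Poly_Mapping.lookup p m * (\<Prod>i\<in>UNIV. (x $ i) ^ Poly_Mapping.lookup m i))"

definition poly_field :: "('n::finite \<Rightarrow> 'n rpoly) \<Rightarrow> real^'n \<Rightarrow> real^'n" where
  "poly_field P x = (\<chi> j. poly_fun (P j) x)"

definition monom_val :: "('n::finite \<Rightarrow>\<^sub>0 nat) \<Rightarrow> ('n \<Rightarrow> scaling) \<Rightarrow> scaling" where
  "monom_val m a = (\<Sum>i\<in>UNIV. nat_scale (Poly_Mapping.lookup m i) (a i))"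

definition poly_val :: "'n::finite rpoly \<Rightarrow> ('n \<Rightarrow> scaling) \<Rightarrow> scaling" where
  "poly_val p a = (if p = 0 then Infty else Min ((\<lambda>m. monom_val m a) ` Poly_Mapping.keys p))"

definition sum_monoms :: "(('n \<Rightarrow>\<^sub>0 nat) \<Rightarrow> bool) \<Rightarrow> 'n rpoly \<Rightarrow> 'n rpoly" where
  "sum_monoms C p = (\<Sum>m\<in>{m \<in> Poly_Mapping.keys p. C m}. Poly_Mapping.single m (Poly_Mapping.lookup p m))"


section \<open>The inductive procedure\<close>

definition min_proj :: "('n::finite \<Rightarrow> 'n rpoly) \<Rightarrow> 'n set \<Rightarrow> ('n \<Rightarrow> scaling) \<Rightarrow> ereal" where
  "min_proj P R a = Min ((\<lambda>j. proj1 (poly_val (P j) a)) ` R)"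

definition next_level :: "('n::finite \<Rightarrow> 'n rpoly) \<Rightarrow> 'n set \<Rightarrow> ('n \<Rightarrow> scaling) \<Rightarrow> 'n set" where
  "next_level P R a =
     (if R = {} \<or> (\<forall>j\<in>R. poly_val (P j) a = Infty) then {}
      else {j \<in> R. proj1 (poly_val (P j) a) = min_proj P R a})"

text \<open>
  \<open>level P \<sigma> l\<close> is \<open>I\<^sub>l\<close> and \<open>vals P \<sigma> l\<close> is \<open>a\<^sub>l\<close>. When the stopping condition holds at \<open>l\<close>, the next
  level is empty and \<open>vals\<close> does not change, so the condition persists and all later levels
  are empty as well.
\<close>

function level :: "('n::finite \<Rightarrow> 'n rpoly) \<Rightarrow> real^'n \<Rightarrow> nat \<Rightarrow> 'n set"
  and vals :: "('n::finite \<Rightarrow> 'n rpoly) \<Rightarrow> real^'n \<Rightarrow> nat \<Rightarrow> 'n \<Rightarrow> scaling" where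
  "level P \<sigma> 0 = {j. \<sigma> $ j > 0}"
| "level P \<sigma> (Suc l) = next_level P (UNIV - (\<Union>k\<in>{..l}. level P \<sigma> k)) (vals P \<sigma> l)"
| "vals P \<sigma> 0 = (\<lambda>j. if j \<in> level P \<sigma> 0 then Scaling (1/2) (1/2) else Infty)"
| "vals P \<sigma> (Suc l) =
     (\<lambda>j. if j \<in> level P \<sigma> (Suc l) then poly_val (P j) (vals P \<sigma> l) + Scaling 1 0
          else vals P \<sigma> l j)"
  by pat_completeness auto
termination
  by (relation "Wellfounded.measure (case_sum (\<lambda>(_, _, l). 2 * l) (\<lambda>(_, _, l). 2 * l + 1))") auto

definition noise_propagating :: "('n::finite \<Rightarrow> 'n rpoly) \<Rightarrow> real^'n \<Rightarrow> bool" where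
  "noise_propagating P \<sigma> \<longleftrightarrow> (\<exists>l. (\<Union>k\<in>{..l}. level P \<sigma> k) = UNIV)"

text \<open>
  The levels are pairwise disjoint, so at most one \<open>l\<close> qualifies in the following definitions;
  if \<open>j\<close> lies in level \<open>0\<close>, no \<open>l\<close> does and the component is \<open>0\<close>.
\<close>

definition P_L :: "('n::finite \<Rightarrow> 'n rpoly) \<Rightarrow> real^'n \<Rightarrow> 'n \<Rightarrow> 'n rpoly" where
  "P_L P \<sigma> j =
     sum_monoms (\<lambda>m. \<exists>l. j \<in> level P \<sigma> (Suc l) \<and>
        monom_val m (vals P \<sigma> l) = poly_val (P j) (vals P \<sigma> l)) (P j)"

definition P_D :: "('n::finite \<Rightarrow> 'n rpoly) \<Rightarrow> real^'n \<Rightarrow> 'n \<Rightarrow> 'n rpoly" where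
  "P_D P \<sigma> j =
     sum_monoms (\<lambda>m. \<exists>l. j \<in> level P \<sigma> (Suc l) \<and>
        proj1 (monom_val m (vals P \<sigma> l)) =
          min_proj P (UNIV - (\<Union>k\<in>{..l}. level P \<sigma> k)) (vals P \<sigma> l)) (P j)"

lemma S_inf_add: "a \<in> S_inf \<Longrightarrow> b \<in> S_inf \<Longrightarrow> a + b \<in> S_inf"
  unfolding S_inf_def
  by (auto simp: add_divide_distrib[symmetric] simp flip: of_nat_add)

lemma S_inf_zero: "0 \<in> S_inf"
  unfolding S_inf_def zero_scaling_def by (auto intro!: exI[of _ 0])

lemma S_inf_scale: "a \<in> S_inf \<Longrightarrow> nat_scale k a \<in> S_inf"
proof (cases a)
  case (Scaling a1 a2)
  assume "a \<in> S_inf"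
  with Scaling obtain i j where "a1 = real i / 2" "a2 = real j / 2"
    by (auto simp: S_inf_def)
  with Scaling have "nat_scale k a = Scaling (real (k * i) / 2) (real (k * j) / 2)"
    by simp
  then show ?thesis unfolding S_inf_def by blast
next
  case Infty
  then show ?thesis using S_inf_zero by (simp add: S_inf_def)
qed

lemma S_inf_poly_val:
  assumes "\<And>i. a i \<in> S_inf"
  shows "poly_val p a \<in> S_inf"
proof (cases "p = 0")
  case True
  then show ?thesis by (simp add: poly_val_def S_inf_def)
next
  case False
  have *: "(\<Sum>i\<in>A. nat_scale (Poly_Mapping.lookup m i) (a i)) \<in> S_inf" for A m
    by (induction A rule: infinite_finite_induct) (auto intro: S_inf_zero S_inf_add S_inf_scale assms)
  have "Min ((\<lambda>m. monom_val m a) ` Poly_Mapping.keys p) \<in> (\<lambda>m. monom_val m a) ` Poly_Mapping.keys p"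
    using False by (intro Min_in) auto
  then obtain m where "poly_val p a = monom_val m a"
    using False unfolding poly_val_def if_not_P[OF False] by blast
  then show ?thesis by (simp add: monom_val_def *)
qed

lemma scaling_in_S_inf: "vals P \<sigma> l j \<in> S_inf"
proof (induction l arbitrary: j)
  case 0
  have "Scaling (1/2) (1/2) \<in> S_inf"
    unfolding S_inf_def by (auto intro!: exI[of _ 1])
  then show ?case by (auto simp: S_inf_def)
next
  case (Suc l)
  have "Scaling 1 0 \<in> S_inf"
    unfolding S_inf_def by (auto intro!: exI[of _ 2] exI[of _ 0])
  with Suc show ?case by (auto intro: S_inf_add S_inf_poly_val)
qed


section \<open>Control systems\<close>

text \<open>
  Only the values on \<open>[0,1]\<close> of a control or of a trajectory matter, although both are total functions.
\<close>

definition abs_continuous_on :: "real set \<Rightarrow> (real \<Rightarrow> 'a::real_normed_vector) \<Rightarrow> bool" where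
  "abs_continuous_on S h \<longleftrightarrow>
     (\<forall>\<epsilon>>0. \<exists>\<delta>>0. \<forall>D. finite D \<and> (\<forall>(a, b)\<in>D. a \<le> b \<and> {a..b} \<subseteq> S) \<and>
        pairwise (\<lambda>p q. {fst p<..<snd p} \<inter> {fst q<..<snd q} = {}) D \<and>
        (\<Sum>(a, b)\<in>D. b - a) < \<delta> \<longrightarrow> (\<Sum>(a, b)\<in>D. norm (h b - h a)) < \<epsilon>)"

definition time_deriv :: "(real \<Rightarrow> 'a::real_normed_vector) \<Rightarrow> real \<Rightarrow> 'a" where
  "time_deriv h s = vector_derivative h (at s within {0..1})"

definition controls :: "(real \<Rightarrow> real^'n::finite) set" where
  "controls =
     {h. abs_continuous_on {0..1} h \<and> h 0 = 0 \<and>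
         set_borel_measurable lebesgue {0..1} (time_deriv h) \<and>
         set_integrable lebesgue {0..1} (\<lambda>s. (norm (time_deriv h s))\<^sup>2)}"

definition controls_le :: "real \<Rightarrow> (real \<Rightarrow> real^'n::finite) set" where
  "controls_le \<alpha> = {f \<in> controls. 1/2 * (LINT s:{0..1}|lebesgue. (norm (time_deriv f s))\<^sup>2) \<le> \<alpha>\<^sup>2}"

definition diag_mult :: "real^'n::finite \<Rightarrow> real^'n \<Rightarrow> real^'n" where
  "diag_mult \<sigma> v = (\<chi> j. \<sigma> $ j * v $ j)"

definition is_solution ::
  "(real^'n::finite \<Rightarrow> real^'n) \<Rightarrow> real^'n \<Rightarrow> (real \<Rightarrow> real^'n) \<Rightarrow> real^'n \<Rightarrow> (real \<Rightarrow> real^'n) \<Rightarrow> bool" where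
  "is_solution Q \<sigma> f x0 x \<longleftrightarrow>
     abs_continuous_on {0..1} x \<and> x 0 = x0 \<and>
     (AE s in lebesgue. s \<in> {0..1} \<longrightarrow>
        (x has_vector_derivative (Q (x s) + diag_mult \<sigma> (time_deriv f s))) (at s within {0..1}))"

text \<open>
  \<open>flow Q \<sigma> f x0 t\<close> is \<open>\<phi>\<^sub>t(Q,f)x\<^sub>0\<close>. It is meaningful for \<open>t \<in> [0,1]\<close> when a solution on \<open>[0,1]\<close> exists;
  the solution is then unique on \<open>[0,1]\<close> if \<open>Q\<close> is locally Lipschitz.
\<close>

definition flow ::
  "(real^'n::finite \<Rightarrow> real^'n) \<Rightarrow> real^'n \<Rightarrow> (real \<Rightarrow> real^'n) \<Rightarrow> real^'n \<Rightarrow> real \<Rightarrow> real^'n" where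
  "flow Q \<sigma> f x0 t = (THE y. \<exists>x. is_solution Q \<sigma> f x0 x \<and> x t = y)"

definition A1 :: "(real^'n::finite \<Rightarrow> real^'n) \<Rightarrow> real^'n \<Rightarrow> real \<Rightarrow> real^'n \<Rightarrow> (real^'n) set" where
  "A1 Q \<sigma> t x = {flow Q \<sigma> f x t | f. f \<in> controls_le 1}"

definition A2 :: "(real^'n::finite \<Rightarrow> real^'n) \<Rightarrow> real^'n \<Rightarrow> real \<Rightarrow> real^'n \<Rightarrow> (real^'n) set" where
  "A2 Q \<sigma> t x = {flow Q \<sigma> f x t | f. f \<in> controls}"

definition component_homogeneous :: "(real^'n::finite \<Rightarrow> real^'n) \<Rightarrow> real^'n \<Rightarrow> bool" where
  "component_homogeneous Q \<sigma> \<longleftrightarrow>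
     (\<forall>j. \<exists>\<alpha>\<ge>0. \<forall>\<epsilon>>0. \<forall>f\<in>controls. \<forall>t. 0 < t \<and> t \<le> 1 \<longrightarrow>
        flow Q \<sigma> (\<lambda>s. \<epsilon> *\<^sub>R f s) 0 t $ j = \<epsilon> powr \<alpha> * flow Q \<sigma> f 0 t $ j)"


section \<open>Iterated brackets\<close>

text \<open>
  A function \<open>V\<close> stands for the vector field \<open>V(y) \<cdot> \<nabla>\<^sub>y\<close>. As a differential operator, \<open>VW - WV\<close> has
  coefficients \<open>DW(V) - DV(W)\<close>.
\<close>

definition lie_bracket ::
  "(real^'n::finite \<Rightarrow> real^'n) \<Rightarrow> (real^'n \<Rightarrow> real^'n) \<Rightarrow> real^'n \<Rightarrow> real^'n" where
  "lie_bracket V W y =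
     frechet_derivative W (at y) (V y) - frechet_derivative V (at y) (W y)"

text \<open>The index \<open>None\<close> plays the role of \<open>0\<close>.\<close>

fun Z :: "(real^'n::finite \<Rightarrow> real^'n) \<Rightarrow> real^'n \<Rightarrow> 'n option \<Rightarrow> real^'n \<Rightarrow> real^'n" where
  "Z Q \<sigma> None = Q"
| "Z Q \<sigma> (Some l) = (\<lambda>y. \<sigma> $ l *\<^sub>R axis l 1)"

inductive_set bracket_list ::
  "(real^'n::finite \<Rightarrow> real^'n) \<Rightarrow> real^'n \<Rightarrow> (real^'n \<Rightarrow> real^'n) set"
  for Q :: "real^'n::finite \<Rightarrow> real^'n" and \<sigma> :: "real^'n" where
  noise: "Z Q \<sigma> (Some l) \<in> bracket_list Q \<sigma>"
| bracket: "lie_bracket (Z Q \<sigma> k1) (Z Q \<sigma> k2) \<in> bracket_list Q \<sigma>"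
| iterate: "V \<in> bracket_list Q \<sigma> \<Longrightarrow> lie_bracket V (Z Q \<sigma> k) \<in> bracket_list Q \<sigma>"

end

theory Submission
  imports Defs
begin

text \<open>
  The system \<open>\<dot>x = Q(x) + \<sigma> \<dot>f\<close> is triangular: a component that receives the noise at level \<open>l + 1\<close> is
  driven, in \<open>Q\<close>, only by components of levels at most \<open>l\<close>, because a monomial of finite value contains no
  variable of value \<open>\<infinity>\<close>. Hence it is solved by iterated integration. Solutions exist, are unique, and
  depend continuously and injectively on the initial point, so that, by invariance of domain,
  \<open>x \<mapsto> \<phi>\<^sub>t(Q,f)x\<close> is an open map for every control \<open>f\<close> (\<open>open_flow_image\<close>). For constant controls the
  flow is even a polynomial in the time, the control and the initial point.

  Let \<open>s > 0\<close>. At some exact time \<open>s' < s\<close> and with controls of bounded energy, one can reach from \<open>0\<close>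
  every point of a nonempty open set (\<open>accessible_at_exact_time\<close>). To see this, one lets
  the flows of the fields \<open>\<tau> Z\<^sub>0 + \<Sum> c\<^sup>l Z\<^sub>l\<close> run for all real \<open>\<tau>\<close> and \<open>c\<close>, negative times and instantaneous
  displacements included. They generate a group. Conjugating small displacements by elements of this
  group produces at \<open>0\<close> all pullbacks of the constant fields \<open>Z\<^sub>l\<close>, and differentiating pullbacks along a flow
  produces brackets (\<open>pullback_bracket\<close>). Under the spanning hypothesis there is therefore a
  finite word in these flows, depending on \<open>\<theta> \<in> \<real>\<^sup>n\<close> through its displacements only, whose endpoint has the
  identity as derivative at \<open>\<theta> = 0\<close>. The endpoint is polynomial in all times and displacements, so the Jacobian
  determinant, being nonzero at these possibly negative times, is also nonzero at suitable positive times
  as small as desired, and positive times can be realized by controls.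

  From a point \<open>x\<close> of this open set the zero control leads, in the time \<open>s - s'\<close>, into \<open>B\<^bsub>r\<^sub>1\<^esub>(0)\<close>, and from
  there some control leads to \<open>0\<close> in time \<open>t\<close>. The concatenation of these two controls carries the open set to
  a neighbourhood of \<open>0\<close>. Thus a ball around \<open>0\<close> is reached at time \<open>t + s\<close> with bounded energy, and
  component homogeneity shrinks the energy to the admissible size at the price of a smaller ball
  (\<open>homogeneous_scaling\<close>).

  A control is only known to be absolutely continuous, so the equivalence of the differential equation
  with its integral form (\<open>solution_iff_integral_solution\<close>) rests on two classical facts: an absolutely
  continuous function is differentiable almost everywhere, and it is constant if its derivative vanishes almost
  everywhere.
\<close>

section \<open>Absolutely continuous functions\<close>

definition nonoverlapping :: "real set \<Rightarrow> (real \<times> real) set \<Rightarrow> bool" where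
  "nonoverlapping S D \<longleftrightarrow> finite D \<and> (\<forall>(a, b)\<in>D. a \<le> b \<and> {a..b} \<subseteq> S) \<and>
     pairwise (\<lambda>p q. {fst p<..<snd p} \<inter> {fst q<..<snd q} = {}) D"

lemma abs_continuous_on_alt:
  "abs_continuous_on S h \<longleftrightarrow> (\<forall>\<epsilon>>0. \<exists>\<delta>>0. \<forall>D. nonoverlapping S D \<longrightarrow>
     (\<Sum>(a, b)\<in>D. b - a) < \<delta> \<longrightarrow> (\<Sum>(a, b)\<in>D. norm (h b - h a)) < \<epsilon>)"
  unfolding abs_continuous_on_def nonoverlapping_def by (simp add: conj_assoc flip: imp_conjL)

lemma abs_continuous_onD:
  assumes "abs_continuous_on S h" "0 < \<epsilon>"
  shows "\<exists>\<delta>>0. \<forall>D. nonoverlapping S D \<longrightarrow>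
     (\<Sum>(a, b)\<in>D. b - a) < \<delta> \<longrightarrow> (\<Sum>(a, b)\<in>D. norm (h b - h a)) < \<epsilon>"
  using assms by (simp add: abs_continuous_on_alt)

lemma abs_continuous_onI:
  assumes "\<And>\<epsilon>. 0 < \<epsilon> \<Longrightarrow> \<exists>\<delta>>0. \<forall>D. nonoverlapping S D \<longrightarrow>
     (\<Sum>(a, b)\<in>D. b - a) < \<delta> \<longrightarrow> (\<Sum>(a, b)\<in>D. norm (h b - h a)) < \<epsilon>"
  shows "abs_continuous_on S h"
  using assms by (simp add: abs_continuous_on_alt)

lemma abs_continuous_on_small_interval:
  assumes "abs_continuous_on {c..d} h" "0 < \<epsilon>"
  obtains \<delta> where "0 < \<delta>" "\<And>a b. c \<le> a \<Longrightarrow> a \<le> b \<Longrightarrow> b \<le> d \<Longrightarrow> b - a < \<delta> \<Longrightarrow> norm (h b - h a) < \<epsilon>"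
proof -
  obtain \<delta> where "0 < \<delta>" and d: "\<And>D. nonoverlapping {c..d} D \<Longrightarrow>
       (\<Sum>(a, b)\<in>D. b - a) < \<delta> \<Longrightarrow> (\<Sum>(a, b)\<in>D. norm (h b - h a)) < \<epsilon>"
    using abs_continuous_onD[OF assms] by blast
  show thesis
  proof (rule that[OF \<open>0 < \<delta>\<close>])
    fix a b assume "c \<le> a" "a \<le> b" "b \<le> d" "b - a < \<delta>"
    then show "norm (h b - h a) < \<epsilon>"
      using d[of "{(a, b)}"] by (auto simp: nonoverlapping_def)
  qed
qed

lemma abs_continuous_on_imp_continuous_on:
  fixes h :: "real \<Rightarrow> 'a::real_normed_vector"
  assumes "abs_continuous_on {c..d} h"
  shows "continuous_on {c..d} h"
  unfolding continuous_on_iff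
proof (intro ballI allI impI)
  fix x \<epsilon> :: real assume x: "x \<in> {c..d}" and "0 < \<epsilon>"
  obtain \<delta> where "0 < \<delta>" and d: "\<And>a b. c \<le> a \<Longrightarrow> a \<le> b \<Longrightarrow> b \<le> d \<Longrightarrow> b - a < \<delta> \<Longrightarrow> norm (h b - h a) < \<epsilon>"
    using abs_continuous_on_small_interval[OF assms \<open>0 < \<epsilon>\<close>] by blast
  show "\<exists>\<delta>>0. \<forall>y\<in>{c..d}. dist y x < \<delta> \<longrightarrow> dist (h y) (h x) < \<epsilon>"
  proof (rule exI[of _ \<delta>], intro conjI ballI impI)
    fix y assume y: "y \<in> {c..d}" "dist y x < \<delta>"
    show "dist (h y) (h x) < \<epsilon>"
      using d[of x y] d[of y x] x y
      by (cases "x \<le> y") (auto simp: dist_norm norm_minus_commute dist_real_def)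
  qed fact
qed

text \<open>
  The increments of \<open>h\<close> are dominated by those of \<open>g\<close>; this covers linear images, Lipschitz functions and
  changes outside \<open>S\<close>.
\<close>

lemma abs_continuous_on_bounded_by:
  assumes g: "abs_continuous_on S g" and C: "0 \<le> C"
    and le: "\<And>a b. a \<le> b \<Longrightarrow> {a..b} \<subseteq> S \<Longrightarrow> norm (h b - h a) \<le> C * (norm (g b - g a))"
  shows "abs_continuous_on S h"
proof (rule abs_continuous_onI)
  fix \<epsilon> :: real assume "0 < \<epsilon>"
  then have "0 < \<epsilon> / (C + 1)" using C by simp
  obtain \<delta> where "0 < \<delta>" and
    d: "\<And>D. nonoverlapping S D \<Longrightarrow>
       (\<Sum>(a, b)\<in>D. b - a) < \<delta> \<Longrightarrow> (\<Sum>(a, b)\<in>D. norm (g b - g a)) < \<epsilon> / (C + 1)" using abs_continuous_onD[OF g \<open>0 < \<epsilon> / (C + 1)\<close>] by blast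
  show "\<exists>\<delta>>0. \<forall>D. nonoverlapping S D \<longrightarrow>
       (\<Sum>(a, b)\<in>D. b - a) < \<delta> \<longrightarrow> (\<Sum>(a, b)\<in>D. norm (h b - h a)) < \<epsilon>"
  proof (rule exI[of _ \<delta>], intro conjI allI impI)
    fix D assume D: "nonoverlapping S D" "(\<Sum>(a, b)\<in>D. b - a) < \<delta>"
    have "(\<Sum>(a, b)\<in>D. norm (h b - h a)) \<le> (\<Sum>(a, b)\<in>D. C * norm (g b - g a))"
      using D le by (intro sum_mono) (auto simp: nonoverlapping_def)
    also have "\<dots> = C * (\<Sum>(a, b)\<in>D. norm (g b - g a))"
      by (simp add: sum_distrib_left case_prod_unfold)
    also have "\<dots> \<le> (C + 1) * (\<Sum>(a, b)\<in>D. norm (g b - g a))"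
      by (rule mult_right_mono) (auto intro!: sum_nonneg)
    also have "\<dots> < (C + 1) * (\<epsilon> / (C + 1))"
      using d[of D] D C by (intro mult_strict_left_mono) auto
    also have "\<dots> = \<epsilon>" using C by simp
    finally show "(\<Sum>(a, b)\<in>D. norm (h b - h a)) < \<epsilon>" .
  qed fact
qed

lemma abs_continuous_on_id: "abs_continuous_on S (\<lambda>s::real. s)"
proof (rule abs_continuous_onI)
  fix \<epsilon> :: real assume "0 < \<epsilon>"
  have "(\<Sum>(a, b)\<in>D. norm (b - a)) = (\<Sum>(a, b)\<in>D. b - a)" if "nonoverlapping S D" for D
    using that by (intro sum.cong) (auto simp: nonoverlapping_def)
  then show "\<exists>\<delta>>0. \<forall>D. nonoverlapping S D \<longrightarrow>
       (\<Sum>(a, b)\<in>D. b - a) < \<delta> \<longrightarrow> (\<Sum>(a, b)\<in>D. norm (b - a)) < \<epsilon>"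
    using \<open>0 < \<epsilon>\<close> by (intro exI[of _ \<epsilon>]) auto
qed

lemma abs_continuous_on_bounded_linear:
  assumes "bounded_linear L" "abs_continuous_on S h"
  shows "abs_continuous_on S (\<lambda>s. L (h s))"
proof -
  obtain C where C: "C > 0" "\<And>x. norm (L x) \<le> norm x * C"
    using bounded_linear.pos_bounded[OF assms(1)] by blast
  show ?thesis
    by (rule abs_continuous_on_bounded_by[OF assms(2), of C])
      (use C in \<open>auto simp: mult.commute bounded_linear.linear[OF assms(1)] simp flip: linear_diff\<close>)
qed

lemma abs_continuous_on_add:
  assumes "abs_continuous_on S f" "abs_continuous_on S g"
  shows "abs_continuous_on S (\<lambda>s. f s + g s)"
proof (rule abs_continuous_onI)
  fix \<epsilon> :: real assume "0 < \<epsilon>"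
  then have e: "0 < \<epsilon>/2" by simp
  obtain d1 where "0 < d1" and
    d1: "\<And>D. nonoverlapping S D \<Longrightarrow>
       (\<Sum>(a, b)\<in>D. b - a) < d1 \<Longrightarrow> (\<Sum>(a, b)\<in>D. norm (f b - f a)) < \<epsilon>/2"
    using abs_continuous_onD[OF assms(1) e] by blast
  obtain d2 where "0 < d2" and
    d2: "\<And>D. nonoverlapping S D \<Longrightarrow>
       (\<Sum>(a, b)\<in>D. b - a) < d2 \<Longrightarrow> (\<Sum>(a, b)\<in>D. norm (g b - g a)) < \<epsilon>/2"
    using abs_continuous_onD[OF assms(2) e] by blast
  show "\<exists>\<delta>>0. \<forall>D. nonoverlapping S D \<longrightarrow>
       (\<Sum>(a, b)\<in>D. b - a) < \<delta> \<longrightarrow> (\<Sum>(a, b)\<in>D. norm (f b + g b - (f a + g a))) < \<epsilon>"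
  proof (rule exI[of _ "min d1 d2"], intro conjI allI impI)
    fix D assume D: "nonoverlapping S D"
      "(\<Sum>(a, b)\<in>D. b - a) < min d1 d2"
    have "(\<Sum>(a, b)\<in>D. norm (f b + g b - (f a + g a)))
        \<le> (\<Sum>(a, b)\<in>D. norm (f b - f a) + norm (g b - g a))"
    proof (intro sum_mono, clarify)
      fix a b
      have "f b + g b - (f a + g a) = (f b - f a) + (g b - g a)" by simp
      then show "norm (f b + g b - (f a + g a)) \<le> norm (f b - f a) + norm (g b - g a)"
        by (metis norm_triangle_ineq)
    qed
    also have "\<dots> = (\<Sum>(a, b)\<in>D. norm (f b - f a)) + (\<Sum>(a, b)\<in>D. norm (g b - g a))"
      by (simp add: case_prod_unfold sum.distrib)
    also have "\<dots> < \<epsilon>/2 + \<epsilon>/2"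
      using D by (intro add_strict_mono d1 d2) auto
    finally show "(\<Sum>(a, b)\<in>D. norm (f b + g b - (f a + g a))) < \<epsilon>" by simp
  qed (use \<open>0 < d1\<close> \<open>0 < d2\<close> in auto)
qed

lemma abs_continuous_on_diff:
  assumes "abs_continuous_on S f" "abs_continuous_on S g"
  shows "abs_continuous_on S (\<lambda>s. f s - g s)"
  using abs_continuous_on_add[OF assms(1) abs_continuous_on_bounded_linear[OF bounded_linear_minus[OF bounded_linear_ident] assms(2)]]
  by simp

lemma measure_nonoverlapping:
  assumes "nonoverlapping S D"
  shows "measure lebesgue (\<Union>(a, b)\<in>D. {a<..<b}) = (\<Sum>(a, b)\<in>D. b - a)"
proof -
  have "measure lebesgue (\<Union>p\<in>D. {fst p<..<snd p}) = (\<Sum>p\<in>D. measure lebesgue {fst p<..<snd p})"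
    using assms by (intro measure_finite_Union)
      (auto simp: disjoint_family_on_def nonoverlapping_def pairwise_def emeasure_eq_ennreal_measure)
  also have "\<dots> = (\<Sum>(a, b)\<in>D. b - a)"
    using assms by (intro sum.cong) (auto simp: nonoverlapping_def)
  finally show ?thesis by (simp add: case_prod_unfold)
qed

lemma total_length_le_measure:
  assumes "nonoverlapping S D" "\<And>a b. (a, b) \<in> D \<Longrightarrow> {a<..<b} \<subseteq> W" "W \<in> lmeasurable"
  shows "(\<Sum>(a, b)\<in>D. b - a) \<le> measure lebesgue W"
proof -
  have "measure lebesgue (\<Union>(a, b)\<in>D. {a<..<b}) \<le> measure lebesgue W"
    using assms by (intro measure_mono_fmeasurable) (auto intro!: sets.finite_UN simp: nonoverlapping_def)
  then show ?thesis using measure_nonoverlapping[OF assms(1)] by simp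
qed

lemma nonoverlapping_subset: "nonoverlapping S D \<Longrightarrow> D' \<subseteq> D \<Longrightarrow> nonoverlapping S D'"
  unfolding nonoverlapping_def by (meson finite_subset pairwise_subset subsetD)

lemma negligible_outer_open:
  fixes N :: "real set"
  assumes "negligible N" "0 < \<delta>"
  obtains U where "open U" "N \<subseteq> U" "U \<in> lmeasurable" "measure lebesgue U < \<delta>"
proof -
  have N: "N \<in> null_sets lebesgue" using assms by (simp add: negligible_iff_null_sets)
  then have "N \<in> sets lebesgue" by auto
  then obtain T where T: "open T" "N \<subseteq> T" "(T - N) \<in> lmeasurable" "emeasure lebesgue (T - N) < ennreal \<delta>"
    using sets_lebesgue_outer_open[OF _ assms(2)] by metis
  have T': "T \<in> lmeasurable" "measure lebesgue T = measure lebesgue (T - N)"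
  proof -
    have "T = (T - N) \<union> N" using T by auto
    moreover have "N \<in> lmeasurable" using assms(1) by (simp add: negligible_imp_measurable)
    ultimately show "T \<in> lmeasurable" using T(3) by (metis fmeasurable.Un)
    show "measure lebesgue T = measure lebesgue (T - N)"
      using N \<open>T \<in> lmeasurable\<close> by (simp add: measure_Diff_null_set fmeasurableD)
  qed
  moreover have "measure lebesgue (T - N) < \<delta>"
    using T(3,4) assms(2) by (simp add: emeasure_eq_measure2 ennreal_less_iff)
  ultimately show thesis using that T by metis
qed

lemma AE_lebesgue_imp_negligible:
  assumes "AE s in lebesgue. P s"
  shows "negligible {s::real. \<not> P s}"
proof -
  obtain M where "M \<in> null_sets lebesgue" "{s. \<not> P s} \<subseteq> M"
    using assms unfolding eventually_ae_filter by auto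
  then show ?thesis using negligible_iff_null_sets negligible_subset by blast
qed

text \<open>
  A gauge and Cousin's lemma yield a tagged division of \<open>[0,r]\<close> adapted to \<open>h\<close>. At tags where the
  derivative is \<open>0\<close>, the increments are small compared with the lengths. The intervals tagged in the exceptional
  null set lie in an open set of small measure, and there absolute continuity bounds the increments.
\<close>

lemma abs_continuous_derivative_zero_imp_constant:
  fixes h :: "real \<Rightarrow> 'a::real_normed_vector"
  assumes ac: "abs_continuous_on {0..1} h"
    and der: "AE s in lebesgue. s \<in> {0..1} \<longrightarrow> (h has_vector_derivative 0) (at s within {0..1})"
    and r: "r \<in> {0..1}"
  shows "h r = h 0"
proof -
  define N where "N = {s. \<not> (s \<in> {0..1} \<longrightarrow> (h has_vector_derivative 0) (at s within {0..1}))}"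
  have N: "negligible N" unfolding N_def using AE_lebesgue_imp_negligible[OF der] .
  have main: "norm (h r - h 0) \<le> \<epsilon> + \<epsilon>" if "0 < \<epsilon>" for \<epsilon>
  proof -
    obtain \<delta> where "0 < \<delta>" and d: "\<And>D. nonoverlapping {0..1} D \<Longrightarrow>
       (\<Sum>(a, b)\<in>D. b - a) < \<delta> \<Longrightarrow> (\<Sum>(a, b)\<in>D. norm (h b - h a)) < \<epsilon>"
      using abs_continuous_onD[OF ac \<open>0 < \<epsilon>\<close>] by blast
    obtain U where U: "open U" "N \<subseteq> U" "U \<in> lmeasurable" "measure lebesgue U < \<delta>"
      using negligible_outer_open[OF N \<open>0 < \<delta>\<close>] by blast
    have "\<exists>e>0. \<forall>y\<in>{0..1}. \<bar>y - s\<bar> < e \<longrightarrow> norm (h y - h s) \<le> \<epsilon> * \<bar>y - s\<bar>"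
      if "s \<in> {0..1}" "s \<notin> N" for s
    proof -
      have "(h has_derivative (\<lambda>x. 0)) (at s within {0..1})"
        using that unfolding N_def has_vector_derivative_def by auto
      then show ?thesis using \<open>0 < \<epsilon>\<close> unfolding has_derivative_within_alt by auto
    qed
    then obtain e where e: "\<And>s. s \<in> {0..1} \<Longrightarrow> s \<notin> N \<Longrightarrow> e s > 0"
      "\<And>s y. s \<in> {0..1} \<Longrightarrow> s \<notin> N \<Longrightarrow> y\<in>{0..1} \<Longrightarrow> \<bar>y - s\<bar> < e s \<Longrightarrow> norm (h y - h s) \<le> \<epsilon> * \<bar>y - s\<bar>"
      by metis
    \<comment> \<open>The gauge confines the intervals tagged in the null set \<open>N\<close> to the small open set \<open>U\<close>.\<close>
    define g where "g s = (if s \<in> N then U else if s \<in> {0..1} then ball s (e s) else UNIV)" for s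
    have "gauge g" unfolding gauge_def g_def using U e by auto
    then obtain p where p: "p tagged_division_of {0..r}" "g fine p"
      using fine_division_exists_real by metis
    have "finite p" using p by blast
    have pK: "\<exists>a b. K = {a..b} \<and> a \<le> x \<and> x \<le> b \<and> 0 \<le> a \<and> b \<le> r \<and> Inf K = a \<and> Sup K = b \<and> K \<subseteq> g x"
      if xK: "(x, K) \<in> p" for x K
    proof -
      obtain a b where K: "K = cbox a b" using tagged_division_ofD(4)[OF p(1) xK] by blast
      moreover have "x \<in> K" "K \<subseteq> {0..r}" using tagged_division_ofD(2,3)[OF p(1) xK] by auto
      moreover have "K \<subseteq> g x" using p(2) xK by (auto simp: fine_def)
      ultimately show ?thesis by (intro exI[of _ a] exI[of _ b]) auto
    qed
    define pN where "pN = {(x, K) \<in> p. x \<in> N}"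
    have "h r - h 0 = (\<Sum>(x, K)\<in>p. h (Sup K) - h (Inf K))"
      using additive_tagged_division_1[OF _ p(1), of h] r by simp
    also have "\<dots> = (\<Sum>(x, K)\<in>pN. h (Sup K) - h (Inf K)) + (\<Sum>(x, K)\<in>p - pN. h (Sup K) - h (Inf K))"
      using \<open>finite p\<close> by (subst add.commute) (intro sum.subset_diff, auto simp: pN_def)
    finally have "norm (h r - h 0) \<le> (\<Sum>(x, K)\<in>pN. norm (h (Sup K) - h (Inf K)))
        + (\<Sum>(x, K)\<in>p - pN. norm (h (Sup K) - h (Inf K)))"
      by (auto simp: case_prod_unfold intro!: norm_triangle_le add_mono norm_sum)
    moreover have "(\<Sum>(x, K)\<in>p - pN. norm (h (Sup K) - h (Inf K))) \<le> \<epsilon>"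
    proof -
      have "(\<Sum>(x, K)\<in>p - pN. norm (h (Sup K) - h (Inf K))) \<le> (\<Sum>(x, K)\<in>p - pN. \<epsilon> * (Sup K - Inf K))"
      proof (intro sum_mono, clarify)
        fix x K assume xK: "(x, K) \<in> p" "(x, K) \<notin> pN"
        then have x: "x \<notin> N" by (auto simp: pN_def)
        obtain a b where ab: "K = {a..b}" "a \<le> x" "x \<le> b" "0 \<le> a" "b \<le> r" "Inf K = a" "Sup K = b" "K \<subseteq> g x"
          using pK[OF xK(1)] by auto
        have x01: "x \<in> {0..1}" using ab r by auto
        then have "K \<subseteq> ball x (e x)" using ab(8) x by (simp add: g_def)
        moreover have "a \<in> K" "b \<in> K" using ab by auto
        ultimately have "\<bar>a - x\<bar> < e x" "\<bar>b - x\<bar> < e x"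
          by (auto simp: dist_real_def abs_minus_commute subset_iff)
        moreover have "a \<in> {0..1}" "b \<in> {0..1}" using ab r by auto
        ultimately have 1: "norm (h a - h x) \<le> \<epsilon> * \<bar>a - x\<bar>" "norm (h b - h x) \<le> \<epsilon> * \<bar>b - x\<bar>"
          using e(2)[OF x01 x, of a] e(2)[OF x01 x, of b] by blast+
        have "norm (h b - h a) \<le> norm (h a - h x) + norm (h b - h x)"
          using norm_triangle_ineq4[of "h b - h x" "h a - h x"] by simp
        also have "\<dots> \<le> \<epsilon> * \<bar>a - x\<bar> + \<epsilon> * \<bar>b - x\<bar>" using 1 by simp
        also have "\<dots> = \<epsilon> * (b - a)" using ab by (simp add: algebra_simps)
        finally show "norm (h (Sup K) - h (Inf K)) \<le> \<epsilon> * (Sup K - Inf K)" using ab by simp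
      qed
      also have "\<dots> \<le> (\<Sum>(x, K)\<in>p. \<epsilon> * (Sup K - Inf K))"
      proof (rule sum_mono2)
        fix z assume "z \<in> p - (p - pN)"
        then obtain x K where "z = (x, K)" "(x, K) \<in> p" by (cases z) auto
        then show "0 \<le> (case z of (x, K) \<Rightarrow> \<epsilon> * (Sup K - Inf K))" using pK \<open>0 < \<epsilon>\<close> by fastforce
      qed (use \<open>finite p\<close> in auto)
      also have "\<dots> = \<epsilon> * (\<Sum>(x, K)\<in>p. Sup K - Inf K)"
        by (simp add: sum_distrib_left case_prod_unfold)
      also have "\<dots> = \<epsilon> * (r - 0)"
        using additive_tagged_division_1[OF _ p(1), of "\<lambda>x. x"] r by simp
      also have "\<dots> \<le> \<epsilon>" using r \<open>0 < \<epsilon>\<close> by (simp add: mult_left_le)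
      finally show ?thesis .
    qed
    moreover have "(\<Sum>(x, K)\<in>pN. norm (h (Sup K) - h (Inf K))) < \<epsilon>"
    proof -
      define D where "D = (\<lambda>(x, K). (Inf K, Sup K)) ` pN"
      \<comment> \<open>Tagged intervals with the same endpoints overlap unless they are degenerate, so forgetting the tags loses only terms \<open>F a a\<close>.\<close>
      have sum_eq: "(\<Sum>(x, K)\<in>pN. F (Inf K) (Sup K)) = (\<Sum>(a, b)\<in>D. F a b)"
        if F: "\<And>a. F a a = 0" for F :: "real \<Rightarrow> real \<Rightarrow> real"
      proof -
        have "(\<Sum>(a, b)\<in>D. F a b) = sum ((\<lambda>(a, b). F a b) \<circ> (\<lambda>(x, K). (Inf K, Sup K))) pN"
          unfolding D_def
        proof (rule sum.reindex_nontrivial)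
          show "finite pN" using \<open>finite p\<close> by (auto simp: pN_def intro: finite_subset)
          fix y z assume yz: "y \<in> pN" "z \<in> pN" "y \<noteq> z"
            and eq: "(\<lambda>(x, K). (Inf K, Sup K)) y = (\<lambda>(x, K). (Inf K, Sup K)) z"
          obtain x K x' K' where y: "y = (x, K)" and z: "z = (x', K')" by (cases y; cases z)
          have "(x, K) \<in> p" "(x', K') \<in> p" using yz y z by (auto simp: pN_def)
          note pp = this
          then have "interior K \<inter> interior K' = {}"
            using tagged_division_ofD(5)[OF p(1) pp] yz(3) y z by blast
          moreover obtain a b where "K = {a..b}" "a \<le> b" "Inf K = a" "Sup K = b" using pK[OF pp(1)] by force
          moreover obtain a' b' where "K' = {a'..b'}" "a' \<le> b'" "Inf K' = a'" "Sup K' = b'" using pK[OF pp(2)] by force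
          ultimately have "Inf K = Sup K" using eq y z
            by (auto simp: interior_cbox)
          then show "(\<lambda>(a, b). F a b) ((\<lambda>(x, K). (Inf K, Sup K)) y) = 0" using y F by simp
        qed
        also have "\<dots> = (\<Sum>(x, K)\<in>pN. F (Inf K) (Sup K))"
          by (intro sum.cong) auto
        finally show ?thesis by simp
      qed
      have D01: "a \<le> b \<and> {a..b} \<subseteq> {0..1} \<and> {a<..<b} \<subseteq> U" if ab: "(a, b) \<in> D" for a b
      proof -
        obtain x K where K: "a = Inf K" "b = Sup K" "(x, K) \<in> p" "x \<in> N"
          using ab unfolding D_def pN_def by auto
        then show "a \<le> b \<and> {a..b} \<subseteq> {0..1} \<and> {a<..<b} \<subseteq> U"
          using pK[OF K(3)] r by (force simp: g_def subset_iff)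
      qed
      have D: "nonoverlapping {0..1} D" unfolding nonoverlapping_def pairwise_def
      proof (intro conjI ballI impI)
        show "finite D" unfolding D_def pN_def
          using finite_subset[OF _ \<open>finite p\<close>, of "{(x, K) \<in> p. x \<in> N}"] by auto
      next
        fix u v assume uv: "u \<in> D" "v \<in> D" "u \<noteq> v"
        then obtain x K x' K' where y: "u = (Inf K, Sup K)" "(x, K) \<in> p" and z: "v = (Inf K', Sup K')" "(x', K') \<in> p"
          unfolding D_def pN_def by auto
        have "(x, K) \<noteq> (x', K')" using uv(3) y z by auto
        then have "interior K \<inter> interior K' = {}"
          using tagged_division_ofD(5)[OF p(1) y(2) z(2)] by blast
        moreover obtain a b where ab: "K = {a..b}" "Inf K = a" "Sup K = b" using pK[OF y(2)] by blast
        moreover obtain a' b' where ab': "K' = {a'..b'}" "Inf K' = a'" "Sup K' = b'" using pK[OF z(2)] by blast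
        ultimately show "{fst u<..<snd u} \<inter> {fst v<..<snd v} = {}"
          using ab(1) ab'(1) ab'(1,2) y(1) z(1)
          by (simp add: interior_atLeastAtMost_real)
      qed (use D01 in auto)
      have "(\<Sum>(a, b)\<in>D. b - a) < \<delta>"
        using total_length_le_measure[OF D _ U(3)] D01 U(4) by fastforce
      then have "(\<Sum>(a, b)\<in>D. norm (h b - h a)) < \<epsilon>" using d[OF D] by simp
      then show ?thesis using sum_eq[of "\<lambda>a b. norm (h b - h a)"] by simp
    qed
    ultimately show ?thesis by linarith
  qed
  have "norm (h r - h 0) \<le> 0"
  proof (rule field_le_epsilon)
    fix e :: real assume "0 < e"
    then show "norm (h r - h 0) \<le> 0 + e" using main[of "e/2"] by simp
  qed
  then show ?thesis by simp
qed


section \<open>Differentiability almost everywhere\<close>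

text \<open>
  Vitali's theorem gives a countable disjoint family covering \<open>E\<close> up to a null set; a finite part
  of it already covers \<open>E\<close> up to measure \<open>\<eta>\<close>.
\<close>

lemma vitali_finite_subfamily:
  assumes E: "E \<in> lmeasurable" and "0 < \<eta>"
    and K: "\<And>u v. (u, v) \<in> K \<Longrightarrow> u < v \<and> {u..v} \<subseteq> S"
    and cover: "\<And>x d. x \<in> E \<Longrightarrow> 0 < d \<Longrightarrow> \<exists>u v. (u, v) \<in> K \<and> u < x \<and> x < v \<and> v - u < d"
  obtains D where "D \<subseteq> K" "nonoverlapping S D"
    "measure lebesgue (E - (\<Union>(a, b)\<in>D. {a<..<b})) < \<eta>"
proof -
  define c where "c = (\<lambda>p::real \<times> real. (fst p + snd p) / 2)"
  define r where "r = (\<lambda>p::real \<times> real. (snd p - fst p) / 2)"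
  have ball: "ball (c p) (r p) = {fst p<..<snd p}" for p
    unfolding c_def r_def ball_eq_greaterThanLessThan by (simp add: field_simps)
  have *: "\<exists>i. i \<in> K \<and> x \<in> ball (c i) (r i) \<and> r i < d" if xd: "x \<in> E" "0 < d" for x d
  proof -
    obtain u v where "(u, v) \<in> K" "u < x" "x < v" "v - u < d" using cover[OF xd] by blast
    then have "(u, v) \<in> K \<and> x \<in> ball (c (u, v)) (r (u, v)) \<and> r (u, v) < d"
      unfolding ball by (auto simp: r_def)
    then show ?thesis by blast
  qed
  obtain C where C: "countable C" "C \<subseteq> K"
     "pairwise (\<lambda>i j. disjnt (ball (c i) (r i)) (ball (c j) (r j))) C"
     "negligible(E - (\<Union>i \<in> C. ball (c i) (r i)))"
    using Vitali_covering_theorem_balls[of E K c r, OF *] by blast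
  note C = C[unfolded ball disjnt_def]
  have no: "nonoverlapping S D" if "finite D" "D \<subseteq> C" for D
  proof -
    have "\<forall>(a, b)\<in>D. a \<le> b \<and> {a..b} \<subseteq> S"
    proof clarify
      fix a b assume "(a, b) \<in> D"
      then have "(a, b) \<in> K" using that C(2) by blast
      then show "a \<le> b \<and> {a..b} \<subseteq> S" using K less_imp_le by blast
    qed
    then show ?thesis unfolding nonoverlapping_def using that pairwise_subset[OF C(3)] by blast
  qed
  show thesis
  proof (cases "C = {}")
    case True
    then have "negligible E" using C(4) by simp
    then show thesis using that[of "{}"] no[of "{}"] \<open>0 < \<eta>\<close> by (simp add: negligible_imp_measure0)
  next
    case False
    define g where "g = from_nat_into C"
    have rg: "range g = C" unfolding g_def using range_from_nat_into[OF False C(1)] .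
    define A where "A n = E - (\<Union>p\<in>g ` {..n}. {fst p<..<snd p})" for n :: nat
    have Ameas: "A n \<in> lmeasurable" for n
      unfolding A_def using E by (intro fmeasurable_Diff) auto
    have "(\<lambda>n. measure lebesgue (A n)) \<longlonglongrightarrow> measure lebesgue (\<Inter>n. A n)"
    proof (rule Lim_measure_decseq)
      show "range A \<subseteq> sets lebesgue" using Ameas by auto
      show "decseq A" unfolding decseq_def A_def by force
      show "emeasure lebesgue (A i) \<noteq> \<infinity>" for i using fmeasurableD2[OF Ameas] by (simp only: infinity_ennreal_def not_False_eq_True simp_thms)
    qed
    moreover have "(\<Inter>n. A n) = E - (\<Union>p\<in>C. {fst p<..<snd p})"
      unfolding A_def rg[symmetric] by auto
    then have "measure lebesgue (\<Inter>n. A n) = 0" using C(4) negligible_imp_measure0 by simp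
    ultimately have "(\<lambda>n. measure lebesgue (A n)) \<longlonglongrightarrow> 0" by simp
    then have "\<forall>\<^sub>F n in sequentially. measure lebesgue (A n) < \<eta>"
      using \<open>0 < \<eta>\<close> order_tendstoD(2) by blast
    then obtain n where n: "measure lebesgue (A n) < \<eta>" by (auto simp: eventually_sequentially)
    have "g ` {..n} \<subseteq> C" using rg by auto
    then show thesis using that[of "g ` {..n}"] no[of "g ` {..n}"] C(2) n
      by (auto simp: A_def case_prod_unfold)
  qed
qed

text \<open>
  The gaps that \<open>D2\<close> leaves inside \<open>D1\<close> again form a nonoverlapping family \<open>R\<close>, so that increments over
  \<open>D1\<close> and \<open>D2\<close> can be compared by absolute continuity on \<open>R\<close>. The last conjunct is what makes the induction
  work: an interval still to be removed lies inside a single member of \<open>R\<close>, which it splits in two.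
\<close>

lemma nonoverlapping_remainder:
  assumes "finite D2" "nonoverlapping S D1" "nonoverlapping S D2"
    and "\<And>a b. (a, b) \<in> D1 \<Longrightarrow> a < b" "\<And>u v. (u, v) \<in> D2 \<Longrightarrow> u < v"
    and "\<And>u v. (u, v) \<in> D2 \<Longrightarrow> \<exists>(a, b)\<in>D1. a \<le> u \<and> v \<le> b"
  shows "\<exists>R. nonoverlapping S R \<and> (\<forall>(a, b)\<in>R. a < b) \<and>
    (\<forall>g :: real \<Rightarrow> real. (\<Sum>(a, b)\<in>R. g b - g a) = (\<Sum>(a, b)\<in>D1. g b - g a) - (\<Sum>(a, b)\<in>D2. g b - g a)) \<and>
    (\<forall>u v. u < v \<longrightarrow> (\<exists>(a, b)\<in>D1. a \<le> u \<and> v \<le> b) \<longrightarrow> (\<forall>(a, b)\<in>D2. {u<..<v} \<inter> {a<..<b} = {}) \<longrightarrow>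
       (\<exists>(a, b)\<in>R. a \<le> u \<and> v \<le> b))"
  using assms
proof (induction D2)
  case empty
  then show ?case by (intro exI[of _ D1]) auto
next
  case (insert p D2)
  obtain u v where p: "p = (u, v)" by (cases p)
  have uv: "u < v" using insert.prems(4) p by blast
  have no2: "nonoverlapping S D2" using insert.prems(2) nonoverlapping_subset by blast
  have disj: "{u<..<v} \<inter> {a<..<b} = {}" if "(a, b) \<in> D2" for a b
  proof -
    have "(a, b) \<noteq> (u, v)" using that insert.hyps p by auto
    then show ?thesis using insert.prems(2) that p unfolding nonoverlapping_def pairwise_def by force
  qed
  obtain R where R: "nonoverlapping S R" "\<forall>(a, b)\<in>R. a < b"
    "\<And>g :: real \<Rightarrow> real. (\<Sum>(a, b)\<in>R. g b - g a) = (\<Sum>(a, b)\<in>D1. g b - g a) - (\<Sum>(a, b)\<in>D2. g b - g a)"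
    "\<And>u v. u < v \<Longrightarrow> (\<exists>(a, b)\<in>D1. a \<le> u \<and> v \<le> b) \<Longrightarrow> (\<forall>(a, b)\<in>D2. {u<..<v} \<inter> {a<..<b} = {}) \<Longrightarrow>
       (\<exists>(a, b)\<in>R. a \<le> u \<and> v \<le> b)"
    using insert.IH[OF insert.prems(1) no2 insert.prems(3)] insert.prems(4,5) by auto
  obtain a b where ab: "(a, b) \<in> R" "a \<le> u" "v \<le> b"
    using R(4)[OF uv] insert.prems(5)[of u v] p disj by blast
  define A where "A = (if a < u then {(a, u)} else {})"
  define B where "B = (if v < b then {(v, b)} else {})"
  define R0 where "R0 = R - {(a, b)}"
  have R0: "{c<..<d} \<inter> {a<..<b} = {}" "c < d" "{c..d} \<subseteq> S" if "(c, d) \<in> R0" for c d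
  proof -
    have cd: "(c, d) \<in> R" "(c, d) \<noteq> (a, b)" using that by (auto simp: R0_def)
    show "{c<..<d} \<inter> {a<..<b} = {}"
      using R(1) pairwiseD[OF _ cd(1) ab(1) cd(2)] unfolding nonoverlapping_def fst_conv snd_conv
      by fastforce
    show "c < d" using R(2) cd by blast
    show "{c..d} \<subseteq> S" using R(1) cd(1) unfolding nonoverlapping_def by blast
  qed
  have finR: "finite R" "finite R0" using R(1) by (auto simp: nonoverlapping_def R0_def)
  have sub: "{a..b} \<subseteq> S" using R(1) ab unfolding nonoverlapping_def by blast
  have AB: "{c<..<d} \<noteq> {} \<and> {c<..<d} \<subseteq> {a<..<b} \<and> c < d \<and> {c..d} \<subseteq> S" if "(c, d) \<in> A \<union> B" for c d
    using that ab uv sub by (auto simp: A_def B_def split: if_splits)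
  have dA: "A \<inter> B = {}" using uv by (auto simp: A_def B_def)
  have d0: "R0 \<inter> (A \<union> B) = {}"
  proof (intro equals0I, elim IntE)
    fix z assume z: "z \<in> R0" "z \<in> A \<union> B"
    obtain c d where "z = (c, d)" by (cases z)
    then show False using R0(1)[of c d] AB[of c d] z by blast
  qed
  show ?case
  proof (intro exI[of _ "R0 \<union> (A \<union> B)"] conjI allI impI)
    show "nonoverlapping S (R0 \<union> (A \<union> B))" unfolding nonoverlapping_def
    proof (intro conjI)
      show "finite (R0 \<union> (A \<union> B))" using finR by (auto simp: A_def B_def)
      show "\<forall>(c, d)\<in>R0 \<union> (A \<union> B). c \<le> d \<and> {c..d} \<subseteq> S"
        using R0(2,3) AB less_imp_le by blast
      have 1: "{c<..<d} \<inter> {c'<..<d'} = {}" if "(c, d) \<in> R0" "(c', d') \<in> R0" "(c, d) \<noteq> (c', d')" for c d c' d'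
        using that R(1) unfolding nonoverlapping_def pairwise_def R0_def by force
      have 2: "{c<..<d} \<inter> {c'<..<d'} = {}" if "(c, d) \<in> R0" "(c', d') \<in> A \<union> B" for c d c' d'
        using R0(1)[OF that(1)] AB[OF that(2)] by blast
      have 3: "{c<..<d} \<inter> {c'<..<d'} = {}" if "(c, d) \<in> A \<union> B" "(c', d') \<in> A \<union> B" "(c, d) \<noteq> (c', d')" for c d c' d'
        using that uv by (auto simp: A_def B_def split: if_splits)
      show "pairwise (\<lambda>p q. {fst p<..<snd p} \<inter> {fst q<..<snd q} = {}) (R0 \<union> (A \<union> B))"
      proof (rule pairwiseI)
        fix x y assume xy: "x \<in> R0 \<union> (A \<union> B)" "y \<in> R0 \<union> (A \<union> B)" "x \<noteq> y"
        obtain c d c' d' where e: "x = (c, d)" "y = (c', d')" by (cases x; cases y)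
        show "{fst x<..<snd x} \<inter> {fst y<..<snd y} = {}"
          using xy unfolding e fst_conv snd_conv
          by (metis "1" "2" "3" Int_commute UnE)
      qed
    qed
    show "\<forall>(c, d)\<in>R0 \<union> (A \<union> B). c < d" using R0(2) AB by blast
  next
    fix g :: "real \<Rightarrow> real"
    have sA: "(\<Sum>(c, d)\<in>A. g d - g c) = g u - g a" using ab by (auto simp: A_def)
    have sB: "(\<Sum>(c, d)\<in>B. g d - g c) = g b - g v" using ab by (auto simp: B_def)
    have "(\<Sum>(c, d)\<in>R0 \<union> (A \<union> B). g d - g c) = (\<Sum>(c, d)\<in>R0. g d - g c) + ((g u - g a) + (g b - g v))"
    proof -
      have fAB: "finite A" "finite B" by (auto simp: A_def B_def)
      have "(\<Sum>(c, d)\<in>A \<union> B. g d - g c) = (g u - g a) + (g b - g v)"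
        unfolding sum.union_disjoint[OF fAB dA] sA sB ..
      moreover have "finite (A \<union> B)" using fAB by simp
      ultimately show ?thesis using sum.union_disjoint[OF finR(2) _ d0, of "\<lambda>(c, d). g d - g c"] by simp
    qed
    also have "(\<Sum>(c, d)\<in>R0. g d - g c) = (\<Sum>(c, d)\<in>R. g d - g c) - (g b - g a)"
      unfolding R0_def using finR ab by (simp add: sum_diff1)
    finally show "(\<Sum>(c, d)\<in>R0 \<union> (A \<union> B). g d - g c) =
        (\<Sum>(a, b)\<in>D1. g b - g a) - (\<Sum>(a, b)\<in>insert p D2. g b - g a)"
      using R(3)[of g] insert.hyps p by simp
  next
    fix u' v' :: real assume h: "u' < v'" "\<exists>(a, b)\<in>D1. a \<le> u' \<and> v' \<le> b"
      "\<forall>(a, b)\<in>insert p D2. {u'<..<v'} \<inter> {a<..<b} = {}"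
    then obtain c d where cd: "(c, d) \<in> R" "c \<le> u'" "v' \<le> d"
      using R(4)[OF h(1,2)] by blast
    show "\<exists>(c, d)\<in>R0 \<union> (A \<union> B). c \<le> u' \<and> v' \<le> d"
    proof (cases "(c, d) = (a, b)")
      case False
      then show ?thesis using cd by (auto simp: R0_def)
    next
      case True
      have "{u'<..<v'} \<inter> {u<..<v} = {}" using h(3) p by blast
      then have "v' \<le> u \<or> v \<le> u'" using h(1) uv
        by (auto simp: min_def max_def split: if_splits)
      then show ?thesis using True cd h(1) by (auto simp: A_def B_def)
    qed
  qed
qed

text \<open>
  Let \<open>s\<close> be the measure of \<open>E\<close>. Vitali's theorem covers almost all of \<open>E\<close>, inside an open set of measure
  about \<open>s\<close>, by intervals of slope less than \<open>p\<close>, and then again, inside these intervals, by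
  intervals of slope greater than \<open>q\<close>. Both families have total length about \<open>s\<close>, hence the gaps are short and
  carry almost no increment. So about \<open>q s\<close> is at most about \<open>p s\<close>, which forces \<open>s = 0\<close>.
\<close>

lemma straddle_oscillation_negligible:
  fixes f :: "real \<Rightarrow> real"
  assumes ac: "abs_continuous_on {0..1} f" and "p < q" and E: "E \<in> lmeasurable"
    and lo: "\<And>x d. x \<in> E \<Longrightarrow> 0 < d \<Longrightarrow>
      \<exists>u v. 0 \<le> u \<and> u < x \<and> x < v \<and> v \<le> 1 \<and> v - u < d \<and> f v - f u < p * (v - u)"
    and hi: "\<And>x d. x \<in> E \<Longrightarrow> 0 < d \<Longrightarrow>
      \<exists>u v. 0 \<le> u \<and> u < x \<and> x < v \<and> v \<le> 1 \<and> v - u < d \<and> f v - f u > q * (v - u)"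
  shows "negligible E"
proof -
  define s where "s = measure lebesgue E"
  have main: "s * (q - p) \<le> \<epsilon> * (1 + 2 * \<bar>p\<bar> + 2 * \<bar>q\<bar>)" if "0 < \<epsilon>" for \<epsilon>
  proof -
    obtain \<delta> where "0 < \<delta>" and d: "\<And>D. nonoverlapping {0..1} D \<Longrightarrow>
       (\<Sum>(a, b)\<in>D. b - a) < \<delta> \<Longrightarrow> (\<Sum>(a, b)\<in>D. norm (f b - f a)) < \<epsilon>"
      using abs_continuous_onD[OF ac \<open>0 < \<epsilon>\<close>] by blast
    \<comment> \<open>The gaps will have total length below \<open>3 \<eta>\<close>.\<close>
    define \<eta> where "\<eta> = min \<delta> \<epsilon> / 3"
    have \<eta>: "0 < \<eta>" "3 * \<eta> \<le> \<delta>" "\<eta> \<le> \<epsilon>" using \<open>0 < \<delta>\<close> \<open>0 < \<epsilon>\<close> by (auto simp: \<eta>_def)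
    obtain U where U: "open U" "E \<subseteq> U" "U - E \<in> lmeasurable" "emeasure lebesgue (U - E) < ennreal \<eta>"
      using sets_lebesgue_outer_open[of E \<eta>] E \<eta> by blast
    have "U = (U - E) \<union> E" using U by auto
    then have Um: "U \<in> lmeasurable" using U(3) E by (metis fmeasurable.Un)
    have "measure lebesgue (U - E) < \<eta>"
      using U(3,4) \<eta> by (simp add: emeasure_eq_measure2 ennreal_less_iff)
    then have mU: "measure lebesgue U < s + \<eta>"
      using measurable_measure_Diff[OF Um fmeasurableD[OF E] U(2)] by (simp add: s_def)
    define K1 where "K1 = {(u, v). u < v \<and> {u..v} \<subseteq> {0..1} \<and> {u<..<v} \<subseteq> U \<and> f v - f u < p * (v - u)}"
    have K1: "u < v \<and> {u..v} \<subseteq> {0..1}" if "(u, v) \<in> K1" for u v using that by (auto simp: K1_def)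
    have cov1: "\<exists>u v. (u, v) \<in> K1 \<and> u < x \<and> x < v \<and> v - u < d" if x: "x \<in> E" and "0 < d" for x d
    proof -
      obtain e where e: "e > 0" "ball x e \<subseteq> U" using U x by (meson open_contains_ball subsetD)
      then have "0 < min d e" using \<open>0 < d\<close> by simp
      then obtain u v where uv: "0 \<le> u" "u < x" "x < v" "v \<le> 1" "v - u < min d e" "f v - f u < p * (v - u)"
        using lo[OF x] by meson
      have "{u<..<v} \<subseteq> ball x e" using uv by (auto simp: dist_real_def)
      then show ?thesis using uv e by (intro exI[of _ u] exI[of _ v]) (auto simp: K1_def)
    qed
    obtain D1 where D1: "D1 \<subseteq> K1" "nonoverlapping {0..1} D1"
      "measure lebesgue (E - (\<Union>(a, b)\<in>D1. {a<..<b})) < \<eta>"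
      by (rule vitali_finite_subfamily[OF E \<eta>(1) K1 cov1])
    have fin1: "finite D1" using D1(2) by (simp add: nonoverlapping_def)
    define V1 where "V1 = (\<Union>(a, b)\<in>D1. {a<..<b})"
    have V1m: "V1 \<in> sets lebesgue" unfolding V1_def using fin1 by (auto intro!: sets.finite_UN)
    define E1 where "E1 = E \<inter> V1"
    have E1: "E1 \<in> lmeasurable" unfolding E1_def using E V1m by (rule fmeasurable_Int_fmeasurable)
    define K2 where "K2 = {(u, v). u < v \<and> {u..v} \<subseteq> {0..1} \<and> (\<exists>(a, b)\<in>D1. a \<le> u \<and> v \<le> b) \<and> f v - f u > q * (v - u)}"
    have K2: "u < v \<and> {u..v} \<subseteq> {0..1}" if "(u, v) \<in> K2" for u v using that by (auto simp: K2_def)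
    have cov2: "\<exists>u v. (u, v) \<in> K2 \<and> u < x \<and> x < v \<and> v - u < d" if x: "x \<in> E1" and "0 < d" for x d
    proof -
      obtain a b where ab: "(a, b) \<in> D1" "a < x" "x < b" using x by (auto simp: E1_def V1_def)
      then have "0 < min d (min (x - a) (b - x))" using \<open>0 < d\<close> by simp
      moreover have "x \<in> E" using x by (simp add: E1_def)
      ultimately obtain u v where uv: "0 \<le> u" "u < x" "x < v" "v \<le> 1" "v - u < min d (min (x - a) (b - x))"
        "f v - f u > q * (v - u)"
        using hi by meson
      then have "a \<le> u \<and> v \<le> b" by auto
      then have "\<exists>(a, b)\<in>D1. a \<le> u \<and> v \<le> b" using ab(1) by blast
      then show ?thesis using uv by (intro exI[of _ u] exI[of _ v]) (auto simp: K2_def)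
    qed
    obtain D2 where D2: "D2 \<subseteq> K2" "nonoverlapping {0..1} D2"
      "measure lebesgue (E1 - (\<Union>(a, b)\<in>D2. {a<..<b})) < \<eta>"
      by (rule vitali_finite_subfamily[OF E1 \<eta>(1) K2 cov2])
    have fin2: "finite D2" using D2(2) by (simp add: nonoverlapping_def)
    define V2 where "V2 = (\<Union>(a, b)\<in>D2. {a<..<b})"
    have V2m: "V2 \<in> sets lebesgue" unfolding V2_def using fin2 by (auto intro!: sets.finite_UN)
    define S1 where "S1 = (\<Sum>(a, b)\<in>D1. b - a)"
    define S2 where "S2 = (\<Sum>(a, b)\<in>D2. b - a)"
    obtain R where R: "nonoverlapping {0..1} R"
      "\<And>g :: real \<Rightarrow> real. (\<Sum>(a, b)\<in>R. g b - g a) = (\<Sum>(a, b)\<in>D1. g b - g a) - (\<Sum>(a, b)\<in>D2. g b - g a)"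
      "\<forall>(a, b)\<in>R. a < b"
    proof -
      have "\<And>a b. (a, b) \<in> D1 \<Longrightarrow> a < b" using D1(1) by (auto simp: K1_def)
      moreover have "\<And>a b. (a, b) \<in> D2 \<Longrightarrow> a < b" "\<And>u v. (u, v) \<in> D2 \<Longrightarrow> \<exists>(a, b)\<in>D1. a \<le> u \<and> v \<le> b"
        using D2(1) by (auto simp: K2_def)
      ultimately show thesis using nonoverlapping_remainder[OF fin2 D1(2) D2(2)] that by blast
    qed
    have "S1 \<le> measure lebesgue U"
      unfolding S1_def using D1 by (intro total_length_le_measure[OF D1(2) _ Um]) (auto simp: K1_def)
    with mU have S1: "S1 < s + \<eta>" by simp
    have "S2 = measure lebesgue V2" using measure_nonoverlapping[OF D2(2)] by (simp add: S2_def V2_def)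
    moreover have "s \<le> measure lebesgue V2 + measure lebesgue (E - V1) + measure lebesgue (E1 - V2)"
    proof -
      have m: "V2 \<in> lmeasurable" "E - V1 \<in> lmeasurable" "E1 - V2 \<in> lmeasurable"
        using E E1 V1m V2m fin2 by (auto simp: V2_def intro!: fmeasurable_Diff fmeasurable.finite_UN)
      have "s \<le> measure lebesgue (V2 \<union> (E - V1) \<union> (E1 - V2))"
        unfolding s_def using E m by (intro measure_mono_fmeasurable) (auto simp: E1_def)
      also have "\<dots> \<le> measure lebesgue (V2 \<union> (E - V1)) + measure lebesgue (E1 - V2)"
        using m by (intro measure_Un_le) auto
      also have "measure lebesgue (V2 \<union> (E - V1)) \<le> measure lebesgue V2 + measure lebesgue (E - V1)"
        using m by (intro measure_Un_le) auto
      finally show ?thesis by simp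
    qed
    ultimately have S2: "S2 > s - 2 * \<eta>" using D1(3) D2(3) by (simp add: V1_def V2_def)
    have "(\<Sum>(a, b)\<in>R. b - a) = S1 - S2" using R(2)[of "\<lambda>x. x"] by (simp add: S1_def S2_def)
    moreover have "(\<Sum>(a, b)\<in>R. b - a) \<ge> 0" using R(3) by (intro sum_nonneg) auto
    ultimately have "S2 \<le> S1" and "(\<Sum>(a, b)\<in>R. b - a) < \<delta>" using S1 S2 \<eta> by auto
    then have "(\<Sum>(a, b)\<in>R. norm (f b - f a)) < \<epsilon>" using d R(1) by blast
    moreover have "- (\<Sum>(a, b)\<in>R. f b - f a) \<le> (\<Sum>(a, b)\<in>R. norm (f b - f a))"
      unfolding sum_negf[symmetric] by (intro sum_mono) auto
    moreover have "(\<Sum>(a, b)\<in>D1. f b - f a) \<le> p * S1"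
      unfolding S1_def sum_distrib_left using D1(1) by (intro sum_mono) (auto simp: K1_def)
    moreover have "(\<Sum>(a, b)\<in>D2. f b - f a) \<ge> q * S2"
      unfolding S2_def sum_distrib_left using D2(1) by (intro sum_mono) (auto simp: K2_def)
    ultimately have "q * S2 - p * S1 < \<epsilon>" using R(2)[of f] by simp
    moreover have "\<bar>S2 - s\<bar> \<le> 2 * \<epsilon>" "\<bar>S1 - s\<bar> \<le> 2 * \<epsilon>" using S1 S2 \<open>S2 \<le> S1\<close> \<eta> by auto
    then have "\<bar>q * (S2 - s)\<bar> \<le> \<bar>q\<bar> * (2 * \<epsilon>)" "\<bar>p * (S1 - s)\<bar> \<le> \<bar>p\<bar> * (2 * \<epsilon>)"
      unfolding abs_mult by (auto intro!: mult_left_mono)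
    ultimately show ?thesis by (simp add: algebra_simps abs_le_iff)
  qed
  have "s * (q - p) \<le> 0"
  proof (rule field_le_epsilon)
    fix e :: real assume "0 < e"
    have "0 < 1 + 2 * \<bar>p\<bar> + 2 * \<bar>q\<bar>" by simp
    then show "s * (q - p) \<le> 0 + e"
      using main[of "e / (1 + 2 * \<bar>p\<bar> + 2 * \<bar>q\<bar>)"] \<open>0 < e\<close> by simp
  qed
  then have "s \<le> 0" using \<open>p < q\<close> by (simp add: mult_le_0_iff)
  then have "measure lebesgue E = 0" unfolding s_def using measure_nonneg order_antisym by blast
  then show ?thesis using E by (simp add: negligible_iff_measure)
qed

text \<open>
  By absolute continuity, increments over intervals of total length less than some \<open>\<delta>\<close> add up to less than \<open>1\<close>.
  Such intervals, if all their slopes exceed \<open>1/\<epsilon>\<close>, have total length less than \<open>\<epsilon>\<close>.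
\<close>

lemma straddle_infinite_negligible:
  fixes f :: "real \<Rightarrow> real"
  assumes ac: "abs_continuous_on {0..1} f" and E: "E \<in> lmeasurable"
    and hi: "\<And>x d q. x \<in> E \<Longrightarrow> 0 < d \<Longrightarrow>
      \<exists>u v. 0 \<le> u \<and> u < x \<and> x < v \<and> v \<le> 1 \<and> v - u < d \<and> f v - f u > q * (v - u)"
  shows "negligible E"
proof -
  obtain \<delta> where "0 < \<delta>" and d: "\<And>D. nonoverlapping {0..1} D \<Longrightarrow>
       (\<Sum>(a, b)\<in>D. b - a) < \<delta> \<Longrightarrow> (\<Sum>(a, b)\<in>D. norm (f b - f a)) < 1"
    using abs_continuous_onD[OF ac zero_less_one] by blast
  have local: "negligible (E \<inter> {c<..<c + \<delta>/2})" for c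
  proof -
    define F where "F = E \<inter> {c<..<c + \<delta>/2}"
    have F: "F \<in> lmeasurable" unfolding F_def using E by (intro fmeasurable_Int_fmeasurable) auto
    define s where "s = measure lebesgue F"
    have main: "s \<le> \<epsilon> + \<epsilon>" if "0 < \<epsilon>" for \<epsilon>
    proof -
      define K where "K = {(u, v). u < v \<and> {u..v} \<subseteq> {0..1} \<and> {u<..<v} \<subseteq> {c<..<c + \<delta>/2} \<and> f v - f u > (1/\<epsilon>) * (v - u)}"
      have K: "u < v \<and> {u..v} \<subseteq> {0..1}" if "(u, v) \<in> K" for u v using that by (auto simp: K_def)
      have cov: "\<exists>u v. (u, v) \<in> K \<and> u < x \<and> x < v \<and> v - u < d" if x: "x \<in> F" and "0 < d" for x d
      proof -
        have "0 < min d (min (x - c) (c + \<delta>/2 - x))" using x \<open>0 < d\<close> by (auto simp: F_def)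
        moreover have "x \<in> E" using x by (simp add: F_def)
        ultimately obtain u v where uv: "0 \<le> u" "u < x" "x < v" "v \<le> 1" "v - u < min d (min (x - c) (c + \<delta>/2 - x))"
          "f v - f u > (1/\<epsilon>) * (v - u)"
          using hi[of x "min d (min (x - c) (c + \<delta>/2 - x))" "1/\<epsilon>"] by blast
        then have "{u<..<v} \<subseteq> {c<..<c + \<delta>/2}" by auto
        then show ?thesis using uv by (intro exI[of _ u] exI[of _ v]) (auto simp: K_def)
      qed
      obtain D where D: "D \<subseteq> K" "nonoverlapping {0..1} D"
        "measure lebesgue (F - (\<Union>(a, b)\<in>D. {a<..<b})) < \<epsilon>"
        by (rule vitali_finite_subfamily[OF F \<open>0 < \<epsilon>\<close> K cov])
      have fin: "finite D" using D(2) by (simp add: nonoverlapping_def)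
      define V where "V = (\<Union>(a, b)\<in>D. {a<..<b})"
      have Vm: "V \<in> lmeasurable" unfolding V_def using fin by (auto intro!: fmeasurable.finite_UN)
      define S where "S = (\<Sum>(a, b)\<in>D. b - a)"
      have SV: "S = measure lebesgue V" using measure_nonoverlapping[OF D(2)] by (simp add: S_def V_def)
      have "s \<le> measure lebesgue (V \<union> (F - V))"
        unfolding s_def using F Vm by (intro measure_mono_fmeasurable) auto
      also have "\<dots> \<le> measure lebesgue V + measure lebesgue (F - V)"
        using F Vm by (intro measure_Un_le) auto
      finally have "s \<le> S + \<epsilon>" using D(3) SV by (simp add: V_def)
      have "S \<le> measure lebesgue {c<..<c + \<delta>/2}"
        unfolding S_def using D by (intro total_length_le_measure[OF D(2)]) (auto simp: K_def)
      then have "S < \<delta>" using \<open>0 < \<delta>\<close> by simp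
      then have "(\<Sum>(a, b)\<in>D. norm (f b - f a)) < 1" using d[OF D(2)] by (simp add: S_def)
      moreover have "(\<Sum>(a, b)\<in>D. norm (f b - f a)) \<ge> (1/\<epsilon>) * S"
        unfolding S_def sum_distrib_left using D(1) by (intro sum_mono) (fastforce simp: K_def)
      ultimately have "(1/\<epsilon>) * S < 1" by linarith
      then have "S < \<epsilon>" using \<open>0 < \<epsilon>\<close> by (simp add: field_simps)
      then show ?thesis using \<open>s \<le> S + \<epsilon>\<close> by simp
    qed
    have "s \<le> 0"
    proof (rule field_le_epsilon)
      fix e :: real assume "0 < e"
      then show "s \<le> 0 + e" using main[of "e/2"] by simp
    qed
    then have "measure lebesgue F = 0" unfolding s_def using measure_nonneg order_antisym by blast
    then show ?thesis using F unfolding F_def by (simp add: negligible_iff_measure)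
  qed
  have "E \<subseteq> (\<Union>q\<in>\<rat>. E \<inter> {q<..<q + \<delta>/2})"
  proof
    fix x assume "x \<in> E"
    obtain q where "q \<in> \<rat>" "x - \<delta>/2 < q" "q < x" using Rats_dense_in_real[of "x - \<delta>/2" x] \<open>0 < \<delta>\<close> by auto
    then show "x \<in> (\<Union>q\<in>\<rat>. E \<inter> {q<..<q + \<delta>/2})" using \<open>x \<in> E\<close> by auto
  qed
  moreover have "negligible (\<Union>q\<in>\<rat>. E \<inter> {q<..<q + \<delta>/2})"
    by (rule negligible_countable_Union[of "(\<lambda>q. E \<inter> {q<..<q + \<delta>/2}) ` \<rat>"])
      (use local countable_rat in auto)
  ultimately show ?thesis using negligible_subset by blast
qed


text \<open>
  Upper derivates are treated through their superlevel sets. Requiring the point to lie in the interior of the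
  intervals makes these sets countable intersections of open sets, hence measurable, for every \<open>f\<close>.
\<close>

definition steep :: "(real \<Rightarrow> real) \<Rightarrow> real \<Rightarrow> real set" where
  "steep f q = {x. \<forall>d>0. \<exists>u v. 0 \<le> u \<and> u < x \<and> x < v \<and> v \<le> 1 \<and> v - u < d \<and> f v - f u > q * (v - u)}"

lemma steepD:
  "x \<in> steep f q \<Longrightarrow> 0 < d \<Longrightarrow>
    \<exists>u v. 0 \<le> u \<and> u < x \<and> x < v \<and> v \<le> 1 \<and> v - u < d \<and> f v - f u > q * (v - u)"
  by (simp add: steep_def)

lemma steep_antimono:
  assumes "p \<le> q" shows "steep f q \<subseteq> steep f p"
proof
  fix x assume x: "x \<in> steep f q"
  show "x \<in> steep f p" unfolding steep_def
  proof (intro CollectI allI impI)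
    fix d :: real assume "0 < d"
    obtain u v where uv: "0 \<le> u" "u < x" "x < v" "v \<le> 1" "v - u < d" "f v - f u > q * (v - u)"
      using steepD[OF x \<open>0 < d\<close>] by blast
    have "p * (v - u) \<le> q * (v - u)" using assms uv by (intro mult_right_mono) auto
    then show "\<exists>u v. 0 \<le> u \<and> u < x \<and> x < v \<and> v \<le> 1 \<and> v - u < d \<and> f v - f u > p * (v - u)"
      using uv by (intro exI[of _ u] exI[of _ v] conjI) (assumption | linarith)+
  qed
qed

lemma steep_lmeasurable: "steep f q \<in> lmeasurable"
proof -
  define W where "W n = (\<Union>(u, v)\<in>{(u, v). 0 \<le> u \<and> v \<le> 1 \<and> v - u < 1 / real (Suc n) \<and> f v - f u > q * (v - u)}. {u<..<v})" for n
  have "steep f q = (\<Inter>n. W n)"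
  proof (intro equalityI subsetI)
    fix x assume x: "x \<in> steep f q"
    show "x \<in> (\<Inter>n. W n)"
    proof
      fix n :: nat
      obtain u v where "0 \<le> u" "u < x" "x < v" "v \<le> 1" "v - u < 1 / real (Suc n)" "f v - f u > q * (v - u)"
        using steepD[OF x, of "1 / real (Suc n)"] by auto
      then show "x \<in> W n" unfolding W_def by (intro UN_I[of "(u, v)"]) auto
    qed
  next
    fix x assume x: "x \<in> (\<Inter>n. W n)"
    show "x \<in> steep f q" unfolding steep_def
    proof (intro CollectI allI impI)
      fix d :: real assume "0 < d"
      then obtain n where n: "1 / real (Suc n) < d" using nat_approx_posE by blast
      have "x \<in> W n" using x by blast
      then obtain u v where "0 \<le> u" "u < x" "x < v" "v \<le> 1" "v - u < 1 / real (Suc n)" "f v - f u > q * (v - u)"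
        unfolding W_def by auto
      then show "\<exists>u v. 0 \<le> u \<and> u < x \<and> x < v \<and> v \<le> 1 \<and> v - u < d \<and> f v - f u > q * (v - u)"
        using n by (intro exI[of _ u] exI[of _ v]) auto
    qed
  qed
  moreover have "open (W n)" for n unfolding W_def by (intro open_UN) auto
  then have "(\<Inter>n. W n) \<in> sets lebesgue"
    by (intro sets.countable_INT) (auto intro: lmeasurable_open)
  moreover have "W 0 \<subseteq> {0..1}" unfolding W_def by auto
  then have "(\<Inter>n. W n) \<subseteq> {0..1}" by blast
  ultimately show ?thesis
    by (metis lmeasurable_interval(1) fmeasurableI2 box_real(2) lmeasurable_cbox)
qed

text \<open>
  Slopes over intervals around \<open>x\<close> control slopes over intervals with endpoint \<open>x\<close>, by letting the other
  endpoint tend to \<open>x\<close>.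
\<close>

lemma straddle_estimate_imp_estimate:
  fixes f :: "real \<Rightarrow> real"
  assumes cont: "isCont f x" and x: "0 < x" "x < 1" and y: "y \<in> {0..1}" "\<bar>y - x\<bar> < d"
    and est: "\<And>u v. 0 \<le> u \<Longrightarrow> u < x \<Longrightarrow> x < v \<Longrightarrow> v \<le> 1 \<Longrightarrow> v - u < d \<Longrightarrow>
      \<bar>f v - f u - L * (v - u)\<bar> \<le> e * (v - u)"
  shows "\<bar>f y - f x - L * (y - x)\<bar> \<le> e * \<bar>y - x\<bar>"
proof -
  have lim: "(f \<longlongrightarrow> f x) (at x)" using cont by (simp add: isCont_def)
  have liml: "(f \<longlongrightarrow> f x) (at_left x)" and limr: "(f \<longlongrightarrow> f x) (at_right x)"
    using lim by (simp_all add: filterlim_at_split)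
  consider "y = x" | "x < y" | "y < x" by linarith
  then show ?thesis
  proof cases
    case 1 then show ?thesis by simp
  next
    case 2
    have "((\<lambda>u. \<bar>f y - f u - L * (y - u)\<bar> - e * (y - u)) \<longlongrightarrow> \<bar>f y - f x - L * (y - x)\<bar> - e * (y - x)) (at_left x)"
      by (intro tendsto_intros liml)
    moreover have "max 0 (y - d) < x" using 2 x y by auto
    then have "\<forall>\<^sub>F u in at_left x. \<bar>f y - f u - L * (y - u)\<bar> - e * (y - u) \<le> 0"
      unfolding eventually_at_left_field
      by (rule exI[of _ "max 0 (y - d)", OF conjI]) (use est[of _ y] 2 y in auto)
    ultimately have "\<bar>f y - f x - L * (y - x)\<bar> - e * (y - x) \<le> 0"
      by (intro tendsto_upperbound) auto
    then show ?thesis using 2 by simp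
  next
    case 3
    have "((\<lambda>v. \<bar>f v - f y - L * (v - y)\<bar> - e * (v - y)) \<longlongrightarrow> \<bar>f x - f y - L * (x - y)\<bar> - e * (x - y)) (at_right x)"
      by (intro tendsto_intros limr)
    moreover have "x < min 1 (y + d)" using 3 x y by auto
    then have "\<forall>\<^sub>F v in at_right x. \<bar>f v - f y - L * (v - y)\<bar> - e * (v - y) \<le> 0"
      unfolding eventually_at_right_field
      by (rule exI[of _ "min 1 (y + d)", OF conjI]) (use est[of y] 3 y in auto)
    ultimately have "\<bar>f x - f y - L * (x - y)\<bar> - e * (x - y) \<le> 0"
      by (intro tendsto_upperbound) auto
    moreover have "\<bar>f x - f y - L * (x - y)\<bar> = \<bar>f y - f x - L * (y - x)\<bar>"
      by (simp add: abs_minus_commute algebra_simps abs_if)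
    ultimately show ?thesis using 3 by simp
  qed
qed

text \<open>
  Outside the null sets where slopes oscillate or are unbounded above or below, the derivative is the supremum of
  those \<open>q\<close> for which \<open>f\<close> has slopes greater than \<open>q\<close> over arbitrarily short intervals around the point.
\<close>

lemma abs_continuous_real_differentiable_ae:
  fixes f :: "real \<Rightarrow> real"
  assumes ac: "abs_continuous_on {0..1} f"
  shows "\<exists>N. negligible N \<and> (\<forall>x\<in>{0..1} - N. \<exists>L. (f has_vector_derivative L) (at x within {0..1}))"
proof -
  define g where "g x = - f x" for x
  have acg: "abs_continuous_on {0..1} g"
    unfolding g_def using abs_continuous_on_bounded_linear[OF bounded_linear_minus[OF bounded_linear_ident] ac] by simp
  define N1 where "N1 = (\<Union>p\<in>\<rat>. \<Union>q\<in>\<rat> \<inter> {p<..}. steep f q \<inter> steep g (- p))"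
  define N2 where "N2 = (\<Inter>n::nat. steep f (real n))"
  define N3 where "N3 = (\<Inter>n::nat. steep g (real n))"
  have "negligible (steep f q \<inter> steep g (- p))" if "p < q" for p q
  proof (rule straddle_oscillation_negligible[OF ac that])
    show "steep f q \<inter> steep g (- p) \<in> lmeasurable"
      using steep_lmeasurable by (intro fmeasurable.Int) auto
    fix x d :: real assume x: "x \<in> steep f q \<inter> steep g (- p)" and "0 < d"
    show "\<exists>u v. 0 \<le> u \<and> u < x \<and> x < v \<and> v \<le> 1 \<and> v - u < d \<and> f v - f u > q * (v - u)"
      using steepD x \<open>0 < d\<close> by blast
    show "\<exists>u v. 0 \<le> u \<and> u < x \<and> x < v \<and> v \<le> 1 \<and> v - u < d \<and> f v - f u < p * (v - u)"
      using steepD[of x g "- p" d] x \<open>0 < d\<close> by (force simp: g_def)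
  qed
  then have "negligible (\<Union>q\<in>\<rat> \<inter> {p<..}. steep f q \<inter> steep g (- p))" for p
    using countable_rat by (intro negligible_countable_Union) auto
  then have N1: "negligible N1"
    unfolding N1_def using countable_rat by (intro negligible_countable_Union) auto
  have inf: "negligible (\<Inter>n::nat. steep h (real n))" if "abs_continuous_on {0..1} h" for h
  proof (rule straddle_infinite_negligible[OF that])
    have "(\<Inter>n::nat. steep h (real n)) \<in> sets lebesgue"
      using steep_lmeasurable by (intro sets.countable_INT) auto
    then show "(\<Inter>n::nat. steep h (real n)) \<in> lmeasurable"
      by (rule fmeasurableI2[OF steep_lmeasurable[of h "real 0"], rotated]) blast
    fix x d q :: real assume x: "x \<in> (\<Inter>n::nat. steep h (real n))" and "0 < d"
    obtain n :: nat where "q \<le> real n" using real_arch_simple by blast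
    then have "x \<in> steep h q" using steep_antimono[of q "real n" h] x by blast
    then show "\<exists>u v. 0 \<le> u \<and> u < x \<and> x < v \<and> v \<le> 1 \<and> v - u < d \<and> h v - h u > q * (v - u)"
      using steepD \<open>0 < d\<close> by blast
  qed
  define N where "N = N1 \<union> N2 \<union> N3 \<union> {0, 1}"
  have "negligible N" unfolding N_def N2_def N3_def using N1 inf[OF ac] inf[OF acg] by auto
  moreover have "\<exists>L. (f has_vector_derivative L) (at x within {0..1})" if x: "x \<in> {0..1} - N" for x
  proof -
    have x01: "0 < x" "x < 1" using x by (auto simp: N_def less_le)
    have cont: "isCont f x"
      using continuous_on_interior[OF abs_continuous_on_imp_continuous_on[OF ac], of x] x01 by simp
    have notsteep: "\<exists>d>0. \<forall>u v. 0 \<le> u \<longrightarrow> u < x \<longrightarrow> x < v \<longrightarrow> v \<le> 1 \<longrightarrow> v - u < d \<longrightarrow> h v - h u \<le> q * (v - u)"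
      if ns: "x \<notin> steep h q" for h q
    proof -
      obtain d where "d > 0" "\<not> (\<exists>u v. 0 \<le> u \<and> u < x \<and> x < v \<and> v \<le> 1 \<and> v - u < d \<and> h v - h u > q * (v - u))"
        using ns unfolding steep_def mem_Collect_eq not_all not_imp by blast
      note d = this
      show ?thesis
      proof (intro exI[of _ d] conjI allI impI)
        fix u v assume uv: "0 \<le> u" "u < x" "x < v" "v \<le> 1" "v - u < d"
        show "h v - h u \<le> q * (v - u)"
        proof (rule ccontr)
          assume "\<not> ?thesis"
          then have "h v - h u > q * (v - u)" by simp
          then show False using uv d(2) by blast
        qed
      qed (fact d(1))
    qed
    define A where "A = {q. x \<in> steep f q}"
    have down: "p \<in> A" if "q \<in> A" "p \<le> q" for p q
      using that steep_antimono unfolding A_def by blast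
    obtain n2 :: nat where n2: "real n2 \<notin> A" using x by (auto simp: N_def N2_def A_def)
    have bdd: "bdd_above A" using down n2 by (intro bdd_aboveI[of _ "real n2"]) (meson le_cases)
    obtain n3 :: nat where "x \<notin> steep g (real n3)" using x by (auto simp: N_def N3_def)
    then obtain d3 where d3: "d3 > 0" "\<And>u v. 0 \<le> u \<Longrightarrow> u < x \<Longrightarrow> x < v \<Longrightarrow> v \<le> 1 \<Longrightarrow> v - u < d3 \<Longrightarrow> g v - g u \<le> real n3 * (v - u)"
      using notsteep by blast
    \<comment> \<open>The slopes of \<open>f\<close> over short intervals around \<open>x\<close> are at least \<open>- n3\<close>.\<close>
    have "- real n3 - 1 \<in> A" unfolding A_def steep_def
    proof (intro CollectI allI impI)
      fix d :: real assume "0 < d"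
      define \<delta> where "\<delta> = min (min d d3) (min x (1 - x)) / 3"
      have \<delta>: "0 < \<delta>" "\<delta> < x" "\<delta> < 1 - x" "2 * \<delta> < d" "2 * \<delta> < d3"
        unfolding \<delta>_def using \<open>0 < d\<close> d3(1) x01 by (auto simp: min_def)
      show "\<exists>u v. 0 \<le> u \<and> u < x \<and> x < v \<and> v \<le> 1 \<and> v - u < d \<and> f v - f u > (- real n3 - 1) * (v - u)"
        using d3(2)[of "x - \<delta>" "x + \<delta>"] \<delta>
        by (intro exI[of _ "x - \<delta>"] exI[of _ "x + \<delta>"]) (auto simp: g_def algebra_simps)
    qed
    then have ne: "A \<noteq> {}" by blast
    define L where "L = Sup A"
    have est: "\<exists>d>0. \<forall>u v. 0 \<le> u \<longrightarrow> u < x \<longrightarrow> x < v \<longrightarrow> v \<le> 1 \<longrightarrow> v - u < d \<longrightarrow>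
        \<bar>f v - f u - L * (v - u)\<bar> \<le> e * (v - u)" if "0 < e" for e
    proof -
      have "L + e \<notin> A" using cSup_upper[OF _ bdd, of "L + e"] \<open>0 < e\<close> by (auto simp: L_def)
      then obtain d1 where d1: "d1 > 0" "\<And>u v. 0 \<le> u \<Longrightarrow> u < x \<Longrightarrow> x < v \<Longrightarrow> v \<le> 1 \<Longrightarrow> v - u < d1 \<Longrightarrow> f v - f u \<le> (L + e) * (v - u)"
        using notsteep unfolding A_def by blast
      obtain p where p: "p \<in> \<rat>" "L - e < p" "p < L - e/2" using Rats_dense_in_real[of "L - e" "L - e/2"] \<open>0 < e\<close> by auto
      obtain q where q: "q \<in> \<rat>" "p < q" "q < L" using Rats_dense_in_real[of p L] p \<open>0 < e\<close> by auto
      obtain a where "a \<in> A" "q < a" using less_cSupE[OF q(3)[unfolded L_def] ne] by blast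
      then have "q \<in> A" using down by auto
      then have "x \<notin> steep g (- p)" using x p q unfolding N_def N1_def A_def by auto
      then obtain d2 where d2: "d2 > 0" "\<And>u v. 0 \<le> u \<Longrightarrow> u < x \<Longrightarrow> x < v \<Longrightarrow> v \<le> 1 \<Longrightarrow> v - u < d2 \<Longrightarrow> g v - g u \<le> (- p) * (v - u)"
        using notsteep by blast
      show ?thesis
      proof (intro exI[of _ "min d1 d2"] conjI allI impI)
        fix u v assume uv: "0 \<le> u" "u < x" "x < v" "v \<le> 1" "v - u < min d1 d2"
        have "(L - e) * (v - u) \<le> p * (v - u)" using p uv by (intro mult_right_mono) auto
        then show "\<bar>f v - f u - L * (v - u)\<bar> \<le> e * (v - u)"
          using d1(2)[of u v] d2(2)[of u v] uv by (simp add: g_def abs_le_iff algebra_simps)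
      qed (use d1 d2 in auto)
    qed
    have "(f has_derivative (\<lambda>h. h *\<^sub>R L)) (at x within {0..1})"
      unfolding has_derivative_within_alt
    proof (intro conjI allI impI)
      show "bounded_linear (\<lambda>h. h *\<^sub>R L)" by (rule bounded_linear_scaleR_left)
      fix e :: real assume "0 < e"
      then obtain d where d: "d > 0" "\<And>u v. 0 \<le> u \<Longrightarrow> u < x \<Longrightarrow> x < v \<Longrightarrow> v \<le> 1 \<Longrightarrow> v - u < d \<Longrightarrow>
        \<bar>f v - f u - L * (v - u)\<bar> \<le> e * (v - u)" using est by blast
      show "\<exists>d>0. \<forall>y\<in>{0..1}. norm (y - x) < d \<longrightarrow> norm (f y - f x - (y - x) *\<^sub>R L) \<le> e * norm (y - x)"
      proof (intro exI[of _ d] conjI ballI impI)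
        fix y :: real assume y: "y \<in> {0..1}" "norm (y - x) < d"
        then show "norm (f y - f x - (y - x) *\<^sub>R L) \<le> e * norm (y - x)"
          using straddle_estimate_imp_estimate[OF cont x01 y(1) _ d(2)] by (simp add: mult.commute)
      qed (fact d)
    qed
    then show ?thesis unfolding has_vector_derivative_def by blast
  qed
  ultimately show ?thesis by blast
qed

lemma has_vector_derivative_vec:
  fixes f :: "real \<Rightarrow> real^'n::finite"
  assumes "\<And>j. ((\<lambda>x. f x $ j) has_vector_derivative (L $ j)) (at x within S)"
  shows "(f has_vector_derivative L) (at x within S)"
  unfolding has_vector_derivative_def
proof (subst has_derivative_componentwise_within, intro ballI)
  fix i :: "real^'n" assume "i \<in> Basis"
  then obtain j where i: "i = axis j 1" by (auto simp: Basis_vec_def)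
  show "((\<lambda>x. f x \<bullet> i) has_derivative (\<lambda>xa. xa *\<^sub>R L \<bullet> i)) (at x within S)"
    using assms[of j] unfolding i inner_axis has_vector_derivative_def by simp
qed

lemma abs_continuous_differentiable_ae:
  fixes f :: "real \<Rightarrow> real^'n::finite"
  assumes ac: "abs_continuous_on {0..1} f"
  shows "AE s in lebesgue. s \<in> {0..1} \<longrightarrow> (f has_vector_derivative time_deriv f s) (at s within {0..1})"
proof -
  have "\<exists>N. negligible N \<and> (\<forall>x\<in>{0..1} - N. \<exists>L. ((\<lambda>s. f s $ j) has_vector_derivative L) (at x within {0..1}))" for j
    by (intro abs_continuous_real_differentiable_ae abs_continuous_on_bounded_linear[OF bounded_linear_vec_nth ac])
  then obtain N where N: "\<And>j. negligible (N j)"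
    "\<And>j x. x \<in> {0..1} - N j \<Longrightarrow> \<exists>L. ((\<lambda>s. f s $ j) has_vector_derivative L) (at x within {0..1})"
    by metis
  have "negligible (\<Union>j. N j)" using N(1) by (intro negligible_Union) auto
  then have "(\<Union>j. N j) \<in> null_sets lebesgue" by (simp add: negligible_iff_null_sets)
  then show ?thesis
  proof (rule AE_I'[of "\<Union>j. N j"], intro subsetI, elim CollectE conjE)
    fix s :: real assume "\<not> (s \<in> {0..1} \<longrightarrow> (f has_vector_derivative time_deriv f s) (at s within {0..1}))"
    then have s: "s \<in> {0..1}"  and nd: "\<not> (f has_vector_derivative time_deriv f s) (at s within {0..1})" by auto
    show "s \<in> (\<Union>j. N j)"
    proof (rule ccontr)
      assume "s \<notin> (\<Union>j. N j)"
      then have "\<forall>j. \<exists>L. ((\<lambda>s. f s $ j) has_vector_derivative L) (at s within {0..1})" using N(2) s by blast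
      then obtain L where "\<And>j. ((\<lambda>s. f s $ j) has_vector_derivative L j) (at s within {0..1})" by metis
      then have "(f has_vector_derivative (\<chi> j. L j)) (at s within {0..1})"
        by (intro has_vector_derivative_vec) simp
      then show False using nd unfolding time_deriv_def
        by (metis differentiableI_vector vector_derivative_works)
    qed
  qed
qed

section \<open>Controls\<close>

text \<open>
  A monotone \<open>\<phi>\<close> may collapse intervals to points and thereby identify several of them, but
  degenerate intervals contribute nothing to the sums considered.
\<close>

lemma nonoverlapping_image:
  assumes D: "nonoverlapping {0..1} D"
    and mono: "\<And>a b. a \<in> {0..1} \<Longrightarrow> b \<in> {0..1} \<Longrightarrow> a \<le> b \<Longrightarrow> \<phi> a \<le> \<phi> b"
    and range: "\<And>a. a \<in> {0..1} \<Longrightarrow> \<phi> a \<in> {0..1}"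
  shows "nonoverlapping {0..1} ((\<lambda>(a, b). (\<phi> a, \<phi> b)) ` D)"
    and "\<And>F :: real \<Rightarrow> real \<Rightarrow> real. (\<And>x. F x x = 0) \<Longrightarrow>
      (\<Sum>(a, b)\<in>(\<lambda>(a, b). (\<phi> a, \<phi> b)) ` D. F a b) = (\<Sum>(a, b)\<in>D. F (\<phi> a) (\<phi> b))"
proof -
  have D01: "a \<in> {0..1}" "b \<in> {0..1}" "a \<le> b" if "(a, b) \<in> D" for a b
    using D that by (auto simp: nonoverlapping_def)
  have fin: "finite D" using D by (simp add: nonoverlapping_def)
  have disj: "\<phi> b \<le> \<phi> c \<or> \<phi> d \<le> \<phi> a \<or> \<phi> a = \<phi> b \<or> \<phi> c = \<phi> d"
    if p: "(a, b) \<in> D" and q: "(c, d) \<in> D" and ne: "(a, b) \<noteq> (c, d)" for a b c d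
  proof -
    have "{a<..<b} \<inter> {c<..<d} = {}"
      using D p q ne unfolding nonoverlapping_def pairwise_def by fastforce
    then have "min b d \<le> max a c" by simp
    then have "b \<le> a \<or> b \<le> c \<or> d \<le> a \<or> d \<le> c" by (auto simp: min_def max_def split: if_splits)
    then show ?thesis using D01[OF p] D01[OF q] mono by (metis order_antisym)
  qed
  have fact2: "(\<Sum>(a, b)\<in>(\<lambda>(a, b). (\<phi> a, \<phi> b)) ` D. F a b) = (\<Sum>(a, b)\<in>D. F (\<phi> a) (\<phi> b))"
    if F: "\<And>x. F x x = 0" for F :: "real \<Rightarrow> real \<Rightarrow> real"
  proof -
    have "(\<Sum>(a, b)\<in>(\<lambda>(a, b). (\<phi> a, \<phi> b)) ` D. F a b) =
      sum ((\<lambda>(a, b). F a b) \<circ> (\<lambda>(a, b). (\<phi> a, \<phi> b))) D"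
    proof (rule sum.reindex_nontrivial[OF fin])
      fix p q assume pq: "p \<in> D" "q \<in> D" "p \<noteq> q"
        and eq: "(\<lambda>(a, b). (\<phi> a, \<phi> b)) p = (\<lambda>(a, b). (\<phi> a, \<phi> b)) q"
      obtain a b c d where e: "p = (a, b)" "q = (c, d)" by (cases p; cases q)
      have le: "\<phi> a \<le> \<phi> b" "\<phi> c \<le> \<phi> d" using D01 mono pq e by blast+
      have "\<phi> a = \<phi> b" using disj[of a b c d] pq eq le unfolding e by auto
      then show "(\<lambda>(a, b). F a b) ((\<lambda>(a, b). (\<phi> a, \<phi> b)) p) = 0" using F e by simp
    qed
    then show ?thesis by (simp add: o_def case_prod_unfold)
  qed
  then show "\<And>F :: real \<Rightarrow> real \<Rightarrow> real. (\<And>x. F x x = 0) \<Longrightarrow>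
      (\<Sum>(a, b)\<in>(\<lambda>(a, b). (\<phi> a, \<phi> b)) ` D. F a b) = (\<Sum>(a, b)\<in>D. F (\<phi> a) (\<phi> b))" .
  show "nonoverlapping {0..1} ((\<lambda>(a, b). (\<phi> a, \<phi> b)) ` D)" unfolding nonoverlapping_def
  proof (intro conjI pairwiseI)
    show "finite ((\<lambda>(a, b). (\<phi> a, \<phi> b)) ` D)" using fin by simp
    show "\<forall>(a, b)\<in>(\<lambda>(a, b). (\<phi> a, \<phi> b)) ` D. a \<le> b \<and> {a..b} \<subseteq> {0..1}"
    proof clarsimp
      fix a b assume "(a, b) \<in> D"
      then show "\<phi> a \<le> \<phi> b \<and> (\<phi> a \<le> \<phi> b \<longrightarrow> 0 \<le> \<phi> a \<and> \<phi> b \<le> 1)"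
        using D01 mono range by (meson atLeastAtMost_iff)
    qed
    fix p q assume "p \<in> (\<lambda>(a, b). (\<phi> a, \<phi> b)) ` D" "q \<in> (\<lambda>(a, b). (\<phi> a, \<phi> b)) ` D" and ne: "p \<noteq> q"
    then obtain a b c d where e: "p = (\<phi> a, \<phi> b)" "q = (\<phi> c, \<phi> d)" and m: "(a, b) \<in> D" "(c, d) \<in> D" by auto
    have "(a, b) \<noteq> (c, d)" using ne e by auto
    then show "{fst p<..<snd p} \<inter> {fst q<..<snd q} = {}"
      using disj[OF m] unfolding e by auto
  qed
qed

lemma abs_continuous_on_reparam:
  assumes ac: "abs_continuous_on {0..1} f"
    and mono: "\<And>a b. a \<in> {0..1} \<Longrightarrow> b \<in> {0..1} \<Longrightarrow> a \<le> b \<Longrightarrow> \<phi> a \<le> \<phi> b"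
    and range: "\<And>a. a \<in> {0..1} \<Longrightarrow> \<phi> a \<in> {0..1}"
    and contr: "\<And>a b. a \<le> b \<Longrightarrow> \<phi> b - \<phi> a \<le> b - a"
  shows "abs_continuous_on {0..1} (\<lambda>s. f (\<phi> s))"
proof (rule abs_continuous_onI)
  fix \<epsilon> :: real assume "0 < \<epsilon>"
  obtain \<delta> where "\<delta> > 0" and d: "\<And>D. nonoverlapping {0..1} D \<Longrightarrow>
       (\<Sum>(a, b)\<in>D. b - a) < \<delta> \<Longrightarrow> (\<Sum>(a, b)\<in>D. norm (f b - f a)) < \<epsilon>"
    using abs_continuous_onD[OF ac \<open>0 < \<epsilon>\<close>] by blast
  show "\<exists>\<delta>>0. \<forall>D. nonoverlapping {0..1} D \<longrightarrow>
     (\<Sum>(a, b)\<in>D. b - a) < \<delta> \<longrightarrow> (\<Sum>(a, b)\<in>D. norm (f (\<phi> b) - f (\<phi> a))) < \<epsilon>"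
  proof (intro exI[of _ \<delta>] conjI allI impI)
    fix D assume D: "nonoverlapping {0..1} D" and len: "(\<Sum>(a, b)\<in>D. b - a) < \<delta>"
    note im = nonoverlapping_image[of D \<phi>, OF D mono range]
    have "(\<Sum>(a, b)\<in>D. \<phi> b - \<phi> a) \<le> (\<Sum>(a, b)\<in>D. b - a)"
      using D contr by (intro sum_mono) (auto simp: nonoverlapping_def)
    then have "(\<Sum>(a, b)\<in>(\<lambda>(a, b). (\<phi> a, \<phi> b)) ` D. b - a) < \<delta>"
      using len im(2)[of "\<lambda>a b. b - a"] by simp
    then have "(\<Sum>(a, b)\<in>(\<lambda>(a, b). (\<phi> a, \<phi> b)) ` D. norm (f b - f a)) < \<epsilon>"
      using d[OF im(1)] by blast
    then show "(\<Sum>(a, b)\<in>D. norm (f (\<phi> b) - f (\<phi> a))) < \<epsilon>"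
      using im(2)[of "\<lambda>a b. norm (f b - f a)"] by simp
  qed (fact)
qed

definition energy :: "(real \<Rightarrow> real^'n::finite) \<Rightarrow> real" where
  "energy h = integral {0..1} (\<lambda>s. (norm (time_deriv h s))\<^sup>2)"

text \<open>
  With the gauge integral, controls can be cut, shifted and glued interval by interval; measurability becomes
  integrability of the derivative, which follows from \<open>\<bar>v\<bar> \<le> 1 + \<bar>v\<bar>\<^sup>2\<close>.
\<close>

lemma controls_iff:
  "h \<in> controls \<longleftrightarrow> abs_continuous_on {0..1} h \<and> h 0 = 0 \<and> time_deriv h integrable_on {0..1} \<and>
     (\<lambda>s. (norm (time_deriv h s))\<^sup>2) integrable_on {0..1}" (is "_ \<longleftrightarrow> ?R")
proof
  assume h: "h \<in> controls"
  have sq: "(\<lambda>s. (norm (time_deriv h s))\<^sup>2) integrable_on {0..1}"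
    using h set_lebesgue_integral_eq_integral(1) unfolding controls_def by blast
  have meas: "time_deriv h \<in> borel_measurable (lebesgue_on {0..1})"
    using h unfolding controls_def set_borel_measurable_def
    by (auto simp: borel_measurable_restrict_space_iff)
  have "(\<lambda>s. 1 + (norm (time_deriv h s))\<^sup>2) integrable_on {0..1}"
    using sq by (intro integrable_add) auto
  moreover have "norm (time_deriv h s) \<le> 1 + (norm (time_deriv h s))\<^sup>2" for s
  proof -
    have "0 \<le> (norm (time_deriv h s) - 1)\<^sup>2" by simp
    then have "2 * norm (time_deriv h s) \<le> 1 + (norm (time_deriv h s))\<^sup>2"
      by (simp add: power2_diff)
    then show ?thesis using norm_ge_zero[of "time_deriv h s"] by linarith
  qed
  ultimately have "time_deriv h integrable_on {0..1}"
    using measurable_bounded_by_integrable_imp_integrable[OF meas] by auto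
  then show ?R using h sq unfolding controls_def by simp
next
  assume R: ?R
  then have "time_deriv h \<in> borel_measurable (lebesgue_on {0..1})"
    using integrable_imp_measurable by blast
  then have "set_borel_measurable lebesgue {0..1} (time_deriv h)"
    unfolding set_borel_measurable_def by (auto simp: borel_measurable_restrict_space_iff)
  moreover have "set_integrable lebesgue {0..1} (\<lambda>s. (norm (time_deriv h s))\<^sup>2)"
    using R by (intro nonnegative_absolutely_integrable_1) auto
  ultimately show "h \<in> controls" using R unfolding controls_def by simp
qed

lemma controls_le_iff: "f \<in> controls_le \<alpha> \<longleftrightarrow> f \<in> controls \<and> 1/2 * energy f \<le> \<alpha>\<^sup>2"
proof -
  have "(LINT s:{0..1}|lebesgue. (norm (time_deriv f s))\<^sup>2) = energy f" if "f \<in> controls"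
    using that set_lebesgue_integral_eq_integral(2) unfolding controls_def energy_def by blast
  then show ?thesis unfolding controls_le_def by auto
qed

lemma energy_nonneg: "f \<in> controls \<Longrightarrow> 0 \<le> energy f"
  unfolding energy_def by (rule integral_nonneg) (auto simp: controls_iff)

lemma time_deriv_eq:
  assumes "(h has_vector_derivative v) (at s within {0..1})" "s \<in> {0..1}"
  shows "time_deriv h s = v"
  unfolding time_deriv_def
  using vector_derivative_within_cbox[of 0 1 s h v] assms by simp

lemma linear_control:
  fixes c :: "real^'n::finite"
  shows "(\<lambda>r. r *\<^sub>R c) \<in> controls" "energy (\<lambda>r. r *\<^sub>R c) = (norm c)\<^sup>2"
proof -
  have td: "time_deriv (\<lambda>r. r *\<^sub>R c) s = c" if "s \<in> {0..1}" for s
    using that by (intro time_deriv_eq) (auto intro!: derivative_eq_intros)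
  have ac: "abs_continuous_on {0..1} (\<lambda>r. r *\<^sub>R c)"
    using abs_continuous_on_bounded_linear[OF bounded_linear_scaleR_left abs_continuous_on_id] .
  have 1: "time_deriv (\<lambda>r. r *\<^sub>R c) integrable_on {0..1}"
    by (rule integrable_eq[of "\<lambda>s. c"]) (use td in auto)
  have 2: "(\<lambda>s. (norm (time_deriv (\<lambda>r. r *\<^sub>R c) s))\<^sup>2) integrable_on {0..1}"
    by (rule integrable_eq[of "\<lambda>s. (norm c)\<^sup>2"]) (use td in auto)
  show "(\<lambda>r. r *\<^sub>R c) \<in> controls" unfolding controls_iff using ac 1 2 by simp
  have "energy (\<lambda>r. r *\<^sub>R c) = integral {0..1} (\<lambda>s::real. (norm c)\<^sup>2)"
    unfolding energy_def by (rule integral_cong) (use td in auto)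
  then show "energy (\<lambda>r. r *\<^sub>R c) = (norm c)\<^sup>2" by simp
qed

lemma zero_control: "(\<lambda>r. 0) \<in> controls" "energy (\<lambda>r. 0 :: real^'n::finite) = 0"
  using linear_control[of 0] by simp_all

text \<open>
  Where \<open>f\<close> is not differentiable, \<open>time_deriv f\<close> is an arbitrary value; so the derivative of the multiple is
  determined by that of \<open>f\<close> only almost everywhere.
\<close>

lemma scaled_control:
  fixes f :: "real \<Rightarrow> real^'n::finite"
  assumes f: "f \<in> controls"
  shows "(\<lambda>s. \<epsilon> *\<^sub>R f s) \<in> controls" "energy (\<lambda>s. \<epsilon> *\<^sub>R f s) = \<epsilon>\<^sup>2 * energy f"
proof -
  have ac: "abs_continuous_on {0..1} f" using f by (simp add: controls_iff)
  define N where "N = {s. \<not> (s \<in> {0..1} \<longrightarrow> (f has_vector_derivative time_deriv f s) (at s within {0..1}))}"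
  have N: "negligible N"
    unfolding N_def by (rule AE_lebesgue_imp_negligible[OF abs_continuous_differentiable_ae[OF ac]])
  have td: "time_deriv (\<lambda>s. \<epsilon> *\<^sub>R f s) s = \<epsilon> *\<^sub>R time_deriv f s" if "s \<in> {0..1} - N" for s
    using that by (intro time_deriv_eq) (auto simp: N_def intro!: derivative_eq_intros)
  have ac': "abs_continuous_on {0..1} (\<lambda>s. \<epsilon> *\<^sub>R f s)"
    using abs_continuous_on_bounded_linear[OF bounded_linear_scaleR_right ac] .
  have 1: "time_deriv (\<lambda>s. \<epsilon> *\<^sub>R f s) integrable_on {0..1}"
  proof (rule integrable_spike[OF _ N])
    show "(\<lambda>s. \<epsilon> *\<^sub>R time_deriv f s) integrable_on {0..1}"
      using f by (intro integrable_cmul) (auto simp: controls_iff)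
  qed (use td in auto)
  have sq: "(norm (time_deriv (\<lambda>s. \<epsilon> *\<^sub>R f s) s))\<^sup>2 = \<epsilon>\<^sup>2 *\<^sub>R (norm (time_deriv f s))\<^sup>2" if "s \<in> {0..1} - N" for s
    using td[OF that] by (simp add: power_mult_distrib)
  have 2: "(\<lambda>s. (norm (time_deriv (\<lambda>s. \<epsilon> *\<^sub>R f s) s))\<^sup>2) integrable_on {0..1}"
  proof (rule integrable_spike[OF _ N])
    show "(\<lambda>s. \<epsilon>\<^sup>2 *\<^sub>R (norm (time_deriv f s))\<^sup>2) integrable_on {0..1}"
      using f by (intro integrable_cmul) (auto simp: controls_iff)
  qed (use sq in auto)
  show "(\<lambda>s. \<epsilon> *\<^sub>R f s) \<in> controls" unfolding controls_iff using ac' 1 2 f by (simp add: controls_iff)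
  have "energy (\<lambda>s. \<epsilon> *\<^sub>R f s) = integral {0..1} (\<lambda>s. \<epsilon>\<^sup>2 *\<^sub>R (norm (time_deriv f s))\<^sup>2)"
    unfolding energy_def by (rule integral_spike[OF N]) (use sq in auto)
  then show "energy (\<lambda>s. \<epsilon> *\<^sub>R f s) = \<epsilon>\<^sup>2 * energy f" unfolding energy_def by simp
qed

text \<open>
  The control \<open>f\<close> until time \<open>a\<close> and \<open>g\<close>, started anew, from then on. Written as a sum of two reparametrized
  controls, the concatenation is absolutely continuous without splitting intervals at \<open>a\<close>.
\<close>

definition concat_control :: "(real \<Rightarrow> 'a::real_vector) \<Rightarrow> real \<Rightarrow> (real \<Rightarrow> 'a) \<Rightarrow> real \<Rightarrow> 'a" where
  "concat_control f a g = (\<lambda>r. f (min r a) + g (max (r - a) 0))"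

lemma concat_control_simps:
  "g 0 = 0 \<Longrightarrow> r \<le> a \<Longrightarrow> concat_control f a g r = f r"
  "a \<le> r \<Longrightarrow> concat_control f a g r = f a + g (r - a)"
  by (auto simp: concat_control_def min_def max_def)

lemma vector_derivative_cong_iff:
  assumes "\<And>D. (f has_vector_derivative D) F \<longleftrightarrow> (g has_vector_derivative D) G"
  shows "vector_derivative f F = vector_derivative g G"
  unfolding vector_derivative_def using assms by simp

lemma time_deriv_concat_control:
  fixes f g :: "real \<Rightarrow> real^'n::finite"
  assumes g0: "g 0 = 0" and a: "0 \<le> a" and r: "0 < r" "r < 1"
  shows "r < a \<Longrightarrow> time_deriv (concat_control f a g) r = time_deriv f r"
    and "a < r \<Longrightarrow> time_deriv (concat_control f a g) r = time_deriv g (r - a)"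
proof -
  have at: "at x within {0..1} = at x" if "0 < x" "x < 1" for x :: real
    using that by (intro at_within_interior) simp
  {
    assume ra: "r < a"
    show "time_deriv (concat_control f a g) r = time_deriv f r"
      unfolding time_deriv_def at[OF r]
    proof (rule vector_derivative_cong_iff)
      fix D
      show "(concat_control f a g has_vector_derivative D) (at r) \<longleftrightarrow> (f has_vector_derivative D) (at r)"
        using ra concat_control_simps(1)[of g _ a f, OF g0]
        by (auto intro: has_vector_derivative_transform_within_open[of _ _ r "{..<a}"])
    qed
  next
    assume ra: "a < r"
    show "time_deriv (concat_control f a g) r = time_deriv g (r - a)"
      unfolding time_deriv_def at[OF r]
    proof (subst at[of "r - a"])
      show "0 < r - a" "r - a < 1" using a r ra by auto
      show "vector_derivative (concat_control f a g) (at r) = vector_derivative g (at (r - a))"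
      proof (rule vector_derivative_cong_iff)
        fix D
        have "(concat_control f a g has_vector_derivative D) (at r) \<longleftrightarrow> ((\<lambda>x. f a + g (x - a)) has_vector_derivative D) (at r)"
          using ra concat_control_simps(2)[of a _ f g]
          by (auto intro: has_vector_derivative_transform_within_open[of _ _ r "{a<..}"])
        also have "\<dots> \<longleftrightarrow> (g has_vector_derivative D) (at (r - a))"
        proof
          assume h: "((\<lambda>x. f a + g (x - a)) has_vector_derivative D) (at r)"
          have "((\<lambda>x. f a + g (x - a)) \<circ> (\<lambda>y. y + a) has_vector_derivative 1 *\<^sub>R D) (at (r - a))"
            by (rule vector_diff_chain_at) (use h in \<open>auto intro!: derivative_eq_intros\<close>)
          then have "((\<lambda>y. f a + g y) has_vector_derivative D) (at (r - a))" by (simp add: o_def)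
          from has_vector_derivative_add[OF this has_vector_derivative_const[of "- f a"]]
          show "(g has_vector_derivative D) (at (r - a))" by simp
        next
          assume h: "(g has_vector_derivative D) (at (r - a))"
          have "(g \<circ> (\<lambda>y. y - a) has_vector_derivative 1 *\<^sub>R D) (at r)"
            by (rule vector_diff_chain_at) (use h in \<open>auto intro!: derivative_eq_intros\<close>)
          from has_vector_derivative_add[OF has_vector_derivative_const[of "f a"] this]
          show "((\<lambda>x. f a + g (x - a)) has_vector_derivative D) (at r)" by (simp add: o_def)
        qed
        finally show "(concat_control f a g has_vector_derivative D) (at r) \<longleftrightarrow> (g has_vector_derivative D) (at (r - a))" .
      qed
    qed
  }
qed

lemma concat_control:
  fixes f g :: "real \<Rightarrow> real^'n::finite"
  assumes f: "f \<in> controls" and g: "g \<in> controls" and a: "0 \<le> a" "a \<le> 1"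
  shows "concat_control f a g \<in> controls" "energy (concat_control f a g) \<le> energy f + energy g"
proof -
  let ?h = "concat_control f a g"
  have g0: "g 0 = 0" using g by (simp add: controls_iff)
  have ac: "abs_continuous_on {0..1} ?h"
    unfolding concat_control_def
  proof (rule abs_continuous_on_add)
    show "abs_continuous_on {0..1} (\<lambda>r. f (min r a))"
      by (rule abs_continuous_on_reparam[of f "\<lambda>r. min r a"]) (use f a in \<open>auto simp: controls_iff\<close>)
    show "abs_continuous_on {0..1} (\<lambda>r. g (max (r - a) 0))"
      by (rule abs_continuous_on_reparam[of g "\<lambda>r. max (r - a) 0"]) (use g a in \<open>auto simp: controls_iff\<close>)
  qed
  have pieces: "(\<lambda>s. F (time_deriv ?h s)) integrable_on {0..1}"
    "integral {0..1} (\<lambda>s. F (time_deriv ?h s)) =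
       integral {0..a} (\<lambda>s. F (time_deriv f s)) + integral {0..1-a} (\<lambda>s. F (time_deriv g s))"
    if Ff: "(\<lambda>s. F (time_deriv f s)) integrable_on {0..1}" and Fg: "(\<lambda>s. F (time_deriv g s)) integrable_on {0..1}"
    for F :: "real^'n \<Rightarrow> 'b::euclidean_space"
  proof -
    have N: "negligible {0, a, 1}" by simp
    have fa: "(\<lambda>s. F (time_deriv f s)) integrable_on {0..a}"
      by (rule integrable_on_subinterval[OF Ff]) (use a in auto)
    have ga: "(\<lambda>s. F (time_deriv g s)) integrable_on {0..1-a}"
      by (rule integrable_on_subinterval[OF Fg]) (use a in auto)
    have "((\<lambda>s. F (time_deriv g (s + - a))) has_integral integral {0..1-a} (\<lambda>s. F (time_deriv g s))) {0 - - a..1 - a - - a}"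
      by (rule has_integral_shift_real_ivl[OF integrable_integral[OF ga]])
    then have gs: "((\<lambda>s. F (time_deriv g (s - a))) has_integral integral {0..1-a} (\<lambda>s. F (time_deriv g s))) {a..1}"
      by simp
    have 1: "((\<lambda>s. F (time_deriv ?h s)) has_integral integral {0..a} (\<lambda>s. F (time_deriv f s))) {0..a}"
    proof (rule has_integral_spike[OF N _ integrable_integral[OF fa]])
      fix s assume "s \<in> {0..a} - {0, a, 1}"
      then have "0 < s" "s < 1" "s < a" using a by auto
      then show "F (time_deriv ?h s) = F (time_deriv f s)"
        using time_deriv_concat_control(1)[of g a s f, OF g0 a(1)] by simp
    qed
    have 2: "((\<lambda>s. F (time_deriv ?h s)) has_integral integral {0..1-a} (\<lambda>s. F (time_deriv g s))) {a..1}"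
    proof (rule has_integral_spike[OF N _ gs])
      fix s assume "s \<in> {a..1} - {0, a, 1}"
      then have "0 < s" "s < 1" "a < s" using a by auto
      then show "F (time_deriv ?h s) = F (time_deriv g (s - a))"
        using time_deriv_concat_control(2)[of g a s f, OF g0 a(1)] by simp
    qed
    note * = has_integral_combine[OF a 1 2]
    show "(\<lambda>s. F (time_deriv ?h s)) integrable_on {0..1}" using * by blast
    show "integral {0..1} (\<lambda>s. F (time_deriv ?h s)) =
       integral {0..a} (\<lambda>s. F (time_deriv f s)) + integral {0..1-a} (\<lambda>s. F (time_deriv g s))"
      using * by (rule integral_unique)
  qed
  have h0: "?h 0 = 0" using concat_control_simps(1)[of g 0 a f, OF g0 a(1)] f by (simp add: controls_iff)
  note pf = pieces(1)[of "\<lambda>v. v"] pieces[of "\<lambda>v. (norm v)\<^sup>2"]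
  show "?h \<in> controls" unfolding controls_iff using ac h0 pf(1,2) f g by (simp add: controls_iff)
  have sub: "integral {0..b} (\<lambda>s. (norm (time_deriv k s))\<^sup>2) \<le> energy k"
    if "k \<in> controls" "0 \<le> b" "b \<le> 1" for k :: "real \<Rightarrow> real^'n" and b
    unfolding energy_def
  proof (rule integral_subset_le)
    show sq: "(\<lambda>s. (norm (time_deriv k s))\<^sup>2) integrable_on {0..1}" using that(1) by (simp add: controls_iff)
    show "(\<lambda>s. (norm (time_deriv k s))\<^sup>2) integrable_on {0..b}"
      by (rule integrable_on_subinterval[OF sq]) (use that in auto)
  qed (use that in auto)
  show "energy ?h \<le> energy f + energy g"
    unfolding energy_def[of ?h]
    using pf(3) f g sub[OF f a] sub[OF g, of "1 - a"] a by (simp add: controls_iff)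
qed

section \<open>Triangular systems\<close>

definition triangular :: "('n \<Rightarrow> nat) \<Rightarrow> (real^'n::finite \<Rightarrow> real^'n) \<Rightarrow> bool" where
  "triangular lev Q \<longleftrightarrow> (\<forall>j x y. (\<forall>i. lev i < lev j \<longrightarrow> x $ i = y $ i) \<longrightarrow> Q x $ j = Q y $ j)"

definition integral_solution ::
  "(real^'n::finite \<Rightarrow> real^'n) \<Rightarrow> real^'n \<Rightarrow> (real \<Rightarrow> real^'n) \<Rightarrow> real^'n \<Rightarrow> (real \<Rightarrow> real^'n) \<Rightarrow> bool" where
  "integral_solution Q \<sigma> f x0 x \<longleftrightarrow> continuous_on {0..1} x \<and>
     (\<forall>r\<in>{0..1}. x r = x0 + diag_mult \<sigma> (f r) + integral {0..r} (\<lambda>s. Q (x s)))"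

lemma bounded_linear_diag_mult: "bounded_linear (diag_mult \<sigma>)"
  unfolding linear_conv_bounded_linear[symmetric]
  by (rule linearI) (simp_all add: diag_mult_def vec_eq_iff distrib_left)

lemma integral_abs_continuous:
  fixes q :: "real \<Rightarrow> 'a::euclidean_space"
  assumes q: "continuous_on {0..1} q"
  shows "abs_continuous_on {0..1} (\<lambda>r. integral {0..r} q)"
proof -
  have "bounded (q ` {0..1})" using compact_continuous_image[OF q] compact_imp_bounded by blast
  then obtain C where "\<forall>s\<in>{0..1}. norm (q s) \<le> C" by (auto simp: bounded_iff)
  then have C: "norm (q s) \<le> C" if "s \<in> {0..1}" for s using that by blast
  have "0 \<le> C" using order_trans[OF norm_ge_zero C[of 0]] by simp
  show ?thesis
  proof (rule abs_continuous_on_bounded_by[OF abs_continuous_on_id \<open>0 \<le> C\<close>])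
    fix a b :: real assume ab: "a \<le> b" "{a..b} \<subseteq> {0..1}"
    then have "0 \<le> a" "b \<le> 1" by auto
    have "integral {0..a} q + integral {a..b} q = integral {0..b} q"
      using \<open>0 \<le> a\<close> \<open>a \<le> b\<close> \<open>b \<le> 1\<close>
      by (intro Henstock_Kurzweil_Integration.integral_combine integrable_continuous_real continuous_on_subset[OF q]) auto
    then have "integral {0..b} q - integral {0..a} q = integral {a..b} q" by (simp add: algebra_simps)
    moreover have "norm (integral {a..b} q) \<le> C * (b - a)"
      using ab by (intro integral_bound continuous_on_subset[OF q] C) auto
    ultimately show "norm (integral {0..b} q - integral {0..a} q) \<le> C * norm (b - a)" using ab by simp
  qed
qed

text \<open>
  As \<open>f\<close> is differentiable almost everywhere, the differential equation says that the derivative of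
  \<open>x - \<sigma> f - \<integral> Q(x)\<close> vanishes almost everywhere; for an absolutely continuous \<open>x\<close> this means that the
  difference is constant.
\<close>

lemma solution_iff_integral_solution:
  fixes Q :: "real^'n::finite \<Rightarrow> real^'n"
  assumes Q: "continuous_on UNIV Q" and f: "f \<in> controls"
  shows "is_solution Q \<sigma> f x0 x \<longleftrightarrow> integral_solution Q \<sigma> f x0 x"
proof -
  have acf: "abs_continuous_on {0..1} f" and f0: "f 0 = 0" using f by (simp_all add: controls_iff)
  have acsf: "abs_continuous_on {0..1} (\<lambda>s. diag_mult \<sigma> (f s))"
    by (rule abs_continuous_on_bounded_linear[OF bounded_linear_diag_mult acf])
  have dsf: "AE s in lebesgue. s \<in> {0..1} \<longrightarrow>
      ((\<lambda>s. diag_mult \<sigma> (f s)) has_vector_derivative diag_mult \<sigma> (time_deriv f s)) (at s within {0..1})"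
    using abs_continuous_differentiable_ae[OF acf]
    by eventually_elim (auto intro: bounded_linear.has_vector_derivative[OF bounded_linear_diag_mult])
  have dI: "((\<lambda>r. integral {0..r} (\<lambda>s. Q (x s))) has_vector_derivative Q (x s)) (at s within {0..1})"
    if "continuous_on {0..1} x" "s \<in> {0..1}" for s
    using integral_has_vector_derivative[of 0 1 "\<lambda>s. Q (x s)" s] continuous_on_compose2[OF Q that(1)] that(2) by simp
  have acI: "abs_continuous_on {0..1} (\<lambda>r. integral {0..r} (\<lambda>s. Q (x s)))" if "continuous_on {0..1} x"
    by (rule integral_abs_continuous) (rule continuous_on_compose2[OF Q that], simp)
  show ?thesis
  proof
    assume sol: "is_solution Q \<sigma> f x0 x"
    then have acx: "abs_continuous_on {0..1} x" and x0: "x 0 = x0" and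
      dx: "AE s in lebesgue. s \<in> {0..1} \<longrightarrow>
        (x has_vector_derivative (Q (x s) + diag_mult \<sigma> (time_deriv f s))) (at s within {0..1})"
      unfolding is_solution_def by auto
    have cx: "continuous_on {0..1} x" by (rule abs_continuous_on_imp_continuous_on[OF acx])
    define y where "y r = x r - diag_mult \<sigma> (f r) - integral {0..r} (\<lambda>s. Q (x s))" for r
    have acy: "abs_continuous_on {0..1} y"
      unfolding y_def by (intro abs_continuous_on_diff acx acsf acI cx)
    have "AE s in lebesgue. s \<in> {0..1} \<longrightarrow> (y has_vector_derivative 0) (at s within {0..1})"
      using dx dsf
    proof eventually_elim
      fix s assume 1: "s \<in> {0..1} \<longrightarrow> (x has_vector_derivative (Q (x s) + diag_mult \<sigma> (time_deriv f s))) (at s within {0..1})"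
        and 2: "s \<in> {0..1} \<longrightarrow> ((\<lambda>s. diag_mult \<sigma> (f s)) has_vector_derivative diag_mult \<sigma> (time_deriv f s)) (at s within {0..1})"
      show "s \<in> {0..1} \<longrightarrow> (y has_vector_derivative 0) (at s within {0..1})"
      proof
        assume s: "s \<in> {0..1}"
        from has_vector_derivative_diff[OF has_vector_derivative_diff[OF 1[rule_format, OF s] 2[rule_format, OF s]] dI[OF cx s]]
        show "(y has_vector_derivative 0) (at s within {0..1})" unfolding y_def by simp
      qed
    qed
    then have yr: "y r = y 0" if "r \<in> {0..1}" for r
      using abs_continuous_derivative_zero_imp_constant[OF acy] that by blast
    have "y 0 = x0" unfolding y_def using x0 f0 bounded_linear_diag_mult[of \<sigma>]
      by (simp add: linear_0 bounded_linear.linear)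
    have "x r = x0 + diag_mult \<sigma> (f r) + integral {0..r} (\<lambda>s. Q (x s))" if "r \<in> {0..1}" for r
    proof -
      have "x r - diag_mult \<sigma> (f r) - integral {0..r} (\<lambda>s. Q (x s)) = x0"
        using yr[OF that] \<open>y 0 = x0\<close> by (simp add: y_def)
      then show ?thesis by (simp add: algebra_simps)
    qed
    then show "integral_solution Q \<sigma> f x0 x" unfolding integral_solution_def using cx by blast
  next
    assume isol: "integral_solution Q \<sigma> f x0 x"
    then have cx: "continuous_on {0..1} x" and
      eq: "\<And>r. r \<in> {0..1} \<Longrightarrow> x r = x0 + (diag_mult \<sigma> (f r) + integral {0..r} (\<lambda>s. Q (x s)))"
      unfolding integral_solution_def by (auto simp: add.assoc)
    have acy: "abs_continuous_on {0..1} (\<lambda>r. diag_mult \<sigma> (f r) + integral {0..r} (\<lambda>s. Q (x s)))"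
      by (intro abs_continuous_on_add acsf acI cx)
    have acx: "abs_continuous_on {0..1} x"
    proof (rule abs_continuous_on_bounded_by[OF acy zero_le_one])
      fix a b :: real assume "a \<le> b" "{a..b} \<subseteq> {0..1}"
      then have "a \<in> {0..1}" "b \<in> {0..1}" by auto
      then show "norm (x b - x a) \<le> 1 * norm (diag_mult \<sigma> (f b) + integral {0..b} (\<lambda>s. Q (x s)) -
          (diag_mult \<sigma> (f a) + integral {0..a} (\<lambda>s. Q (x s))))"
        using eq[of a] eq[of b] by simp
    qed
    have "AE s in lebesgue. s \<in> {0..1} \<longrightarrow>
        (x has_vector_derivative (Q (x s) + diag_mult \<sigma> (time_deriv f s))) (at s within {0..1})"
      using dsf
    proof eventually_elim
      fix s assume 2: "s \<in> {0..1} \<longrightarrow> ((\<lambda>s. diag_mult \<sigma> (f s)) has_vector_derivative diag_mult \<sigma> (time_deriv f s)) (at s within {0..1})"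
      show "s \<in> {0..1} \<longrightarrow> (x has_vector_derivative (Q (x s) + diag_mult \<sigma> (time_deriv f s))) (at s within {0..1})"
      proof
        assume s: "s \<in> {0..1}"
        have "((\<lambda>r. x0 + (diag_mult \<sigma> (f r) + integral {0..r} (\<lambda>s. Q (x s)))) has_vector_derivative
            0 + (diag_mult \<sigma> (time_deriv f s) + Q (x s))) (at s within {0..1})"
          by (intro has_vector_derivative_add has_vector_derivative_const 2[rule_format, OF s] dI[OF cx s])
        then show "(x has_vector_derivative (Q (x s) + diag_mult \<sigma> (time_deriv f s))) (at s within {0..1})"
          using has_vector_derivative_transform[OF s eq] by (simp add: add.commute)
      qed
    qed
    moreover have "x 0 = x0" using eq[of 0] f0 bounded_linear_diag_mult[of \<sigma>]
      by (simp add: linear_0 bounded_linear.linear)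
    ultimately show "is_solution Q \<sigma> f x0 x" unfolding is_solution_def using acx by blast
  qed
qed

text \<open>
  Induction over the levels: once the lower components agree, the integrands of the component \<open>j\<close> agree, and the
  two solutions differ there by a constant, which vanishes at \<open>t\<close>. The case \<open>t = 0\<close> is uniqueness, the case of a later
  \<open>t\<close> is injectivity of the flow.
\<close>

lemma integral_solutions_agree:
  fixes Q :: "real^'n::finite \<Rightarrow> real^'n"
  assumes Q: "continuous_on UNIV Q" and tri: "triangular lev Q"
    and x: "integral_solution Q \<sigma> f x0 x" and y: "integral_solution Q \<sigma> f y0 y"
    and t: "t \<in> {0..1}" and eq: "x t = y t" and r: "r \<in> {0..1}"
  shows "x r = y r"
proof -
  have int: "(\<lambda>s. Q (z s)) integrable_on {0..r}" if "continuous_on {0..1} z" "r \<in> {0..1}" for z :: "real \<Rightarrow> real^'n" and r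
    using that by (intro integrable_continuous_real continuous_on_compose2[OF Q continuous_on_subset[OF that(1)]]) auto
  have comp: "z r $ j = z0 $ j + diag_mult \<sigma> (f r) $ j + integral {0..r} (\<lambda>s. Q (z s) $ j)"
    if "integral_solution Q \<sigma> f z0 z" "r \<in> {0..1}" for z z0 r j
  proof -
    have "continuous_on {0..1} z" "z r = z0 + diag_mult \<sigma> (f r) + integral {0..r} (\<lambda>s. Q (z s))"
      using that unfolding integral_solution_def by auto
    then show ?thesis using integral_component_eq_cart[OF int[of z r], of j] that(2) by simp
  qed
  have "\<forall>r\<in>{0..1}. x r $ j = y r $ j" for j
  proof (induction "lev j" arbitrary: j rule: less_induct)
    case less
    then have "Q (x s) $ j = Q (y s) $ j" if "s \<in> {0..1}" for s
      using tri that unfolding triangular_def by blast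
    then have I: "integral {0..r} (\<lambda>s. Q (x s) $ j) = integral {0..r} (\<lambda>s. Q (y s) $ j)" if "r \<in> {0..1}" for r
      using that by (intro integral_cong) auto
    have d: "x r $ j - y r $ j = x0 $ j - y0 $ j" if "r \<in> {0..1}" for r
      using comp[OF x that, of j] comp[OF y that, of j] I[OF that] by simp
    from d[OF t] eq have "x0 $ j - y0 $ j = 0" by simp
    then show ?case using d by simp
  qed
  then show ?thesis using r by (simp add: vec_eq_iff)
qed

text \<open>
  Picard iteration, with the integral over \<open>[0,r]\<close> transformed to \<open>[0,1]\<close> so that its continuity in \<open>(x0, r)\<close>
  is that of an integral depending on parameters.
\<close>

primrec picard :: "(real^'n::finite \<Rightarrow> real^'n) \<Rightarrow> (real \<Rightarrow> real^'n) \<Rightarrow> nat \<Rightarrow> real^'n \<Rightarrow> real \<Rightarrow> real^'n" where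
  "picard Q g 0 x0 r = x0"
| "picard Q g (Suc k) x0 r = x0 + g r + r *\<^sub>R integral {0..1} (\<lambda>u. Q (picard Q g k x0 (r * u)))"

lemma continuous_on_picard:
  fixes Q :: "real^'n::finite \<Rightarrow> real^'n"
  assumes Q: "continuous_on UNIV Q" and g: "continuous_on {0..1} g"
  shows "continuous_on (UNIV \<times> {0..1}) (\<lambda>(x0, r). picard Q g k x0 r)"
proof (induction k)
  case 0
  show ?case by (auto simp: case_prod_unfold intro: continuous_intros)
next
  case (Suc k)
  have "continuous_on ((UNIV \<times> {0..1}) \<times> cbox 0 1) (\<lambda>(p, u). Q (picard Q g k (fst p) (snd p * u)))"
  proof -
    have "continuous_on ((UNIV \<times> {0..1}) \<times> cbox 0 1) (\<lambda>z. (\<lambda>(x0, r). picard Q g k x0 r) (fst (fst z), snd (fst z) * snd z))"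
      by (rule continuous_on_compose2[OF Suc]) (auto intro!: continuous_intros simp: mult_le_one)
    then show ?thesis using continuous_on_compose2[OF Q, of _ "\<lambda>z. (\<lambda>(x0, r). picard Q g k x0 r) (fst (fst z), snd (fst z) * snd z)"]
      by (auto simp: case_prod_unfold)
  qed
  then have "continuous_on (UNIV \<times> {0..1}) (\<lambda>p. integral (cbox 0 1) (\<lambda>u. Q (picard Q g k (fst p) (snd p * u))))"
    by (rule integral_continuous_on_param)
  moreover have "continuous_on (UNIV \<times> {0..1}) (\<lambda>p. g (snd p))"
    by (rule continuous_on_compose2[OF g]) (auto intro: continuous_intros)
  ultimately show ?case by (auto simp: case_prod_unfold intro!: continuous_intros)
qed

text \<open>
  For a triangular field the iteration does not merely converge: the components of level less than \<open>k\<close> have reached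
  their final value after \<open>k\<close> steps.
\<close>

lemma picard_stable:
  fixes Q :: "real^'n::finite \<Rightarrow> real^'n"
  assumes Q: "continuous_on UNIV Q" and g: "continuous_on {0..1} g" and tri: "triangular lev Q"
  shows "lev j < k \<Longrightarrow> r \<in> {0..1} \<Longrightarrow> picard Q g k x0 r $ j = picard Q g (Suc k) x0 r $ j"
proof (induction k arbitrary: j r)
  case 0 then show ?case by simp
next
  case (Suc k)
  have int: "(\<lambda>u. Q (picard Q g k x0 (r * u))) integrable_on {0..1}" for k
  proof (intro integrable_continuous_real continuous_on_compose2[OF Q])
    have "continuous_on {0..1} (\<lambda>u. (\<lambda>(x0, r). picard Q g k x0 r) (x0, r * u))"
      using Suc.prems by (intro continuous_on_compose2[OF continuous_on_picard[OF Q g, of k]])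
        (auto intro!: continuous_intros simp: mult_le_one)
    then show "continuous_on {0..1} (\<lambda>u. picard Q g k x0 (r * u))" by simp
  qed auto
  have "Q (picard Q g k x0 (r * u)) $ j = Q (picard Q g (Suc k) x0 (r * u)) $ j" if "u \<in> {0..1}" for u
  proof -
    have "r * u \<in> {0..1}" using that Suc.prems by (auto simp: mult_le_one)
    then have "\<forall>i. lev i < lev j \<longrightarrow> picard Q g k x0 (r * u) $ i = picard Q g (Suc k) x0 (r * u) $ i"
      using Suc.IH Suc.prems by auto
    then show ?thesis using tri unfolding triangular_def by blast
  qed
  then have "integral {0..1} (\<lambda>u. Q (picard Q g k x0 (r * u)) $ j) = integral {0..1} (\<lambda>u. Q (picard Q g (Suc k) x0 (r * u)) $ j)"
    by (rule integral_cong)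
  then show ?case using int[of k] int[of "Suc k"]
    by (simp only: picard.simps(2) vector_add_component vector_scaleR_component integral_component_eq_cart)
qed

lemma integral_scale:
  fixes h :: "real \<Rightarrow> 'a::euclidean_space"
  assumes h: "continuous_on {0..r} h" and r: "0 \<le> r"
  shows "r *\<^sub>R integral {0..1} (\<lambda>u. h (r * u)) = integral {0..r} h"
proof (cases "r = 0")
  case True then show ?thesis by simp
next
  case False
  then have r: "0 < r" using r by simp
  have "((\<lambda>x. h (r * x)) has_integral (1 / \<bar>r\<bar>) *\<^sub>R integral {0..r} h) ((\<lambda>x. x / r) ` {0..r})"
    using r by (intro has_integral_stretch_real integrable_integral integrable_continuous_real h) auto
  moreover have "(\<lambda>x. x / r) ` {0..r} = {0..1}"
    using r image_mult_atLeastAtMost[of "1 / r" 0 r] by (simp add: divide_inverse mult.commute)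
  ultimately have "integral {0..1} (\<lambda>u. h (r * u)) = (1 / r) *\<^sub>R integral {0..r} h"
    using r by (simp add: integral_unique)
  then show ?thesis using r by simp
qed

lemma triangular_solution_exists:
  fixes Q :: "real^'n::finite \<Rightarrow> real^'n"
  assumes Q: "continuous_on UNIV Q" and f: "f \<in> controls" and tri: "triangular lev Q"
  shows "\<exists>X. (\<forall>x0. integral_solution Q \<sigma> f x0 (X x0)) \<and> (\<forall>r\<in>{0..1}. continuous_on UNIV (\<lambda>x0. X x0 r))"
proof -
  define g where "g r = diag_mult \<sigma> (f r)" for r
  have "continuous_on {0..1} f" using f by (intro abs_continuous_on_imp_continuous_on) (simp add: controls_iff)
  then have g: "continuous_on {0..1} g"
    unfolding g_def by (rule bounded_linear.continuous_on[OF bounded_linear_diag_mult])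
  define K where "K = Suc (Max (range lev))"
  have K: "lev j < K" for j unfolding K_def by (simp add: le_imp_less_Suc)
  define X where "X = picard Q g K"
  have fix_eq: "X x0 r = x0 + g r + r *\<^sub>R integral {0..1} (\<lambda>u. Q (X x0 (r * u)))" if "r \<in> {0..1}" for x0 r
    using picard_stable[OF Q g tri K that, where ?x0.0=x0] unfolding X_def by (simp add: vec_eq_iff)
  have cont: "continuous_on (UNIV \<times> {0..1}) (\<lambda>(x0, r). X x0 r)"
    unfolding X_def by (rule continuous_on_picard[OF Q g])
  have contr: "continuous_on {0..1} (X x0)" for x0
  proof -
    have "continuous_on {0..1} (\<lambda>r. (\<lambda>(x0, r). X x0 r) (x0, r))"
      by (rule continuous_on_compose2[OF cont]) (auto intro!: continuous_intros)
    then show ?thesis by simp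
  qed
  have "integral_solution Q \<sigma> f x0 (X x0)" for x0
    unfolding integral_solution_def
  proof (intro conjI ballI contr)
    fix r :: real assume r: "r \<in> {0..1}"
    have "continuous_on {0..r} (\<lambda>s. Q (X x0 s))"
      by (rule continuous_on_compose2[OF Q continuous_on_subset[OF contr]]) (use r in auto)
    from integral_scale[OF this] r fix_eq[OF r, of x0]
    show "X x0 r = x0 + diag_mult \<sigma> (f r) + integral {0..r} (\<lambda>s. Q (X x0 s))" by (simp add: g_def)
  qed
  moreover have "continuous_on UNIV (\<lambda>x0. X x0 r)" if "r \<in> {0..1}" for r
  proof -
    have "continuous_on UNIV (\<lambda>x0. (\<lambda>(x0, r). X x0 r) (x0, r))"
      by (rule continuous_on_compose2[OF cont]) (use that in \<open>auto intro!: continuous_intros\<close>)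
    then show ?thesis by simp
  qed
  ultimately show ?thesis by blast
qed

lemma flow_eqI:
  fixes Q :: "real^'n::finite \<Rightarrow> real^'n"
  assumes Q: "continuous_on UNIV Q" and f: "f \<in> controls" and tri: "triangular lev Q"
    and x: "integral_solution Q \<sigma> f x0 x" and t: "t \<in> {0..1}"
  shows "flow Q \<sigma> f x0 t = x t"
  unfolding flow_def solution_iff_integral_solution[OF Q f]
proof (rule the_equality)
  show "\<exists>xa. integral_solution Q \<sigma> f x0 xa \<and> xa t = x t" using x by blast
  fix y assume "\<exists>x. integral_solution Q \<sigma> f x0 x \<and> x t = y"
  then obtain z where z: "integral_solution Q \<sigma> f x0 z" "z t = y" by blast
  have "z 0 = x 0" using z(1) x unfolding integral_solution_def by simp
  then have "z t = x t" using integral_solutions_agree[OF Q tri z(1) x, of 0 t] t by simp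
  then show "y = x t" using z by simp
qed

lemma flow_is_solution:
  fixes Q :: "real^'n::finite \<Rightarrow> real^'n"
  assumes Q: "continuous_on UNIV Q" and f: "f \<in> controls" and tri: "triangular lev Q"
  shows "integral_solution Q \<sigma> f x0 (flow Q \<sigma> f x0)"
proof -
  obtain X where X: "integral_solution Q \<sigma> f x0 (X x0)"
    using triangular_solution_exists[OF Q f tri] by blast
  have eq: "flow Q \<sigma> f x0 r = X x0 r" if "r \<in> {0..1}" for r
    using flow_eqI[OF Q f tri X that] .
  show ?thesis unfolding integral_solution_def
  proof (intro conjI ballI)
    show "continuous_on {0..1} (flow Q \<sigma> f x0)"
    proof (rule continuous_on_eq)
      show "continuous_on {0..1} (X x0)" using X unfolding integral_solution_def by blast
    qed (use eq in simp)
    fix r :: real assume r: "r \<in> {0..1}"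
    have "integral {0..r} (\<lambda>s. Q (flow Q \<sigma> f x0 s)) = integral {0..r} (\<lambda>s. Q (X x0 s))"
      using r eq by (intro integral_cong) auto
    then show "flow Q \<sigma> f x0 r = x0 + diag_mult \<sigma> (f r) + integral {0..r} (\<lambda>s. Q (flow Q \<sigma> f x0 s))"
      using X r eq[OF r] unfolding integral_solution_def by simp
  qed
qed

lemma open_flow_image:
  fixes Q :: "real^'n::finite \<Rightarrow> real^'n"
  assumes Q: "continuous_on UNIV Q" and f: "f \<in> controls" and tri: "triangular lev Q"
    and t: "t \<in> {0..1}" and U: "open U"
  shows "open ((\<lambda>x. flow Q \<sigma> f x t) ` U)"
proof (rule invariance_of_domain[OF _ U])
  obtain X where X: "\<And>x0. integral_solution Q \<sigma> f x0 (X x0)" "continuous_on UNIV (\<lambda>x0. X x0 t)"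
    using triangular_solution_exists[OF Q f tri] t by blast
  have eq: "(\<lambda>x. flow Q \<sigma> f x t) = (\<lambda>x. X x t)" using flow_eqI[OF Q f tri X(1) t] by blast
  show "continuous_on U (\<lambda>x. flow Q \<sigma> f x t)" unfolding eq using X(2) continuous_on_subset by blast
  show "inj_on (\<lambda>x. flow Q \<sigma> f x t) U"
  proof (rule inj_onI)
    fix x y assume "flow Q \<sigma> f x t = flow Q \<sigma> f y t"
    then have "X x t = X y t" using eq by metis
    then have "X x 0 = X y 0" by (rule integral_solutions_agree[OF Q tri X(1) X(1) t]) simp
    moreover have "X z 0 = z + diag_mult \<sigma> (f 0)" for z
      using X(1)[of z] unfolding integral_solution_def by simp
    ultimately show "x = y" by simp
  qed
qed

lemma flow_concat_control:
  fixes Q :: "real^'n::finite \<Rightarrow> real^'n"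
  assumes Q: "continuous_on UNIV Q" and tri: "triangular lev Q"
    and f: "f \<in> controls" and g: "g \<in> controls" and ab: "0 \<le> a" "0 \<le> b" "a + b \<le> 1"
  shows "flow Q \<sigma> (concat_control f a g) x0 (a + b) = flow Q \<sigma> g (flow Q \<sigma> f x0 a) b"
proof -
  define x where "x = flow Q \<sigma> f x0"
  define y where "y = flow Q \<sigma> g (x a)"
  have x: "integral_solution Q \<sigma> f x0 x" unfolding x_def by (rule flow_is_solution[OF Q f tri])
  have y: "integral_solution Q \<sigma> g (x a) y" unfolding y_def by (rule flow_is_solution[OF Q g tri])
  have g0: "g 0 = 0" using g by (simp add: controls_iff)
  have lin: "diag_mult \<sigma> (u + v) = diag_mult \<sigma> u + diag_mult \<sigma> v" "diag_mult \<sigma> 0 = 0" for u v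
    by (auto simp: diag_mult_def vec_eq_iff algebra_simps)
  have y0: "y 0 = x a" using y g0 lin unfolding integral_solution_def by simp
  have cx: "continuous_on {0..1} x" and cy: "continuous_on {0..1} y"
    using x y unfolding integral_solution_def by auto
  define z where "z r = (if r \<le> a then x r else y (r - a))" for r
  have z2: "z r = y (r - a)" if "a \<le> r" for r using that y0 by (cases "r = a") (auto simp: z_def)
  have a1: "a \<le> 1" using ab by simp
  have cyr: "continuous_on {a..1} (\<lambda>r. y (r - a))"
    using ab by (intro continuous_on_compose2[OF cy]) (auto intro!: continuous_intros)
  have cz: "continuous_on {0..1} z"
  proof -
    have "continuous_on ({0..a} \<union> {a..1}) z"
    proof (rule continuous_on_closed_Un)
      have "continuous_on {0..a} x" using continuous_on_subset[OF cx, of "{0..a}"] a1 by simp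
      then show "continuous_on {0..a} z" by (rule continuous_on_eq) (simp add: z_def)
      show "continuous_on {a..1} z" using cyr by (rule continuous_on_eq) (simp add: z2)
    qed auto
    moreover have "{0..a} \<union> {a..1} = {0..1::real}" using ab by auto
    ultimately show ?thesis by simp
  qed
  have "integral_solution Q \<sigma> (concat_control f a g) x0 z"
    unfolding integral_solution_def
  proof (intro conjI ballI cz)
    fix r :: real assume r: "r \<in> {0..1}"
    show "z r = x0 + diag_mult \<sigma> (concat_control f a g r) + integral {0..r} (\<lambda>s. Q (z s))"
    proof (cases "r \<le> a")
      case True
      have "integral {0..r} (\<lambda>s. Q (z s)) = integral {0..r} (\<lambda>s. Q (x s))"
        using True by (intro integral_cong) (auto simp: z_def)
      then show ?thesis using True x r concat_control_simps(1)[of g r a f, OF g0]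
        unfolding integral_solution_def by (simp add: z_def)
    next
      case False
      then have ar: "a \<le> r" "r \<le> 1" using r by auto
      have "integral {0..a} (\<lambda>s. Q (z s)) + integral {a..r} (\<lambda>s. Q (z s)) = integral {0..r} (\<lambda>s. Q (z s))"
        using ab ar
        by (intro Henstock_Kurzweil_Integration.integral_combine integrable_continuous_real
            continuous_on_compose2[OF Q continuous_on_subset[OF cz]]) auto
      moreover have "integral {0..a} (\<lambda>s. Q (z s)) = integral {0..a} (\<lambda>s. Q (x s))"
        by (intro integral_cong) (auto simp: z_def)
      moreover have "integral {a..r} (\<lambda>s. Q (z s)) = integral {a..r} (\<lambda>s. Q (y (s - a)))"
        using z2 by (intro integral_cong) auto
      moreover have "integral {a..r} (\<lambda>s. Q (y (s - a))) = integral {0..r - a} (\<lambda>s. Q (y s))"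
        using integral_shift_real_ivl[of 0 "- a" "r - a" "\<lambda>s. Q (y s)"] by simp
      moreover have "x a = x0 + diag_mult \<sigma> (f a) + integral {0..a} (\<lambda>s. Q (x s))"
        using x ab a1 unfolding integral_solution_def by simp
      moreover have "y (r - a) = x a + diag_mult \<sigma> (g (r - a)) + integral {0..r - a} (\<lambda>s. Q (y s))"
        using y ab ar unfolding integral_solution_def by simp
      ultimately show ?thesis
        using concat_control_simps(2)[OF ar(1), of f g] z2[OF ar(1)] by (simp add: lin algebra_simps)
    qed
  qed
  then have "flow Q \<sigma> (concat_control f a g) x0 (a + b) = z (a + b)"
    using ab concat_control(1)[OF f g ab(1) a1] by (intro flow_eqI[OF Q _ tri]) auto
  also have "\<dots> = y b" using z2[of "a + b"] ab by simp
  finally show ?thesis unfolding y_def x_def .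
qed

section \<open>Polynomial functions of several variables\<close>

lemma polynomial_function_comp:
  "polynomial_function g \<Longrightarrow> polynomial_function f \<Longrightarrow> polynomial_function (\<lambda>x. g (f x))"
  using polynomial_function_compose[of f g] by (simp add: o_def)

lemma real_polynomial_function_comp:
  "real_polynomial_function g \<Longrightarrow> polynomial_function f \<Longrightarrow> real_polynomial_function (\<lambda>x. g (f x))"
  using polynomial_function_comp[of g f] by (simp add: real_polynomial_function_eq)

lemma polynomial_function_Pair:
  assumes "polynomial_function f" "polynomial_function g"
  shows "polynomial_function (\<lambda>x. (f x, g x))"
proof -
  have 1: "polynomial_function (\<lambda>x. (f x, 0))"
    by (rule polynomial_function_comp[OF _ assms(1)])
      (intro polynomial_function_bounded_linear bounded_linear_Pair bounded_linear_ident bounded_linear_zero)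
  have 2: "polynomial_function (\<lambda>x. (0, g x))"
    by (rule polynomial_function_comp[OF _ assms(2)])
      (intro polynomial_function_bounded_linear bounded_linear_Pair bounded_linear_ident bounded_linear_zero)
  have "polynomial_function (\<lambda>x. (f x, 0) + (0, g x))" using polynomial_function_add[OF 1 2] .
  then show ?thesis by simp
qed

lemma polynomial_function_fst: "polynomial_function fst"
  and polynomial_function_snd: "polynomial_function snd"
  by (auto intro: polynomial_function_bounded_linear bounded_linear_fst bounded_linear_snd)

lemma polynomial_function_vec_nth:
  "polynomial_function f \<Longrightarrow> real_polynomial_function (\<lambda>x. f x $ j)"
  using bounded_linear_vec_nth unfolding polynomial_function_def o_def by blast

lemma polynomial_function_vec:
  fixes f :: "'a::real_normed_vector \<Rightarrow> real^'n::finite"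
  assumes "\<And>j. real_polynomial_function (\<lambda>x. f x $ j)"
  shows "polynomial_function f"
  unfolding polynomial_function_iff_Basis_inner
proof
  fix b :: "real^'n" assume "b \<in> Basis"
  then obtain j where "b = axis j 1" by (auto simp: Basis_vec_def)
  then show "real_polynomial_function (\<lambda>x. f x \<bullet> b)" using assms[of j] by (simp add: inner_axis)
qed

lemma polynomial_has_derivative:
  fixes f :: "'a::real_normed_vector \<Rightarrow> 'b::euclidean_space"
  assumes "polynomial_function f"
  shows "(f has_derivative frechet_derivative f (at x)) (at x)"
  using differentiable_at_polynomial_function[OF assms] frechet_derivative_works by blast

lemma polynomial_continuous_on:
  fixes f :: "'a::real_normed_vector \<Rightarrow> 'b::euclidean_space"
  assumes "polynomial_function f"
  shows "continuous_on S f"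
  using differentiable_on_polynomial_function[OF assms] differentiable_imp_continuous_on by blast

lemma frechet_derivative_eqI:
  "(f has_derivative f') (at x) \<Longrightarrow> frechet_derivative f (at x) v = f' v"
  using frechet_derivative_at by metis

lemma frechet_derivative_linear:
  fixes f :: "'a::real_normed_vector \<Rightarrow> 'b::euclidean_space"
  assumes "polynomial_function f"
  shows "linear (frechet_derivative f (at x))"
  using polynomial_has_derivative[OF assms] has_derivative_linear by blast

lemma real_polynomial_function_frechet_derivative:
  "real_polynomial_function p \<Longrightarrow> real_polynomial_function (\<lambda>z. frechet_derivative p (at (fst z)) (snd z))"
proof (induction p rule: real_polynomial_function.induct)
  case (linear f)
  have "frechet_derivative f (at (fst z)) (snd z) = f (snd z)" for z :: "'a \<times> 'a"
    by (rule frechet_derivative_eqI) (rule bounded_linear.has_derivative[OF linear has_derivative_ident])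
  then show ?case
    using real_polynomial_function_comp[OF real_polynomial_function.intros(1)[OF linear] polynomial_function_snd] by simp
next
  case (const c)
  then show ?case by (simp add: real_polynomial_function.intros(2) frechet_derivative_const)
next
  case (add f g)
  have d: "(f has_derivative frechet_derivative f (at x)) (at x)" "(g has_derivative frechet_derivative g (at x)) (at x)" for x
    using add.hyps polynomial_has_derivative real_polynomial_function_eq by blast+
  have "frechet_derivative (\<lambda>x. f x + g x) (at x) v = frechet_derivative f (at x) v + frechet_derivative g (at x) v" for x v
    by (rule frechet_derivative_eqI[OF has_derivative_add[OF d]])
  then show ?case using real_polynomial_function.intros(3)[OF add.IH] by simp
next
  case (mult f g)
  have d: "(f has_derivative frechet_derivative f (at x)) (at x)" "(g has_derivative frechet_derivative g (at x)) (at x)" for x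
    using mult.hyps polynomial_has_derivative real_polynomial_function_eq by blast+
  have eq: "frechet_derivative (\<lambda>x. f x * g x) (at x) v = f x * frechet_derivative g (at x) v + frechet_derivative f (at x) v * g x" for x v
    by (rule frechet_derivative_eqI[OF has_derivative_mult[OF d]])
  have "real_polynomial_function (\<lambda>z. f (fst z))" "real_polynomial_function (\<lambda>z. g (fst z))"
    using mult.hyps real_polynomial_function_comp polynomial_function_fst by blast+
  then show ?case unfolding eq using mult.IH
    by (intro real_polynomial_function.intros(3) real_polynomial_function.intros(4))
qed

lemma polynomial_function_frechet_derivative:
  fixes f :: "'a::real_normed_vector \<Rightarrow> 'b::euclidean_space"
  assumes f: "polynomial_function f"
  shows "polynomial_function (\<lambda>z. frechet_derivative f (at (fst z)) (snd z))"
  unfolding polynomial_function_def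
proof (intro allI impI)
  fix h :: "'b \<Rightarrow> real" assume h: "bounded_linear h"
  have hf: "real_polynomial_function (\<lambda>x. h (f x))"
    using f h unfolding polynomial_function_def o_def by blast
  have "h (frechet_derivative f (at x) v) = frechet_derivative (\<lambda>x. h (f x)) (at x) v" for x v
    by (rule frechet_derivative_eqI[symmetric])
      (rule bounded_linear.has_derivative[OF h polynomial_has_derivative[OF f]])
  then show "real_polynomial_function (h \<circ> (\<lambda>z. frechet_derivative f (at (fst z)) (snd z)))"
    using real_polynomial_function_frechet_derivative[OF hf] by (simp add: o_def)
qed

text \<open>
  The expansion in powers of one real variable; it provides antiderivatives and the interchange of derivatives.
\<close>

lemma polynomial_in_first_variable:
  fixes p :: "real \<times> 'b::real_normed_vector \<Rightarrow> real"
  assumes "real_polynomial_function p"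
  shows "\<exists>c n. (\<forall>k. real_polynomial_function (c k)) \<and> (\<forall>k>n. \<forall>b. c k b = 0) \<and>
    (\<forall>r b. p (r, b) = (\<Sum>k\<le>n. c k b * r ^ k))"
  using assms
proof (induction p rule: real_polynomial_function.induct)
  case (linear f)
  define c where "c k = (if k = 0 then (\<lambda>b. f (0, b)) else if k = 1 then (\<lambda>b. f (1, 0)) else (\<lambda>b. 0))" for k :: nat
  have "bounded_linear (\<lambda>b. f (0, b))"
    by (rule bounded_linear_compose[OF linear]) (intro bounded_linear_Pair bounded_linear_zero bounded_linear_ident)
  then have "real_polynomial_function (c k)" for k
    by (auto simp: c_def)
  moreover have "f (r, b) = (\<Sum>k\<le>1. c k b * r ^ k)" for r b
  proof -
    have "(r, b) = r *\<^sub>R (1, 0) + (0, b)" by simp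
    then have "f (r, b) = r *\<^sub>R f (1, 0) + f (0, b)"
      using linear by (metis bounded_linear.linear linear_add linear_scale)
    then show ?thesis by (simp add: c_def)
  qed
  moreover have "\<forall>k>1. \<forall>b. c k b = 0" by (auto simp: c_def)
  ultimately show ?case by blast
next
  case (const c)
  show ?case
    by (intro exI[of _ "\<lambda>k b. if k = 0 then c else 0"] exI[of _ 0]) (auto simp: real_polynomial_function.intros(2))
next
  case (add f g)
  obtain a m where a: "\<And>k. real_polynomial_function (a k)" "\<And>k b. k > m \<Longrightarrow> a k b = 0"
    "\<And>r b. f (r, b) = (\<Sum>k\<le>m. a k b * r ^ k)" using add.IH(1) by blast
  obtain d n where d: "\<And>k. real_polynomial_function (d k)" "\<And>k b. k > n \<Longrightarrow> d k b = 0"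
    "\<And>r b. g (r, b) = (\<Sum>k\<le>n. d k b * r ^ k)" using add.IH(2) by blast
  have "f (r, b) = (\<Sum>k\<le>max m n. a k b * r ^ k)" for r b
    unfolding a(3) by (rule sum.mono_neutral_left) (use a(2) in auto)
  moreover have "g (r, b) = (\<Sum>k\<le>max m n. d k b * r ^ k)" for r b
    unfolding d(3) by (rule sum.mono_neutral_left) (use d(2) in auto)
  ultimately have "f (r, b) + g (r, b) = (\<Sum>k\<le>max m n. (a k b + d k b) * r ^ k)" for r b
    by (simp add: sum.distrib distrib_right)
  moreover have "\<forall>k. real_polynomial_function (\<lambda>b. a k b + d k b)" using a(1) d(1) by auto
  moreover have "\<forall>k>max m n. \<forall>b. a k b + d k b = 0" using a(2) d(2) by auto
  ultimately show ?case by (intro exI[of _ "\<lambda>k b. a k b + d k b"] exI[of _ "max m n"]) auto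
next
  case (mult f g)
  obtain a m where a: "\<And>k. real_polynomial_function (a k)" "\<And>k b. k > m \<Longrightarrow> a k b = 0"
    "\<And>r b. f (r, b) = (\<Sum>k\<le>m. a k b * r ^ k)" using mult.IH(1) by blast
  obtain d n where d: "\<And>k. real_polynomial_function (d k)" "\<And>k b. k > n \<Longrightarrow> d k b = 0"
    "\<And>r b. g (r, b) = (\<Sum>k\<le>n. d k b * r ^ k)" using mult.IH(2) by blast
  define e where "e k b = (\<Sum>i\<le>k. a i b * d (k - i) b)" for k b
  have "f (r, b) * g (r, b) = (\<Sum>k\<le>m + n. e k b * r ^ k)" for r b
    unfolding a(3) d(3) e_def using polynomial_product[of m "\<lambda>i. a i b" n "\<lambda>i. d i b" r] a(2) d(2) by simp
  moreover have "\<forall>k. real_polynomial_function (e k)"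
    unfolding e_def using a(1) d(1) by (intro allI real_polynomial_function_sum real_polynomial_function.intros(4)) auto
  moreover have "\<forall>k>m + n. \<forall>b. e k b = 0"
  proof (intro allI impI)
    fix k b assume "m + n < k"
    then have "i > m \<or> k - i > n" for i by linarith
    then have "a i b * d (k - i) b = 0" for i using a(2) d(2) by (metis mult_zero_left mult_zero_right)
    then show "e k b = 0" unfolding e_def by (intro sum.neutral) blast
  qed
  ultimately show ?case by blast
qed

lemma polynomial_antiderivative:
  fixes p :: "real \<times> 'b::real_normed_vector \<Rightarrow> real"
  assumes "real_polynomial_function p"
  shows "\<exists>q. real_polynomial_function q \<and> (\<forall>b. q (0, b) = 0) \<and>
    (\<forall>r b. ((\<lambda>r. q (r, b)) has_real_derivative p (r, b)) (at r))"
proof -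
  obtain c n where c: "\<And>k. real_polynomial_function (c k)" "\<And>r b. p (r, b) = (\<Sum>k\<le>n. c k b * r ^ k)"
    using polynomial_in_first_variable[OF assms] by blast
  define q where "q z = (\<Sum>k\<le>n. c k (snd z) * (fst z ^ Suc k / real (Suc k)))" for z :: "real \<times> 'b"
  have "real_polynomial_function q"
    unfolding q_def
  proof (intro real_polynomial_function_sum real_polynomial_function.intros(4) real_polynomial_function_divide
        real_polynomial_function_power)
    show "real_polynomial_function (\<lambda>z::real \<times> 'b. c k (snd z))" for k
      by (rule real_polynomial_function_comp[OF c(1) polynomial_function_snd])
    show "real_polynomial_function (fst :: real \<times> 'b \<Rightarrow> real)"
      by (rule real_polynomial_function.intros(1)) (rule bounded_linear_fst)
  qed simp
  moreover have "q (0, b) = 0" for b by (simp add: q_def)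
  moreover have "((\<lambda>r. q (r, b)) has_real_derivative p (r, b)) (at r)" for r b
  proof -
    have "((\<lambda>r. r ^ Suc k / real (Suc k)) has_real_derivative r ^ k) (at r)" for k
      by (rule derivative_eq_intros refl | simp)+
    then show ?thesis
      unfolding q_def fst_conv snd_conv c(2) by (intro DERIV_sum DERIV_cmult)
  qed
  ultimately show ?thesis by blast
qed

section \<open>Polynomial flows\<close>

lemma has_vector_derivative_vec_iff:
  fixes f :: "real \<Rightarrow> real^'n::finite"
  shows "(f has_vector_derivative L) (at x) \<longleftrightarrow> (\<forall>j. ((\<lambda>x. f x $ j) has_real_derivative L $ j) (at x))"
proof
  assume "(f has_vector_derivative L) (at x)"
  then show "\<forall>j. ((\<lambda>x. f x $ j) has_real_derivative L $ j) (at x)"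
    using bounded_linear.has_vector_derivative[OF bounded_linear_vec_nth]
    by (auto simp: has_real_derivative_iff_has_vector_derivative)
qed (auto intro!: has_vector_derivative_vec simp: has_real_derivative_iff_has_vector_derivative)

lemma same_derivative_imp_eq:
  fixes f g :: "real \<Rightarrow> real"
  assumes f: "\<And>r. (f has_real_derivative d r) (at r)" and g: "\<And>r. (g has_real_derivative d r) (at r)"
    and 0: "f 0 = g 0"
  shows "f r = g r"
proof -
  have "((\<lambda>r. f r - g r) has_real_derivative 0) (at r)" for r
    using DERIV_diff[OF f g] by simp
  then have "f r - g r = f 0 - g 0" using DERIV_isconst_all[of "\<lambda>r. f r - g r" r 0] by blast
  then show ?thesis using 0 by simp
qed

lemma triangular_ode_unique:
  fixes X :: "real^'n::finite \<Rightarrow> real^'n"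
  assumes tri: "triangular lev X"
    and x: "\<And>r. (x has_vector_derivative X (x r)) (at r)"
    and y: "\<And>r. (y has_vector_derivative X (y r)) (at r)" and 0: "x 0 = y 0"
  shows "x r = y r"
proof -
  have "\<forall>r. x r $ j = y r $ j" for j
  proof (induction "lev j" arbitrary: j rule: less_induct)
    case less
    then have "X (x r) $ j = X (y r) $ j" for r using tri unfolding triangular_def by blast
    then have "((\<lambda>r. y r $ j) has_real_derivative X (x r) $ j) (at r)" for r
      using y by (simp add: has_vector_derivative_vec_iff)
    moreover have "((\<lambda>r. x r $ j) has_real_derivative X (x r) $ j) (at r)" for r
      using x by (simp add: has_vector_derivative_vec_iff)
    ultimately show ?case
      using same_derivative_imp_eq[of "\<lambda>r. x r $ j" "\<lambda>r. X (x r) $ j" "\<lambda>r. y r $ j"] 0 by simp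
  qed
  then show ?thesis by (simp add: vec_eq_iff)
qed

text \<open>
  Repeated integration keeps the approximate flows polynomial, and each round makes one further level of components
  solve the equation exactly.
\<close>

lemma triangular_polynomial_flow:
  fixes X :: "'a::euclidean_space \<times> (real^'n::finite) \<Rightarrow> real^'n"
  assumes X: "polynomial_function X" and tri: "\<And>a. triangular lev (\<lambda>x. X (a, x))"
  shows "\<exists>\<Phi> :: real \<times> 'a \<times> (real^'n) \<Rightarrow> real^'n. polynomial_function \<Phi> \<and> (\<forall>a x. \<Phi> (0, a, x) = x) \<and>
    (\<forall>r a x. ((\<lambda>r. \<Phi> (r, a, x)) has_vector_derivative X (a, \<Phi> (r, a, x))) (at r))"
proof -
  have "\<exists>\<Phi> :: real \<times> 'a \<times> (real^'n) \<Rightarrow> real^'n. polynomial_function \<Phi> \<and> (\<forall>a x. \<Phi> (0, a, x) = x) \<and>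
    (\<forall>j. lev j < k \<longrightarrow> (\<forall>r a x. ((\<lambda>r. \<Phi> (r, a, x) $ j) has_real_derivative X (a, \<Phi> (r, a, x)) $ j) (at r)))" for k
  proof (induction k)
    case 0
    have "polynomial_function (\<lambda>z::real \<times> 'a \<times> (real^'n). snd (snd z))"
      by (intro polynomial_function_comp[OF polynomial_function_snd] polynomial_function_snd)
    then show ?case by (intro exI[of _ "\<lambda>z. snd (snd z)"]) auto
  next
    case (Suc k)
    then obtain \<Phi> :: "real \<times> 'a \<times> (real^'n) \<Rightarrow> real^'n" where \<Phi>: "polynomial_function \<Phi>" "\<And>a x. \<Phi> (0, a, x) = x"
      "\<And>j r a x. lev j < k \<Longrightarrow> ((\<lambda>r. \<Phi> (r, a, x) $ j) has_real_derivative X (a, \<Phi> (r, a, x)) $ j) (at r)"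
      by blast
    have "polynomial_function (\<lambda>z::real \<times> 'a \<times> (real^'n). X (fst (snd z), \<Phi> z))"
      by (intro polynomial_function_comp[OF X] polynomial_function_Pair \<Phi>(1)
          polynomial_function_comp[OF polynomial_function_fst] polynomial_function_snd)
    then have "\<exists>q. real_polynomial_function q \<and> (\<forall>b. q (0, b) = 0) \<and>
      (\<forall>r b. ((\<lambda>r. q (r, b)) has_real_derivative X (fst b, \<Phi> (r, b)) $ j) (at r))" for j
      using polynomial_antiderivative[OF polynomial_function_vec_nth[of "\<lambda>z. X (fst (snd z), \<Phi> z)" j]] by simp
    then obtain q where q: "\<And>j. real_polynomial_function (q j)" "\<And>j b. q j (0, b) = 0"
      "\<And>j r b. ((\<lambda>r. q j (r, b)) has_real_derivative X (fst b, \<Phi> (r, b)) $ j) (at r)" by metis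
    define \<Psi> where "\<Psi> z = snd (snd z) + (\<chi> j. q j z)" for z :: "real \<times> 'a \<times> (real^'n)"
    have d\<Psi>: "((\<lambda>r. \<Psi> (r, a, x) $ j) has_real_derivative X (a, \<Phi> (r, a, x)) $ j) (at r)" for r a x j
      unfolding \<Psi>_def using DERIV_add[OF DERIV_const[of "x $ j"] q(3)[of j "(a, x)" r]] by simp
    have \<Psi>0: "\<Psi> (0, a, x) = x" for a x unfolding \<Psi>_def using q(2) by (simp add: vec_eq_iff)
    have "polynomial_function \<Psi>" unfolding \<Psi>_def
      by (intro polynomial_function_add polynomial_function_comp[OF polynomial_function_snd] polynomial_function_snd
          polynomial_function_vec) (simp add: q(1))
    moreover have "X (a, \<Phi> (r, a, x)) $ j = X (a, \<Psi> (r, a, x)) $ j" if "lev j < Suc k" for j r a x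
    proof -
      have "\<Phi> (r, a, x) $ i = \<Psi> (r, a, x) $ i" if "lev i < lev j" for i
        using same_derivative_imp_eq[OF \<Phi>(3)[of i a x] d\<Psi>[of a x i]] \<Phi>(2) \<Psi>0 that \<open>lev j < Suc k\<close> by simp
      then show ?thesis using tri[of a] unfolding triangular_def by blast
    qed
    then have "((\<lambda>r. \<Psi> (r, a, x) $ j) has_real_derivative X (a, \<Psi> (r, a, x)) $ j) (at r)" if "lev j < Suc k" for j r a x
      using d\<Psi>[of a x j r] that by simp
    ultimately show ?case using \<Psi>0 by (intro exI[of _ \<Psi>]) blast
  qed
  then obtain \<Phi> :: "real \<times> 'a \<times> (real^'n) \<Rightarrow> real^'n" where \<Phi>: "polynomial_function \<Phi>" "\<And>a x. \<Phi> (0, a, x) = x"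
      "\<And>j r a x. lev j < Suc (Max (range lev)) \<Longrightarrow> ((\<lambda>r. \<Phi> (r, a, x) $ j) has_real_derivative X (a, \<Phi> (r, a, x)) $ j) (at r)"
    by metis
  have "lev j < Suc (Max (range lev))" for j by (simp add: le_imp_less_Suc)
  then have "((\<lambda>r. \<Phi> (r, a, x)) has_vector_derivative X (a, \<Phi> (r, a, x))) (at r)" for r a x
    unfolding has_vector_derivative_vec_iff using \<Phi>(3) by blast
  then show ?thesis using \<Phi>(1,2) by blast
qed


section \<open>The group generated by the vector fields\<close>

locale polynomial_system =
  fixes Q :: "real^'n::finite \<Rightarrow> real^'n" and \<sigma> :: "real^'n" and lev :: "'n \<Rightarrow> nat"
  assumes poly_Q: "polynomial_function Q" and tri: "triangular lev Q"
begin

text \<open>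
  The linear combination \<open>\<tau> Z\<^sub>0 + \<Sum> c\<^sup>l Z\<^sub>l\<close> of the given vector fields, for \<open>a = (\<tau>, c)\<close>. A pair with \<open>\<tau> = 0\<close> is an
  instantaneous displacement by \<open>\<sigma> c\<close>.
\<close>

definition field :: "real \<times> (real^'n) \<Rightarrow> real^'n \<Rightarrow> real^'n" where
  "field a x = fst a *\<^sub>R Q x + diag_mult \<sigma> (snd a)"

lemma polynomial_function_field:
  assumes "polynomial_function A" "polynomial_function B"
  shows "polynomial_function (\<lambda>z. field (A z) (B z))"
proof -
  have "polynomial_function (\<lambda>z. diag_mult \<sigma> (snd (A z)))"
    by (rule polynomial_function_comp[OF polynomial_function_bounded_linear[OF bounded_linear_diag_mult]
          polynomial_function_comp[OF polynomial_function_snd assms(1)]])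
  moreover have "polynomial_function (\<lambda>z. fst (A z) *\<^sub>R Q (B z))"
    by (rule polynomial_function_mult[OF polynomial_function_comp[OF polynomial_function_fst assms(1)]
          polynomial_function_comp[OF poly_Q assms(2)]])
  ultimately show ?thesis unfolding field_def by (rule polynomial_function_add[rotated])
qed

lemma triangular_field: "triangular lev (field a)"
  using tri unfolding triangular_def field_def by (metis vector_add_component vector_scaleR_component)

lemma field_scale: "field (s *\<^sub>R a) x = s *\<^sub>R field a x"
  by (simp add: field_def diag_mult_def vec_eq_iff algebra_simps)

definition Phi :: "real \<times> (real \<times> (real^'n)) \<times> (real^'n) \<Rightarrow> real^'n" where
  "Phi = (SOME \<Phi>. polynomial_function \<Phi> \<and> (\<forall>a x. \<Phi> (0, a, x) = x) \<and>
    (\<forall>r a x. ((\<lambda>r. \<Phi> (r, a, x)) has_vector_derivative field a (\<Phi> (r, a, x))) (at r)))"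

definition pflow :: "real \<Rightarrow> real \<times> (real^'n) \<Rightarrow> real^'n \<Rightarrow> real^'n" where
  "pflow r a x = Phi (r, a, x)"

lemma Phi:
  "polynomial_function Phi \<and> (\<forall>a x. Phi (0, a, x) = x) \<and>
    (\<forall>r a x. ((\<lambda>r. Phi (r, a, x)) has_vector_derivative field a (Phi (r, a, x))) (at r))"
proof -
  have "\<exists>\<Phi>. polynomial_function \<Phi> \<and> (\<forall>a x. \<Phi> (0, a, x) = x) \<and>
    (\<forall>r a x. ((\<lambda>r. \<Phi> (r, a, x)) has_vector_derivative field a (\<Phi> (r, a, x))) (at r))"
    using triangular_polynomial_flow[of "\<lambda>z. field (fst z) (snd z)" lev,
        OF polynomial_function_field[OF polynomial_function_fst polynomial_function_snd]] triangular_field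
    by simp
  then show ?thesis unfolding Phi_def by (rule someI_ex)
qed

lemma pflow_0: "pflow 0 a x = x"
  using Phi unfolding pflow_def by blast

lemma pflow_deriv: "((\<lambda>r. pflow r a x) has_vector_derivative field a (pflow r a x)) (at r)"
  using Phi unfolding pflow_def by blast

lemma polynomial_function_pflow:
  assumes "polynomial_function R" "polynomial_function A" "polynomial_function B"
  shows "polynomial_function (\<lambda>z. pflow (R z) (A z) (B z))"
  unfolding pflow_def using Phi
  by (intro polynomial_function_comp[of Phi "\<lambda>z. (R z, A z, B z)"] polynomial_function_Pair assms) simp

lemma pflow_unique:
  assumes "\<And>r. (y has_vector_derivative field a (y r)) (at r)"
  shows "y r = pflow r a (y 0)"
  using triangular_ode_unique[OF triangular_field assms pflow_deriv] pflow_0 by metis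

lemma pflow_add: "pflow (r + s) a x = pflow r a (pflow s a x)"
proof -
  have "((\<lambda>r. pflow (r + s) a x) has_vector_derivative field a (pflow (r + s) a x)) (at r)" for r
  proof -
    have "((\<lambda>r. pflow r a x) \<circ> (\<lambda>r. r + s) has_vector_derivative 1 *\<^sub>R field a (pflow (r + s) a x)) (at r)"
      by (rule vector_diff_chain_at[OF _ pflow_deriv]) (auto intro!: derivative_eq_intros)
    then show ?thesis by (simp add: o_def)
  qed
  from pflow_unique[of "\<lambda>r. pflow (r + s) a x", OF this] show ?thesis by simp
qed

lemma pflow_scale: "pflow (s * r) a x = pflow r (s *\<^sub>R a) x"
proof -
  have "((\<lambda>r. pflow (s * r) a x) has_vector_derivative field (s *\<^sub>R a) (pflow (s * r) a x)) (at r)" for r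
  proof -
    have "((\<lambda>r. pflow r a x) \<circ> (\<lambda>r. s * r) has_vector_derivative s *\<^sub>R field a (pflow (s * r) a x)) (at r)"
      by (rule vector_diff_chain_at[OF _ pflow_deriv]) (auto intro!: derivative_eq_intros)
    then show ?thesis by (simp add: o_def field_scale)
  qed
  from pflow_unique[of "\<lambda>r. pflow (s * r) a x", OF this] show ?thesis by (simp add: pflow_0)
qed

lemma pflow_impulse: "pflow r (0, c) x = x + r *\<^sub>R diag_mult \<sigma> c"
proof -
  have "((\<lambda>r. x + r *\<^sub>R diag_mult \<sigma> c) has_vector_derivative field (0, c) (x + r *\<^sub>R diag_mult \<sigma> c)) (at r)" for r
    unfolding field_def by (auto intro!: derivative_eq_intros)
  from pflow_unique[of "\<lambda>r. x + r *\<^sub>R diag_mult \<sigma> c", OF this] show ?thesis by simp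
qed

definition step :: "real \<times> (real^'n) \<Rightarrow> real^'n \<Rightarrow> real^'n" where "step a x = pflow 1 a x"

lemma step_zero: "step 0 x = x"
  using pflow_scale[of 0 1 0 x] by (simp add: step_def pflow_0)

lemma step_uminus: "step (- a) (step a x) = x"
proof -
  have "pflow 1 (- a) (pflow 1 a x) = pflow (- 1) a (pflow 1 a x)"
    using pflow_scale[of "- 1" 1 a] by simp
  also have "\<dots> = x" using pflow_add[of "- 1" 1 a x] by (simp add: pflow_0)
  finally show ?thesis by (simp add: step_def)
qed

definition act :: "(real \<times> (real^'n)) list \<Rightarrow> real^'n \<Rightarrow> real^'n" where "act w = fold step w"

lemma act_simps: "act [] x = x" "act (a # w) x = act w (step a x)" "act (v @ w) x = act w (act v x)"
  by (simp_all add: act_def)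

definition inv_word :: "(real \<times> (real^'n)) list \<Rightarrow> (real \<times> (real^'n)) list" where
  "inv_word w = map uminus (rev w)"

lemma act_inv_word: "act (inv_word w) (act w x) = x"
  by (induction w arbitrary: x) (auto simp: inv_word_def act_simps step_uminus)

lemma polynomial_function_act:
  assumes "\<And>A. A \<in> set As \<Longrightarrow> polynomial_function A" "polynomial_function B"
  shows "polynomial_function (\<lambda>z. act (map (\<lambda>A. A z) As) (B z))"
  using assms
proof (induction As arbitrary: B)
  case Nil then show ?case by (simp add: act_simps)
next
  case (Cons A As)
  have "polynomial_function (\<lambda>z. step (A z) (B z))"
    unfolding step_def using Cons.prems by (intro polynomial_function_pflow polynomial_function_const) auto
  then show ?case using Cons.IH[of "\<lambda>z. step (A z) (B z)"] Cons.prems by (simp add: act_simps)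
qed

lemma polynomial_function_act_word: "polynomial_function (act w)"
proof -
  have "polynomial_function (\<lambda>z::real^'n. act (map (\<lambda>A. A z) (map (\<lambda>a z. a) w)) z)"
    by (rule polynomial_function_act[where B="\<lambda>z. z"]) auto
  then show ?thesis by (simp add: o_def)
qed

section \<open>Directions reachable from the origin\<close>

text \<open>
  Words whose letters depend on a parameter \<open>\<theta>\<close>, but whose times do not: varying \<open>\<theta>\<close> must not change the total time.
\<close>

definition family :: "(real^'n \<Rightarrow> real \<times> (real^'n)) list \<Rightarrow> bool" where
  "family As \<longleftrightarrow> (\<forall>A\<in>set As. polynomial_function A \<and> (\<forall>\<theta>. fst (A \<theta>) = fst (A 0)))"

text \<open>
  Requiring the word to act trivially everywhere at \<open>\<theta> = 0\<close>, and not just to fix the point \<open>0\<close>, makes the derivatives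
  of concatenated words add up.
\<close>

definition realized :: "(real^'n \<Rightarrow> real^'n) \<Rightarrow> bool" where
  "realized L \<longleftrightarrow> (\<exists>As. family As \<and> (\<forall>x. act (map (\<lambda>A. A 0) As) x = x) \<and>
     ((\<lambda>\<theta>. act (map (\<lambda>A. A \<theta>) As) 0) has_derivative L) (at 0))"

lemma realized_zero: "realized (\<lambda>\<theta>. 0)"
  unfolding realized_def by (intro exI[of _ "[]"]) (auto simp: family_def act_simps)

lemma realized_add:
  assumes "realized L" "realized M"
  shows "realized (\<lambda>\<theta>. L \<theta> + M \<theta>)"
proof -
  obtain As where As: "family As" "\<And>x. act (map (\<lambda>A. A 0) As) x = x"
    "((\<lambda>\<theta>. act (map (\<lambda>A. A \<theta>) As) 0) has_derivative L) (at 0)"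
    using assms(1) unfolding realized_def by blast
  obtain Bs where Bs: "family Bs" "\<And>x. act (map (\<lambda>A. A 0) Bs) x = x"
    "((\<lambda>\<theta>. act (map (\<lambda>A. A \<theta>) Bs) 0) has_derivative M) (at 0)"
    using assms(2) unfolding realized_def by blast
  define G where "G z = act (map (\<lambda>A. A (fst z)) Bs) (snd z)" for z :: "(real^'n) \<times> (real^'n)"
  have "polynomial_function (\<lambda>z. act (map (\<lambda>A. A z) (map (\<lambda>A z. A (fst z)) Bs)) (snd z))"
  proof (rule polynomial_function_act[OF _ polynomial_function_snd])
    fix A :: "(real^'n) \<times> (real^'n) \<Rightarrow> real \<times> (real^'n)"
    assume "A \<in> set (map (\<lambda>A z. A (fst z)) Bs)"
    then obtain A' where "A' \<in> set Bs" "A = (\<lambda>z. A' (fst z))" by auto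
    then show "polynomial_function A"
      using Bs(1) polynomial_function_comp[OF _ polynomial_function_fst, of A'] unfolding family_def by auto
  qed
  then have G: "polynomial_function G" unfolding G_def by (simp add: o_def)
  define D where "D = frechet_derivative G (at (0, 0))"
  have D: "(G has_derivative D) (at (0, 0))" unfolding D_def by (rule polynomial_has_derivative[OF G])
  interpret D: bounded_linear D using D by (rule has_derivative_bounded_linear)
  have 1: "D (h, 0) = M h" for h
  proof -
    have "((\<lambda>\<theta>. G (\<theta>, 0)) has_derivative (\<lambda>h. D (h, 0))) (at 0)"
      by (rule has_derivative_compose[of "\<lambda>\<theta>. (\<theta>, 0)" "\<lambda>h. (h, 0)", OF _ D])
        (auto intro!: derivative_eq_intros)
    then have "((\<lambda>\<theta>. act (map (\<lambda>A. A \<theta>) Bs) 0) has_derivative (\<lambda>h. D (h, 0))) (at 0)"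
      by (simp add: G_def)
    from has_derivative_unique[OF this Bs(3)] show ?thesis by (rule fun_cong)
  qed
  have 2: "D (0, k) = k" for k
  proof -
    have "((\<lambda>x. G (0, x)) has_derivative (\<lambda>k. D (0, k))) (at 0)"
      by (rule has_derivative_compose[of "\<lambda>x. (0, x)" "\<lambda>h. (0, h)", OF _ D])
        (auto intro!: derivative_eq_intros)
    moreover have "(\<lambda>x. G (0, x)) = (\<lambda>x. x)" unfolding G_def using Bs(2) by simp
    ultimately have "((\<lambda>x. x) has_derivative (\<lambda>k. D (0, k))) (at 0)" by simp
    then show ?thesis using has_derivative_unique[OF _ has_derivative_ident] by metis
  qed
  have sum: "D (h, k) = M h + k" for h k
    using D.add[of "(h, 0)" "(0, k)"] 1 2 by simp
  have D': "(G has_derivative D) (at (0, act (map (\<lambda>A. A 0) As) 0))" using D As(2) by simp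
  have "((\<lambda>\<theta>. G (\<theta>, act (map (\<lambda>A. A \<theta>) As) 0)) has_derivative (\<lambda>h. D (h, L h))) (at 0)"
    by (rule has_derivative_compose[of "\<lambda>\<theta>. (\<theta>, act (map (\<lambda>A. A \<theta>) As) 0)" "\<lambda>h. (h, L h)", OF _ D'])
      (intro has_derivative_Pair has_derivative_ident As(3))
  then have "((\<lambda>\<theta>. act (map (\<lambda>A. A \<theta>) (As @ Bs)) 0) has_derivative (\<lambda>\<theta>. L \<theta> + M \<theta>)) (at 0)"
    by (simp add: sum add.commute G_def act_simps)
  then show ?thesis unfolding realized_def using As(1,2) Bs(1,2)
    by (intro exI[of _ "As @ Bs"]) (auto simp: family_def act_simps)
qed

text \<open>
  Quantifying over all linear functionals \<open>l\<close> lets different directions be steered by different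
  components of \<open>\<theta>\<close> and absorbs scalar factors.
\<close>

definition reachable_directions :: "(real^'n) set" where
  "reachable_directions = {v. \<forall>l. bounded_linear l \<longrightarrow> realized (\<lambda>\<theta>. l \<theta> *\<^sub>R v)}"

lemma subspace_reachable_directions: "subspace reachable_directions"
proof (rule subspaceI)
  show "0 \<in> reachable_directions" by (simp add: reachable_directions_def realized_zero)
  show "x + y \<in> reachable_directions" if "x \<in> reachable_directions" "y \<in> reachable_directions" for x y
    using that realized_add unfolding reachable_directions_def by (simp add: scaleR_add_right)
  show "c *\<^sub>R x \<in> reachable_directions" if "x \<in> reachable_directions" for c x
    unfolding reachable_directions_def
  proof (intro CollectI allI impI)
    fix l :: "real^'n \<Rightarrow> real" assume "bounded_linear l"
    then have "bounded_linear (\<lambda>\<theta>. l \<theta> * c)" by (rule bounded_linear_mult_const)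
    then have "realized (\<lambda>\<theta>. (l \<theta> * c) *\<^sub>R x)" using that unfolding reachable_directions_def by blast
    then show "realized (\<lambda>\<theta>. l \<theta> *\<^sub>R c *\<^sub>R x)" by simp
  qed
qed

text \<open>
  The value at \<open>0\<close> of the pullback of the vector field \<open>V\<close> under the diffeomorphism \<open>act w\<close>.
\<close>

definition pullback :: "(real \<times> (real^'n)) list \<Rightarrow> (real^'n \<Rightarrow> real^'n) \<Rightarrow> real^'n" where
  "pullback w V = frechet_derivative (act (inv_word w)) (at (act w 0)) (V (act w 0))"

text \<open>
  Move along \<open>w\<close>, make a displacement by \<open>l \<theta>\<close> times the constant field, and move back.
\<close>

lemma pullback_impulse:
  "pullback w (\<lambda>y. diag_mult \<sigma> c) \<in> reachable_directions"
  unfolding reachable_directions_def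
proof (intro CollectI allI impI)
  fix l :: "real^'n \<Rightarrow> real" assume l: "bounded_linear l"
  define As where "As = map (\<lambda>a \<theta>. a) w @ [\<lambda>\<theta>. (0, l \<theta> *\<^sub>R c)] @ map (\<lambda>a \<theta>. a) (inv_word w)"
  have l0: "l 0 = 0" using l by (simp add: bounded_linear.linear linear_0)
  have m: "map (\<lambda>A. A \<theta>) As = w @ [(0, l \<theta> *\<^sub>R c)] @ inv_word w" for \<theta>
    by (simp add: As_def o_def)
  have s: "step (0, b) x = x + diag_mult \<sigma> b" for b x by (simp add: step_def pflow_impulse)
  have lin: "diag_mult \<sigma> (r *\<^sub>R c) = r *\<^sub>R diag_mult \<sigma> c" for r
    by (simp add: diag_mult_def vec_eq_iff algebra_simps)
  have "polynomial_function (\<lambda>\<theta>. (0::real, l \<theta> *\<^sub>R c))"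
    using polynomial_function_bounded_linear[OF l]
    by (intro polynomial_function_Pair polynomial_function_mult polynomial_function_const)
  then have "family As" unfolding family_def As_def by auto
  moreover have "act (map (\<lambda>A. A 0) As) x = x" for x
    unfolding m using lin[of 0] by (simp add: act_simps s l0 lin act_inv_word)
  moreover have "((\<lambda>\<theta>. act (map (\<lambda>A. A \<theta>) As) 0) has_derivative (\<lambda>\<theta>. l \<theta> *\<^sub>R pullback w (\<lambda>y. diag_mult \<sigma> c))) (at 0)"
  proof -
    let ?F = "frechet_derivative (act (inv_word w)) (at (act w 0))"
    have F: "(act (inv_word w) has_derivative ?F) (at (act w 0 + l 0 *\<^sub>R diag_mult \<sigma> c))"
      using polynomial_has_derivative[OF polynomial_function_act_word] l0 by simp
    have "((\<lambda>\<theta>. act w 0 + l \<theta> *\<^sub>R diag_mult \<sigma> c) has_derivative (\<lambda>\<theta>. l \<theta> *\<^sub>R diag_mult \<sigma> c)) (at 0)"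
      by (auto intro!: derivative_eq_intros bounded_linear.has_derivative[OF l])
    from has_derivative_compose[OF this F]
    show ?thesis unfolding m pullback_def
      by (simp add: act_simps s lin linear_scale[OF frechet_derivative_linear[OF polynomial_function_act_word]])
  qed
  ultimately show "realized (\<lambda>\<theta>. l \<theta> *\<^sub>R pullback w (\<lambda>y. diag_mult \<sigma> c))" unfolding realized_def by blast
qed


section \<open>Pullbacks and brackets\<close>

lemma closed_under_derivative:
  fixes g :: "real \<Rightarrow> 'a::euclidean_space"
  assumes T: "subspace T" and g: "(g has_vector_derivative d) (at 0)" "\<And>\<epsilon>. g \<epsilon> \<in> T"
  shows "d \<in> T"
proof (rule Lim_in_closed_set[OF closed_subspace[OF T], of _ "at 0"])
  have "((\<lambda>h. norm (g h - g 0 - h *\<^sub>R d) / norm h) \<longlongrightarrow> 0) (at 0)"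
    using g(1) unfolding has_vector_derivative_def has_derivative_at by simp
  moreover have "\<forall>\<^sub>F h in at 0. norm (g h - g 0 - h *\<^sub>R d) / norm h = norm ((1 / h) *\<^sub>R (g h - g 0) - d)"
    unfolding eventually_at_filter
  proof (rule always_eventually, intro allI impI)
    fix h :: real assume "h \<noteq> 0"
    then have "(1 / h) *\<^sub>R (g h - g 0) - d = (1 / h) *\<^sub>R (g h - g 0 - h *\<^sub>R d)"
      by (simp add: scaleR_diff_right)
    then show "norm (g h - g 0 - h *\<^sub>R d) / norm h = norm ((1 / h) *\<^sub>R (g h - g 0) - d)"
      by simp
  qed
  ultimately have "((\<lambda>h. norm ((1 / h) *\<^sub>R (g h - g 0) - d)) \<longlongrightarrow> 0) (at 0)"
    by (rule Lim_transform_eventually)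
  then show "((\<lambda>h. (1 / h) *\<^sub>R (g h - g 0)) \<longlongrightarrow> d) (at 0)"
    by (metis LIM_zero_iff tendsto_norm_zero_iff)
  show "\<forall>\<^sub>F h in at 0. (1 / h) *\<^sub>R (g h - g 0) \<in> T"
    using g(2) by (intro always_eventually allI subspace_scale[OF T] subspace_diff[OF T])
  show "at (0::real) \<noteq> bot" by simp
qed

lemma derivative_at_0_of_powers:
  fixes c :: "nat \<Rightarrow> real"
  assumes "\<And>k. k > n \<Longrightarrow> c k = 0"
  shows "((\<lambda>r. \<Sum>k\<le>n. c k * r ^ k) has_real_derivative c 1) (at 0)"
proof -
  have "((\<lambda>r. \<Sum>k\<le>n. c k * r ^ k) has_real_derivative (\<Sum>k\<le>n. c k * (real k * 0 ^ (k - 1)))) (at 0)"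
    by (intro DERIV_sum DERIV_cmult) (auto intro!: derivative_eq_intros)
  moreover have "c k * (real k * 0 ^ (k - 1)) = (if k = 1 then c 1 else 0)" for k
    by (cases k; cases "k = 1") auto
  ultimately show ?thesis using assms[of 1] by (cases "1 \<le> n") (auto simp: not_le)
qed

text \<open>
  Expanding the flow in powers of \<open>\<epsilon>\<close>, the coefficient of \<open>\<epsilon>\<close> is the vector field itself; differentiating the
  coefficients in space gives the claim.
\<close>

lemma pflow_mixed_derivative:
  "((\<lambda>\<epsilon>. frechet_derivative (pflow \<epsilon> a) (at y) v) has_vector_derivative
      frechet_derivative (field a) (at y) v) (at 0)"
  unfolding has_vector_derivative_vec_iff
proof
  fix j
  define H where "H z = pflow (fst z) a (snd z) $ j" for z :: "real \<times> (real^'n)"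
  have "real_polynomial_function H" unfolding H_def
    by (intro polynomial_function_vec_nth polynomial_function_pflow polynomial_function_fst
        polynomial_function_snd polynomial_function_const)
  from polynomial_in_first_variable[OF this]
  obtain c n where c: "\<And>k. real_polynomial_function (c k)" "\<And>k b. k > n \<Longrightarrow> c k b = 0"
    "\<And>r b. H (r, b) = (\<Sum>k\<le>n. c k b * r ^ k)" by blast
  have H: "pflow \<epsilon> a x $ j = (\<Sum>k\<le>n. c k x * \<epsilon> ^ k)" for \<epsilon> x using c(3)[of \<epsilon> x] by (simp add: H_def)
  have comp: "frechet_derivative f (at y) v $ j = frechet_derivative (\<lambda>x. f x $ j) (at y) v"
    if "polynomial_function f" for f :: "real^'n \<Rightarrow> real^'n"
    by (rule frechet_derivative_eqI[symmetric])
      (rule bounded_linear.has_derivative[OF bounded_linear_vec_nth polynomial_has_derivative[OF that]])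
  have c1: "c 1 = (\<lambda>x. field a x $ j)"
  proof
    fix x
    have "((\<lambda>r. pflow r a x $ j) has_real_derivative field a x $ j) (at 0)"
      using pflow_deriv[of a x 0] unfolding has_vector_derivative_vec_iff pflow_0 by blast
    moreover have "((\<lambda>r. pflow r a x $ j) has_real_derivative c 1 x) (at 0)"
      unfolding H by (rule derivative_at_0_of_powers) (use c(2) in auto)
    ultimately show "c 1 x = field a x $ j" using DERIV_unique by blast
  qed
  define dc where "dc k = frechet_derivative (c k) (at y) v" for k
  have dck: "(c k has_derivative frechet_derivative (c k) (at y)) (at y)" for k
    using c(1) polynomial_has_derivative real_polynomial_function_eq by blast
  have dc0: "dc k = 0" if "k > n" for k
  proof -
    have "c k = (\<lambda>b. 0)" using c(2)[OF that] by blast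
    then show ?thesis by (simp add: dc_def frechet_derivative_const)
  qed
  have "frechet_derivative (pflow \<epsilon> a) (at y) v $ j = (\<Sum>k\<le>n. dc k * \<epsilon> ^ k)" for \<epsilon>
  proof -
    have "polynomial_function (pflow \<epsilon> a)"
      using polynomial_function_pflow[of "\<lambda>z. \<epsilon>" "\<lambda>z. a" "\<lambda>z. z"] by simp
    then have "frechet_derivative (pflow \<epsilon> a) (at y) v $ j = frechet_derivative (\<lambda>x. pflow \<epsilon> a x $ j) (at y) v"
      by (rule comp)
    also have "\<dots> = (\<Sum>k\<le>n. dc k * \<epsilon> ^ k)" unfolding H dc_def
      by (rule frechet_derivative_eqI[where f'="\<lambda>v. \<Sum>k\<le>n. frechet_derivative (c k) (at y) v * \<epsilon> ^ k"])
        (intro has_derivative_sum has_derivative_mult_left dck)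
    finally show ?thesis .
  qed
  moreover have "frechet_derivative (field a) (at y) v $ j = dc 1"
    unfolding dc_def c1
    by (rule comp) (use polynomial_function_field[of "\<lambda>z. a" "\<lambda>z. z"] in simp)
  ultimately show "((\<lambda>\<epsilon>. frechet_derivative (pflow \<epsilon> a) (at y) v $ j) has_real_derivative
      frechet_derivative (field a) (at y) v $ j) (at 0)"
    using derivative_at_0_of_powers[of n dc] dc0 by simp
qed

text \<open>
  Appending the letter \<open>\<epsilon> a\<close> to \<open>w\<close> gives a curve \<open>\<epsilon> \<mapsto> pullback (w @ [\<epsilon> a]) V\<close> of reachable directions, whose
  derivative at \<open>\<epsilon> = 0\<close> is the pullback of the bracket with the field of \<open>a\<close>. As a subspace is closed,
  this derivative is again a reachable direction.
\<close>

lemma pullback_bracket: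
  assumes V: "polynomial_function V" and T: "\<And>w. pullback w V \<in> reachable_directions"
  shows "pullback w (lie_bracket (field a) V) \<in> reachable_directions"
proof -
  define y where "y = act w 0"
  define z where "z \<epsilon> = pflow \<epsilon> a y" for \<epsilon>
  define D0 where "D0 = frechet_derivative (act (inv_word w)) (at y)"
  have D0: "(act (inv_word w) has_derivative D0) (at y)"
    unfolding D0_def by (rule polynomial_has_derivative[OF polynomial_function_act_word])
  have pp: "polynomial_function (pflow \<epsilon> a)" for \<epsilon>
    using polynomial_function_pflow[of "\<lambda>z. \<epsilon>" "\<lambda>z. a" "\<lambda>z. z"] by simp
  define H where "H p = pflow (fst p) a (snd p)" for p :: "real \<times> (real^'n)"
  have H: "polynomial_function H" unfolding H_def
    by (intro polynomial_function_pflow polynomial_function_fst polynomial_function_snd polynomial_function_const)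
  define M where "M p = frechet_derivative H (at (fst p, fst (snd p))) (0, snd (snd p))"
    for p :: "real \<times> (real^'n) \<times> (real^'n)"
  have M_eq: "M (\<epsilon>, x, v) = frechet_derivative (pflow \<epsilon> a) (at x) v" for \<epsilon> x v
  proof -
    have "((\<lambda>x. H (\<epsilon>, x)) has_derivative (\<lambda>v. frechet_derivative H (at (\<epsilon>, x)) (0, v))) (at x)"
      by (rule has_derivative_compose[of "\<lambda>x. (\<epsilon>, x)" "\<lambda>v. (0, v)", OF _ polynomial_has_derivative[OF H]])
        (auto intro!: derivative_eq_intros)
    then have "(pflow \<epsilon> a has_derivative (\<lambda>v. frechet_derivative H (at (\<epsilon>, x)) (0, v))) (at x)"
      by (simp add: H_def)
    then show ?thesis using frechet_derivative_eqI[of "pflow \<epsilon> a"] by (simp add: M_def)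
  qed
  have Mpoly: "polynomial_function M"
  proof -
    have 1: "polynomial_function (\<lambda>p::real \<times> (real^'n) \<times> (real^'n). ((fst p, fst (snd p)), (0::real, snd (snd p))))"
      by (intro polynomial_function_Pair polynomial_function_fst polynomial_function_const
          polynomial_function_comp[OF polynomial_function_fst polynomial_function_snd]
          polynomial_function_comp[OF polynomial_function_snd polynomial_function_snd])
    show ?thesis
      using polynomial_function_comp[OF polynomial_function_frechet_derivative[OF H] 1]
      by (simp add: M_def[abs_def])
  qed
  define g where "g \<epsilon> = pullback (w @ [\<epsilon> *\<^sub>R a]) V" for \<epsilon>
  have step_eq: "step (\<epsilon> *\<^sub>R a) x = pflow \<epsilon> a x" for \<epsilon> x
    using pflow_scale[of \<epsilon> 1 a x] by (simp add: step_def)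
  have g_eq: "g \<epsilon> = D0 (M (- \<epsilon>, z \<epsilon>, V (z \<epsilon>)))" for \<epsilon>
  proof -
    have e: "act (w @ [\<epsilon> *\<^sub>R a]) 0 = z \<epsilon>" by (simp add: act_simps step_eq z_def y_def)
    have i: "act (inv_word (w @ [\<epsilon> *\<^sub>R a])) = (\<lambda>x. act (inv_word w) (pflow (- \<epsilon>) a x))"
      using step_eq[of "- \<epsilon>"] by (auto simp: inv_word_def act_simps)
    have ret: "pflow (- \<epsilon>) a (z \<epsilon>) = y"
      unfolding z_def using pflow_add[of "- \<epsilon>" \<epsilon> a y] by (simp add: pflow_0)
    have "((\<lambda>x. act (inv_word w) (pflow (- \<epsilon>) a x)) has_derivative
        (\<lambda>v. D0 (frechet_derivative (pflow (- \<epsilon>) a) (at (z \<epsilon>)) v))) (at (z \<epsilon>))"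
      by (rule has_derivative_compose[OF polynomial_has_derivative[OF pp]]) (simp add: ret D0)
    then show ?thesis unfolding g_def pullback_def e i M_eq by (rule frechet_derivative_eqI)
  qed
  define DM where "DM = frechet_derivative M (at (0, y, V y))"
  have DM: "(M has_derivative DM) (at (0, y, V y))" unfolding DM_def by (rule polynomial_has_derivative[OF Mpoly])
  interpret DM: bounded_linear DM using DM by (rule has_derivative_bounded_linear)
  have z0: "z 0 = y" by (simp add: z_def pflow_0)
  have dz: "(z has_vector_derivative field a y) (at 0)"
    using pflow_deriv[of a y 0] unfolding z_def[abs_def] pflow_0 .
  define DV where "DV = frechet_derivative V (at y)"
  have DV: "(V has_derivative DV) (at (z 0))" unfolding DV_def z0 by (rule polynomial_has_derivative[OF V])
  interpret DV: bounded_linear DV using DV by (rule has_derivative_bounded_linear)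
  have dz': "(z has_derivative (\<lambda>h. h *\<^sub>R field a y)) (at 0)" using dz unfolding has_vector_derivative_def .
  have inner: "((\<lambda>\<epsilon>. (- \<epsilon>, z \<epsilon>, V (z \<epsilon>))) has_derivative (\<lambda>h. (- h, h *\<^sub>R field a y, DV (h *\<^sub>R field a y)))) (at 0)"
    by (intro has_derivative_Pair has_derivative_minus has_derivative_ident dz' has_derivative_compose[OF dz' DV])
  have DM': "(M has_derivative DM) (at (- 0, z 0, V (z 0)))" using DM z0 by simp
  have "((\<lambda>\<epsilon>. M (- \<epsilon>, z \<epsilon>, V (z \<epsilon>))) has_derivative (\<lambda>h. DM (- h, h *\<^sub>R field a y, DV (h *\<^sub>R field a y)))) (at 0)"
    by (rule has_derivative_compose[OF inner DM'])
  moreover have snd_part: "DM (0, u, v) = v" for u v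
  proof -
    have "((\<lambda>p. M (0, p)) has_derivative (\<lambda>p. DM (0, p))) (at (y, V y))"
      by (rule has_derivative_compose[of "\<lambda>p. (0, p)" "\<lambda>p. (0, p)", OF _ DM]) (auto intro!: derivative_eq_intros)
    moreover have "(\<lambda>p. M (0, p)) = snd"
    proof
      fix p :: "(real^'n) \<times> (real^'n)"
      obtain x v where p: "p = (x, v)" by (cases p)
      have "(pflow 0 a has_derivative (\<lambda>v. v)) (at x)"
        using has_derivative_ident by (simp add: pflow_0[abs_def])
      then show "M (0, p) = snd p" unfolding p M_eq using frechet_derivative_eqI[of "pflow 0 a" "\<lambda>v. v"] by simp
    qed
    moreover have "(snd has_derivative snd) (at (y, V y))" by (auto intro!: derivative_eq_intros)
    ultimately have "(\<lambda>p. DM (0, p)) = snd" using has_derivative_unique by metis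
    then show ?thesis by (metis snd_conv)
  qed
  moreover have fst_part: "DM (1, 0, 0) = frechet_derivative (field a) (at y) (V y)"
  proof -
    have "((\<lambda>\<epsilon>. M (\<epsilon>, y, V y)) has_derivative (\<lambda>h. DM (h, 0, 0))) (at 0)"
      by (rule has_derivative_compose[of "\<lambda>\<epsilon>. (\<epsilon>, y, V y)" "\<lambda>h. (h, 0, 0)", OF _ DM])
        (intro has_derivative_Pair has_derivative_ident has_derivative_const)
    moreover have "(\<lambda>h. DM (h, 0, 0)) = (\<lambda>h. h *\<^sub>R DM (1, 0, 0))"
    proof
      fix h :: real
      have "(h, 0, 0) = h *\<^sub>R (1 :: real, 0 :: real^'n, 0 :: real^'n)" by simp
      then show "DM (h, 0, 0) = h *\<^sub>R DM (1, 0, 0)" by (simp only: DM.scaleR)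
    qed
    ultimately have "((\<lambda>\<epsilon>. M (\<epsilon>, y, V y)) has_vector_derivative DM (1, 0, 0)) (at 0)"
      unfolding has_vector_derivative_def by simp
    moreover have "((\<lambda>\<epsilon>. M (\<epsilon>, y, V y)) has_vector_derivative frechet_derivative (field a) (at y) (V y)) (at 0)"
      unfolding M_eq by (rule pflow_mixed_derivative)
    ultimately show ?thesis using vector_derivative_unique_at by blast
  qed
  have "DM (- h, h *\<^sub>R field a y, DV (h *\<^sub>R field a y)) = h *\<^sub>R lie_bracket (field a) V y" for h
  proof -
    have "DM (- h, h *\<^sub>R field a y, DV (h *\<^sub>R field a y)) =
        DM ((- h) *\<^sub>R (1, 0, 0)) + DM (0, h *\<^sub>R field a y, DV (h *\<^sub>R field a y))"
      by (subst DM.add[symmetric]) simp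
    also have "\<dots> = (- h) *\<^sub>R frechet_derivative (field a) (at y) (V y) + h *\<^sub>R DV (field a y)"
      unfolding DM.scaleR fst_part snd_part DV.scaleR ..
    finally show ?thesis by (simp add: lie_bracket_def DV_def scaleR_diff_right)
  qed
  ultimately have "((\<lambda>\<epsilon>. M (- \<epsilon>, z \<epsilon>, V (z \<epsilon>))) has_vector_derivative lie_bracket (field a) V y) (at 0)"
    unfolding has_vector_derivative_def by simp
  moreover have "bounded_linear D0" using D0 by (rule has_derivative_bounded_linear)
  ultimately have "(g has_vector_derivative D0 (lie_bracket (field a) V y)) (at 0)"
    unfolding g_eq[abs_def] by (rule bounded_linear.has_vector_derivative[rotated])
  then have "D0 (lie_bracket (field a) V y) \<in> reachable_directions"
    using closed_under_derivative[OF subspace_reachable_directions] T unfolding g_def by blast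
  then show ?thesis by (simp add: pullback_def D0_def y_def)
qed

lemma Z_eq_field:
  "Z Q \<sigma> None = field (1, 0)" "Z Q \<sigma> (Some l) = field (0, axis l 1)"
  "Z Q \<sigma> (Some l) = (\<lambda>y. diag_mult \<sigma> (axis l 1))"
  by (auto simp: fun_eq_iff field_def diag_mult_def vec_eq_iff axis_def)

lemma Z_is_field: "\<exists>a. Z Q \<sigma> k = field a"
  using Z_eq_field by (cases k) blast+

lemma polynomial_function_Z: "polynomial_function (Z Q \<sigma> k)"
proof -
  obtain a where "Z Q \<sigma> k = field a" using Z_is_field by blast
  then show ?thesis using polynomial_function_field[of "\<lambda>z. a" "\<lambda>z. z"] by simp
qed

lemma polynomial_function_lie_bracket:
  fixes V W :: "real^'m::finite \<Rightarrow> real^'m"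
  assumes "polynomial_function V" "polynomial_function W"
  shows "polynomial_function (lie_bracket V W)"
proof -
  have "polynomial_function (\<lambda>y. frechet_derivative A (at y) (B y))"
    if A: "polynomial_function A" and B: "polynomial_function B" for A B :: "real^'m \<Rightarrow> real^'m"
    using polynomial_function_comp[OF polynomial_function_frechet_derivative[OF A]
        polynomial_function_Pair[OF polynomial_function_id B]] by simp
  then show ?thesis unfolding lie_bracket_def[abs_def] using assms by (intro polynomial_function_diff)
qed

lemma lie_bracket_swap: "lie_bracket V W = (\<lambda>y. - lie_bracket W V y)"
  by (simp add: lie_bracket_def fun_eq_iff)

lemma pullback_uminus: "pullback w (\<lambda>y. - V y) = - pullback w V"
  unfolding pullback_def by (rule linear_neg[OF frechet_derivative_linear[OF polynomial_function_act_word]])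

lemma pullback_bracket_list:
  assumes "V \<in> bracket_list Q \<sigma>"
  shows "polynomial_function V \<and> (\<forall>w. pullback w V \<in> reachable_directions)"
  using assms
proof (induction rule: bracket_list.induct)
  have step: "pullback w (lie_bracket V (Z Q \<sigma> k)) \<in> reachable_directions"
    "pullback w (lie_bracket (Z Q \<sigma> k) V) \<in> reachable_directions"
    if "polynomial_function V" "\<And>w. pullback w V \<in> reachable_directions" for V k w
  proof -
    obtain a where a: "Z Q \<sigma> k = field a" using Z_is_field by blast
    show 1: "pullback w (lie_bracket (Z Q \<sigma> k) V) \<in> reachable_directions"
      unfolding a by (rule pullback_bracket[OF that])
    show "pullback w (lie_bracket V (Z Q \<sigma> k)) \<in> reachable_directions"
      unfolding lie_bracket_swap[of V] pullback_uminus
      by (rule subspace_neg[OF subspace_reachable_directions 1])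
  qed
  have impulse: "pullback w (Z Q \<sigma> (Some l)) \<in> reachable_directions" for w l
    unfolding Z_eq_field(3) by (rule pullback_impulse)
  {
    case (noise l)
    show ?case using polynomial_function_Z impulse by blast
  next
    case (bracket k1 k2)
    have "pullback w (lie_bracket (Z Q \<sigma> k1) (Z Q \<sigma> k2)) \<in> reachable_directions" for w
    proof (cases k2)
      case (Some l)
      then show ?thesis using step(2)[OF polynomial_function_Z impulse] by blast
    next
      case k2: None
      show ?thesis
      proof (cases k1)
        case (Some l)
        then show ?thesis using step(1)[OF polynomial_function_Z impulse] by blast
      next
        case None
        then have "lie_bracket (Z Q \<sigma> k1) (Z Q \<sigma> k2) = (\<lambda>y. 0)" using k2 by (simp add: lie_bracket_def fun_eq_iff)
        then have "pullback w (lie_bracket (Z Q \<sigma> k1) (Z Q \<sigma> k2)) = 0"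
          unfolding pullback_def by (simp add: linear_0[OF frechet_derivative_linear[OF polynomial_function_act_word]])
        then show ?thesis using subspace_0[OF subspace_reachable_directions] by simp
      qed
    qed
    then show ?case using polynomial_function_lie_bracket polynomial_function_Z by blast
  next
    case (iterate V k)
    then show ?case using step(1) polynomial_function_lie_bracket polynomial_function_Z by blast
  }
qed

text \<open>
  All directions are reachable, so each coordinate of \<open>\<theta>\<close> can be used for the corresponding direction.
\<close>

lemma realized_identity:
  assumes "span {V 0 | V. V \<in> bracket_list Q \<sigma>} = UNIV"
  shows "realized (\<lambda>\<theta>. \<theta>)"
proof -
  have p0: "pullback [] V = V 0" for V
  proof -
    have "act (inv_word []) = (\<lambda>x. x)" "act [] 0 = 0" by (auto simp: inv_word_def act_simps)
    then show ?thesis unfolding pullback_def by simp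
  qed
  then have "{V 0 | V. V \<in> bracket_list Q \<sigma>} \<subseteq> reachable_directions"
  proof clarify
    fix V assume "V \<in> bracket_list Q \<sigma>"
    then have "pullback [] V \<in> reachable_directions" using pullback_bracket_list by blast
    then show "V 0 \<in> reachable_directions" by (simp add: p0)
  qed
  then have all: "v \<in> reachable_directions" for v
    using span_minimal[OF _ subspace_reachable_directions] assms by blast
  have "realized (\<lambda>\<theta>. \<Sum>j\<in>J. \<theta> $ j *\<^sub>R axis j 1)" if "finite J" for J :: "'n set"
    using that
  proof (induction J)
    case empty then show ?case using realized_zero by simp
  next
    case (insert j J)
    have "realized (\<lambda>\<theta>. \<theta> $ j *\<^sub>R axis j 1)"
      using all[of "axis j 1"] bounded_linear_vec_nth[of j] unfolding reachable_directions_def by blast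
    then show ?case using realized_add[OF _ insert.IH] insert.hyps by simp
  qed
  from this[of UNIV] have "realized (\<lambda>\<theta>. \<Sum>j\<in>UNIV. \<theta> $ j *\<^sub>R axis j 1)" by simp
  moreover have "(\<Sum>j\<in>UNIV. \<theta> $ j *\<^sub>R axis j 1) = \<theta>" for \<theta> :: "real^'n"
    using basis_expansion[of \<theta>] by (simp add: scalar_mult_eq_scaleR)
  ultimately show ?thesis by simp
qed

end

section \<open>Accessibility at an exact time\<close>

text \<open>
  A nonzero polynomial has only finitely many zeros, so one nonzero value, however far from \<open>0\<close>, suffices.
\<close>

lemma real_polynomial_nonzero_near_0:
  fixes p :: "real \<Rightarrow> real"
  assumes p: "real_polynomial_function p" and nz: "p a \<noteq> 0"
    and ev: "eventually P (at_right 0)"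
  obtains x where "0 < x" "P x" "p x \<noteq> 0"
proof -
  obtain c n where c: "p = (\<lambda>x. \<Sum>i\<le>n. c i * x ^ i)"
    using real_polynomial_function_imp_sum[OF p] by blast
  have "\<exists>i\<le>n. c i \<noteq> 0"
  proof (rule ccontr)
    assume "\<not> (\<exists>i\<le>n. c i \<noteq> 0)"
    then have "p a = 0" unfolding c by (intro sum.neutral) auto
    then show False using nz by simp
  qed
  then have fin: "finite {x. p x = 0}" unfolding c using polyfun_finite_roots by blast
  obtain b where b: "b > 0" "\<And>x. 0 < x \<Longrightarrow> x < b \<Longrightarrow> P x"
    using ev unfolding eventually_at_right_field by blast
  have "infinite {0<..<b}" using infinite_Ioo[OF b(1)] .
  then have "\<not> {0<..<b} \<subseteq> {x. p x = 0}" using fin finite_subset by blast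
  then obtain x where "x \<in> {0<..<b}" "p x \<noteq> 0" by blast
  then show thesis using that[of x] b(2) by auto
qed

lemma real_polynomial_function_det:
  fixes M :: "'a::real_normed_vector \<Rightarrow> real^'n::finite^'n"
  assumes "\<And>i j. real_polynomial_function (\<lambda>z. M z $ i $ j)"
  shows "real_polynomial_function (\<lambda>z. det (M z))"
  unfolding det_def
proof (rule real_polynomial_function_sum)
  fix p :: "'n \<Rightarrow> 'n"
  show "real_polynomial_function (\<lambda>z. of_int (sign p) * (\<Prod>i\<in>UNIV. M z $ i $ p i))"
    by (rule real_polynomial_function.intros(4)[OF real_polynomial_function.intros(2)])
      (rule real_polynomial_function_prod, simp, rule assms)
qed (simp add: finite_permutations)

context polynomial_system
begin

lemma continuous_Q: "continuous_on UNIV Q"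
  by (rule polynomial_continuous_on[OF poly_Q])

lemma flow_linear_control:
  assumes r: "r \<in> {0..1}"
  shows "flow Q \<sigma> (\<lambda>s. s *\<^sub>R c) x r = pflow r (1, c) x"
proof (rule flow_eqI[OF continuous_Q linear_control(1) tri _ r])
  have cont: "continuous_on S (\<lambda>r. pflow r (1, c) x)" for S
    by (rule polynomial_continuous_on)
      (intro polynomial_function_pflow polynomial_function_id polynomial_function_const)
  show "integral_solution Q \<sigma> (\<lambda>s. s *\<^sub>R c) x (\<lambda>r. pflow r (1, c) x)"
    unfolding integral_solution_def
  proof (intro conjI ballI cont)
    fix r :: real assume r: "r \<in> {0..1}"
    have i1: "((\<lambda>s. field (1, c) (pflow s (1, c) x)) has_integral pflow r (1, c) x - pflow 0 (1, c) x) {0..r}"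
      by (rule fundamental_theorem_of_calculus[OF _ has_vector_derivative_at_within[OF pflow_deriv]])
        (use r in auto)
    have i2: "((\<lambda>s. field (1, c) (pflow s (1, c) x)) has_integral
        integral {0..r} (\<lambda>s. Q (pflow s (1, c) x)) + r *\<^sub>R diag_mult \<sigma> c) {0..r}"
    proof -
      have "(\<lambda>s. Q (pflow s (1, c) x)) integrable_on {0..r}"
        by (intro integrable_continuous_real continuous_on_compose2[OF continuous_Q cont]) auto
      moreover have "((\<lambda>s. diag_mult \<sigma> c) has_integral r *\<^sub>R diag_mult \<sigma> c) {0..r}"
        using has_integral_const_real[of "diag_mult \<sigma> c" 0 r] r by simp
      ultimately have "((\<lambda>s. Q (pflow s (1, c) x) + diag_mult \<sigma> c) has_integral
        integral {0..r} (\<lambda>s. Q (pflow s (1, c) x)) + r *\<^sub>R diag_mult \<sigma> c) {0..r}"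
        using has_integral_add integrable_integral by blast
      then show ?thesis by (simp add: field_def)
    qed
    have "pflow r (1, c) x - x = integral {0..r} (\<lambda>s. Q (pflow s (1, c) x)) + r *\<^sub>R diag_mult \<sigma> c"
      using has_integral_unique[OF i1 i2] by (simp only: pflow_0)
    moreover have "diag_mult \<sigma> (r *\<^sub>R c) = r *\<^sub>R diag_mult \<sigma> c"
      by (simp add: diag_mult_def vec_eq_iff algebra_simps)
    ultimately show "pflow r (1, c) x = x + diag_mult \<sigma> (r *\<^sub>R c) + integral {0..r} (\<lambda>s. Q (pflow s (1, c) x))"
      by (simp add: algebra_simps)
  qed
qed

lemma flow_zero_control: "r \<in> {0..1} \<Longrightarrow> flow Q \<sigma> (\<lambda>s. 0) x r = pflow r (1, 0) x"
  using flow_linear_control[of r 0 x] by simp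

lemma step_eq_flow:
  assumes "0 < \<tau>" "\<tau> \<le> 1"
  shows "step (\<tau>, c) x = flow Q \<sigma> (\<lambda>s. s *\<^sub>R ((1 / \<tau>) *\<^sub>R c)) x \<tau>"
  using flow_linear_control[of \<tau> "(1 / \<tau>) *\<^sub>R c" x] pflow_scale[of \<tau> 1 "(1, (1 / \<tau>) *\<^sub>R c)" x] assms
  by (simp add: step_def)

lemma act_reachable:
  assumes "\<And>a. a \<in> set w \<Longrightarrow> 0 < fst a" "sum_list (map fst w) \<le> 1"
  shows "\<exists>f\<in>controls. energy f \<le> (\<Sum>a\<leftarrow>w. (norm (snd a) / fst a)\<^sup>2) \<and>
    flow Q \<sigma> f x (sum_list (map fst w)) = act w x"
  using assms
proof (induction w arbitrary: x)
  case Nil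
  show ?case
  proof (rule bexI[OF _ zero_control(1)], intro conjI)
    have "flow Q \<sigma> (\<lambda>r. 0) x 0 = x" using flow_zero_control[of 0 x] pflow_0 by simp
    then show "flow Q \<sigma> (\<lambda>r. 0) x (sum_list (map fst [])) = act [] x" by (simp add: act_simps)
    show "energy (\<lambda>r. 0 :: real^'n) \<le> (\<Sum>a\<leftarrow>[]. (norm (snd a) / fst a)\<^sup>2)"
      by (simp add: zero_control(2))
  qed
next
  case (Cons a w)
  obtain \<tau> c where a: "a = (\<tau>, c)" by (cases a)
  have nn: "0 \<le> sum_list (map fst w)"
    using Cons.prems(1) by (intro sum_list_nonneg) (fastforce dest: less_imp_le)
  have \<tau>: "0 < \<tau>" "\<tau> + sum_list (map fst w) \<le> 1"
    using Cons.prems(1)[of a] Cons.prems(2) a by auto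
  then have "\<tau> \<le> 1" "sum_list (map fst w) \<le> 1" using nn by auto
  define k where "k = (\<lambda>s::real. s *\<^sub>R ((1 / \<tau>) *\<^sub>R c))"
  have k: "k \<in> controls" "energy k = (norm c / \<tau>)\<^sup>2"
    unfolding k_def using linear_control[of "(1 / \<tau>) *\<^sub>R c"] \<tau>(1) by (auto simp: power_divide divide_inverse)
  obtain f where f: "f \<in> controls" "energy f \<le> (\<Sum>a\<leftarrow>w. (norm (snd a) / fst a)\<^sup>2)"
    "flow Q \<sigma> f (step a x) (sum_list (map fst w)) = act w (step a x)"
    using Cons.IH[of "step a x"] Cons.prems(1) \<open>sum_list (map fst w) \<le> 1\<close> by auto
  show ?case
  proof (rule bexI[of _ "concat_control k \<tau> f"], intro conjI)
    show "concat_control k \<tau> f \<in> controls" using concat_control(1)[OF k(1) f(1)] \<tau> \<open>\<tau> \<le> 1\<close> by simp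
    show "energy (concat_control k \<tau> f) \<le> (\<Sum>a\<leftarrow>a # w. (norm (snd a) / fst a)\<^sup>2)"
      using concat_control(2)[OF k(1) f(1), of \<tau>] \<tau> \<open>\<tau> \<le> 1\<close> k(2) f(2) a by simp
    have "flow Q \<sigma> (concat_control k \<tau> f) x (\<tau> + sum_list (map fst w)) =
        flow Q \<sigma> f (flow Q \<sigma> k x \<tau>) (sum_list (map fst w))"
      by (rule flow_concat_control[OF continuous_Q tri k(1) f(1)]) (use \<tau> nn in auto)
    also have "flow Q \<sigma> k x \<tau> = step a x"
      unfolding a k_def using step_eq_flow[OF \<tau>(1) \<open>\<tau> \<le> 1\<close>] by simp
    finally show "flow Q \<sigma> (concat_control k \<tau> f) x (sum_list (map fst (a # w))) = act (a # w) x"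
      using f(3) a by (simp add: act_simps)
  qed
qed

text \<open>
  The word realizing the identity may contain negative times and instantaneous displacements. It is joined to the trivial
  word by a path, polynomial in a parameter \<open>l\<close>, along which the times are positive for small \<open>l > 0\<close>. The Jacobian determinant of
  the endpoint is a polynomial in \<open>l\<close> with value \<open>1\<close> at \<open>l = 1\<close>, hence nonzero for suitable small \<open>l\<close>, and the open
  mapping property follows from Sussmann's theorem.
\<close>

lemma accessible_at_exact_time:
  assumes span: "span {V 0 | V. V \<in> bracket_list Q \<sigma>} = UNIV"
    and s: "0 < s" "s \<le> 1" and \<eta>: "0 < \<eta>"
  shows "\<exists>s' U E x. 0 \<le> s' \<and> s' < s \<and> open U \<and> x \<in> U \<and>
    norm (flow Q \<sigma> (\<lambda>_. 0) x (s - s') - flow Q \<sigma> (\<lambda>_. 0) 0 s) < \<eta> \<and>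
    (\<forall>u\<in>U. \<exists>f\<in>controls. energy f \<le> E \<and> flow Q \<sigma> f 0 s' = u)"
proof -
  obtain As where fam: "family As" and id: "\<And>x. act (map (\<lambda>A. A 0) As) x = x"
    and deriv: "((\<lambda>\<theta>. act (map (\<lambda>A. A \<theta>) As) 0) has_derivative (\<lambda>\<theta>. \<theta>)) (at 0)"
    using realized_identity[OF span] unfolding realized_def by blast
  \<comment> \<open>The time of the letter at \<open>l\<close>: it is the original time at \<open>l = 1\<close> and asymptotic to \<open>l\<close> at \<open>0\<close>.\<close>
  define \<tau> where "\<tau> A l = l + l\<^sup>2 * (fst (A 0) - 1)" for A :: "real^'n \<Rightarrow> real \<times> (real^'n)" and l :: real
  define letter where "letter A z = (\<tau> A (fst z), fst z *\<^sub>R snd (A (snd z)))"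
    for A :: "real^'n \<Rightarrow> real \<times> (real^'n)" and z :: "real \<times> (real^'n)"
  define word where "word z = map (\<lambda>A. letter A z) As" for z
  define G where "G z = act (word z) 0" for z
  have Apoly: "polynomial_function A" "fst (A \<theta>) = fst (A 0)" if "A \<in> set As" for A \<theta>
    using fam that unfolding family_def by blast+
  have rp_sq: "polynomial_function (\<lambda>l::real. \<tau> A l)" for A
    unfolding \<tau>_def real_polynomial_function_eq[symmetric]
    by (intro real_polynomial_function.intros(3,4) real_polynomial_function.intros(2) real_polynomial_function_power
        real_polynomial_function.intros(1) bounded_linear_ident)
  have lpoly: "polynomial_function (letter A)" if "A \<in> set As" for A
    unfolding letter_def[abs_def]
    by (intro polynomial_function_Pair polynomial_function_comp[OF rp_sq polynomial_function_fst]
        polynomial_function_mult polynomial_function_fst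
        polynomial_function_comp[OF polynomial_function_snd
          polynomial_function_comp[OF Apoly(1)[OF that] polynomial_function_snd]])
  have Gpoly: "polynomial_function G"
  proof -
    have "polynomial_function (\<lambda>z. act (map (\<lambda>L. L z) (map letter As)) 0)"
      by (rule polynomial_function_act) (use lpoly in auto)
    then show ?thesis by (simp add: G_def[abs_def] word_def o_def)
  qed
  define DG where "DG l h = frechet_derivative G (at (l, 0)) (0, h)" for l h
  have DG: "((\<lambda>\<theta>. G (l, \<theta>)) has_derivative DG l) (at 0)" for l
    unfolding DG_def[abs_def]
    by (rule has_derivative_compose[of "\<lambda>\<theta>. (l, \<theta>)" "\<lambda>h. (0, h)", OF _ polynomial_has_derivative[OF Gpoly]])
      (auto intro!: derivative_eq_intros)
  define p where "p l = det (matrix (DG l))" for l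
  have pp: "real_polynomial_function p"
    unfolding p_def[abs_def]
  proof (rule real_polynomial_function_det)
    fix i j
    have "polynomial_function (\<lambda>l::real. ((l, 0 :: real^'n), (0::real, axis j (1::real) :: real^'n)))"
      by (intro polynomial_function_Pair polynomial_function_const polynomial_function_id)
    from polynomial_function_comp[OF polynomial_function_frechet_derivative[OF Gpoly] this]
    have "polynomial_function (\<lambda>l. DG l (axis j 1))" by (simp add: DG_def)
    then show "real_polynomial_function (\<lambda>l. matrix (DG l) $ i $ j)"
      unfolding matrix_def by (simp add: polynomial_function_vec_nth)
  qed
  have p1: "p 1 \<noteq> 0"
  proof -
    have "word (1, \<theta>) = map (\<lambda>A. A \<theta>) As" for \<theta>
      unfolding word_def
    proof (rule map_cong[OF refl])
      fix A assume "A \<in> set As"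
      then show "letter A (1, \<theta>) = A \<theta>" using Apoly(2)[of A \<theta>] by (simp add: letter_def \<tau>_def prod_eq_iff)
    qed
    then have "((\<lambda>\<theta>. G (1, \<theta>)) has_derivative (\<lambda>\<theta>. \<theta>)) (at 0)" using deriv by (simp add: G_def)
    then have "DG 1 = (\<lambda>\<theta>. \<theta>)" using DG has_derivative_unique by blast
    then have "matrix (DG 1) = mat 1" using matrix_id_mat_1 by (simp add: id_def)
    then show ?thesis by (simp add: p_def)
  qed
  have ev: "\<forall>\<^sub>F l in at_right 0. (\<forall>A\<in>set As. 0 < \<tau> A l) \<and> (\<Sum>A\<leftarrow>As. \<tau> A l) < s \<and>
      norm (pflow (s - (\<Sum>A\<leftarrow>As. \<tau> A l)) (1, 0) (G (l, 0)) - pflow s (1, 0) 0) < \<eta>"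
  proof (intro eventually_conj)
    have "\<forall>\<^sub>F l in at_right 0. 0 < \<tau> A l" for A
    proof -
      have "((\<lambda>l. 1 + l * (fst (A 0) - 1)) \<longlongrightarrow> 1 + 0 * (fst (A 0) - 1)) (at_right 0)"
        by (intro tendsto_intros)
      then have "\<forall>\<^sub>F l in at_right 0. 0 < 1 + l * (fst (A 0) - 1)"
        by (rule order_tendstoD) simp
      moreover have "\<forall>\<^sub>F l::real in at_right 0. 0 < l" by (rule eventually_at_right_less)
      ultimately show ?thesis
      proof eventually_elim
        case (elim l)
        then have "0 < l * (1 + l * (fst (A 0) - 1))" by simp
        then show ?case by (simp add: \<tau>_def algebra_simps power2_eq_square)
      qed
    qed
    then show "\<forall>\<^sub>F l in at_right 0. \<forall>A\<in>set As. 0 < \<tau> A l" by (intro eventually_ball_finite) auto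
    have S_eq: "(\<Sum>A\<leftarrow>Bs. \<tau> A l) = l * real (length Bs) + l\<^sup>2 * (\<Sum>A\<leftarrow>Bs. fst (A 0) - 1)" for l Bs
      by (induction Bs) (auto simp: \<tau>_def algebra_simps)
    have S_poly: "polynomial_function (\<lambda>l. \<Sum>A\<leftarrow>As. \<tau> A l)"
      unfolding S_eq real_polynomial_function_eq[symmetric]
      by (intro real_polynomial_function.intros(3,4) real_polynomial_function.intros(2) real_polynomial_function_power
        real_polynomial_function.intros(1) bounded_linear_ident)
    have S0: "(\<Sum>A\<leftarrow>As. \<tau> A 0) = 0" by (simp add: S_eq)
    have lim: "(f \<longlongrightarrow> f 0) (at_right 0)" if "polynomial_function f" for f :: "real \<Rightarrow> 'b::euclidean_space"
      using polynomial_continuous_on[OF that, of UNIV] by (auto simp: continuous_on_def filterlim_at_split)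
    show "\<forall>\<^sub>F l in at_right 0. (\<Sum>A\<leftarrow>As. \<tau> A l) < s"
      using order_tendstoD(2)[OF lim[OF S_poly]] s S0 by simp
    have G0: "G (0, 0) = 0"
    proof -
      have "act (map (\<lambda>A. letter A (0, 0)) Bs) x = x" for Bs x
        by (induction Bs arbitrary: x) (auto simp: act_simps letter_def \<tau>_def step_zero[unfolded zero_prod_def])
      then show ?thesis by (simp add: G_def word_def)
    qed
    have Gl: "polynomial_function (\<lambda>l. G (l, 0))"
      by (rule polynomial_function_comp[OF Gpoly]) (intro polynomial_function_Pair polynomial_function_id polynomial_function_const)
    have "polynomial_function (\<lambda>l. pflow (s - (\<Sum>A\<leftarrow>As. \<tau> A l)) (1, 0) (G (l, 0)))"
      by (intro polynomial_function_pflow polynomial_function_diff polynomial_function_const S_poly Gl)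
    from tendsto_norm_zero[OF LIM_zero[OF lim[OF this]]]
    show "\<forall>\<^sub>F l in at_right 0. norm (pflow (s - (\<Sum>A\<leftarrow>As. \<tau> A l)) (1, 0) (G (l, 0)) - pflow s (1, 0) 0) < \<eta>"
      using order_tendstoD(2) \<eta> by (fastforce simp: S0 G0)
  qed
  obtain l where "0 < l" "p l \<noteq> 0" "(\<forall>A\<in>set As. 0 < \<tau> A l) \<and> (\<Sum>A\<leftarrow>As. \<tau> A l) < s \<and>
      norm (pflow (s - (\<Sum>A\<leftarrow>As. \<tau> A l)) (1, 0) (G (l, 0)) - pflow s (1, 0) 0) < \<eta>"
    by (rule real_polynomial_nonzero_near_0[OF pp p1 ev])
  then have l: "0 < l" "\<And>A. A \<in> set As \<Longrightarrow> 0 < \<tau> A l" "(\<Sum>A\<leftarrow>As. \<tau> A l) < s"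
      "norm (pflow (s - (\<Sum>A\<leftarrow>As. \<tau> A l)) (1, 0) (G (l, 0)) - pflow s (1, 0) 0) < \<eta>" "p l \<noteq> 0"
    by blast+
  define s' where "s' = (\<Sum>A\<leftarrow>As. \<tau> A l)"
  have s': "0 \<le> s'" "s' < s" using l(2,3) unfolding s'_def by (auto intro!: sum_list_nonneg simp: less_imp_le)
  define U where "U = interior ((\<lambda>\<theta>. G (l, \<theta>)) ` ball 0 1)"
  have lin: "linear (DG l)" using DG has_derivative_linear by blast
  have "\<exists>g. linear g \<and> DG l \<circ> g = id"
  proof (rule linear_surjective_right_inverse[OF lin])
    have "inj (DG l)" using l(5) det_nz_iff_inj[OF lin] by (simp add: p_def)
    then show "surj (DG l)" by (rule linear_injective_imp_surjective[OF lin]) simp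
  qed
  then obtain g where g: "linear g" "DG l \<circ> g = id" by blast
  have "G (l, 0) \<in> U" unfolding U_def
  proof (rule sussmann_open_mapping[where f="\<lambda>\<theta>. G (l, \<theta>)" and S=UNIV and T="ball 0 1"])
    show "continuous_on UNIV (\<lambda>\<theta>. G (l, \<theta>))"
      by (rule polynomial_continuous_on) (intro polynomial_function_comp[OF Gpoly] polynomial_function_Pair polynomial_function_id polynomial_function_const)
    show "((\<lambda>\<theta>. G (l, \<theta>)) has_derivative DG l) (at 0)" by (rule DG)
    show "bounded_linear g" using g(1) by (simp add: linear_conv_bounded_linear)
    show "DG l \<circ> g = id" by (rule g(2))
  qed auto
  have "\<exists>B. \<forall>\<theta>\<in>cball 0 1. norm (snd (A \<theta>)) \<le> B" if "A \<in> set As" for A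
  proof -
    have "compact ((\<lambda>\<theta>. snd (A \<theta>)) ` cball 0 1)"
      by (intro compact_continuous_image compact_cball polynomial_continuous_on
          polynomial_function_comp[OF polynomial_function_snd Apoly(1)[OF that]])
    then show ?thesis using compact_imp_bounded by (fastforce simp: bounded_iff)
  qed
  then obtain B where B: "\<And>A \<theta>. A \<in> set As \<Longrightarrow> \<theta> \<in> cball 0 1 \<Longrightarrow> norm (snd (A \<theta>)) \<le> B A" by metis
  define E where "E = (\<Sum>A\<leftarrow>As. (l * B A / \<tau> A l)\<^sup>2)"
  have "\<exists>f\<in>controls. energy f \<le> E \<and> flow Q \<sigma> f 0 s' = u" if uU: "u \<in> U" for u
  proof -
    obtain \<theta> where \<theta>: "\<theta> \<in> ball 0 1" "u = G (l, \<theta>)" using uU interior_subset unfolding U_def by blast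
    have sum: "sum_list (map fst (word (l, \<theta>))) = s'"
      unfolding word_def s'_def by (simp add: letter_def o_def)
    have "\<exists>f\<in>controls. energy f \<le> (\<Sum>a\<leftarrow>word (l, \<theta>). (norm (snd a) / fst a)\<^sup>2) \<and>
      flow Q \<sigma> f 0 (sum_list (map fst (word (l, \<theta>)))) = act (word (l, \<theta>)) 0"
      by (rule act_reachable) (use l(2) sum s' s in \<open>auto simp: word_def letter_def\<close>)
    moreover have "(\<Sum>a\<leftarrow>word (l, \<theta>). (norm (snd a) / fst a)\<^sup>2) \<le> E"
      unfolding word_def E_def map_map o_def
    proof (rule sum_list_mono)
      fix A assume A: "A \<in> set As"
      have "norm (snd (A \<theta>)) \<le> B A" using B[OF A] \<theta>(1) by simp
      then show "(norm (snd (letter A (l, \<theta>))) / fst (letter A (l, \<theta>)))\<^sup>2 \<le> (l * B A / \<tau> A l)\<^sup>2"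
        using l(1) l(2)[OF A]
        by (intro power_mono) (auto simp: letter_def intro!: divide_right_mono mult_left_mono)
    qed
    ultimately show ?thesis unfolding sum \<theta>(2) G_def by (blast intro: order_trans)
  qed
  moreover have "norm (flow Q \<sigma> (\<lambda>_. 0) (G (l, 0)) (s - s') - flow Q \<sigma> (\<lambda>_. 0) 0 s) < \<eta>"
    using l(4) s s' flow_zero_control[of "s - s'"] flow_zero_control[of s] by (simp add: s'_def)
  ultimately show ?thesis using s' \<open>G (l, 0) \<in> U\<close> open_interior unfolding U_def by blast
qed

end


section \<open>The leading part is a triangular polynomial field\<close>

lemma real_polynomial_function_poly_fun:
  fixes p :: "'n::finite rpoly"
  shows "real_polynomial_function (poly_fun p)"
proof -
  have "real_polynomial_function (\<lambda>x::real^'n. x $ i)" for i :: 'n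
    by (rule real_polynomial_function.intros(1)) (rule bounded_linear_vec_nth)
  then show ?thesis unfolding poly_fun_def[abs_def]
    by (intro real_polynomial_function_sum real_polynomial_function.intros(4)[OF real_polynomial_function.intros(2)]
        real_polynomial_function_prod real_polynomial_function_power) auto
qed

lemma polynomial_function_poly_field: "polynomial_function (poly_field P)"
  by (rule polynomial_function_vec) (simp add: poly_field_def real_polynomial_function_poly_fun)

lemma poly_fun_cong:
  fixes p :: "'n::finite rpoly"
  assumes "\<And>m i. m \<in> Poly_Mapping.keys p \<Longrightarrow> Poly_Mapping.lookup m i \<noteq> 0 \<Longrightarrow> x $ i = y $ i"
  shows "poly_fun p x = poly_fun p y"
  unfolding poly_fun_def
proof (intro sum.cong refl arg_cong2[where f="(*)"] prod.cong)
  fix m i assume "m \<in> Poly_Mapping.keys p"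
  then show "(x $ i) ^ Poly_Mapping.lookup m i = (y $ i) ^ Poly_Mapping.lookup m i"
    using assms by (cases "Poly_Mapping.lookup m i = 0") auto
qed

lemma keys_sum_monoms:
  assumes "m \<in> Poly_Mapping.keys (sum_monoms C p)"
  shows "m \<in> Poly_Mapping.keys p" "C m"
proof -
  have "Poly_Mapping.keys (sum_monoms C p) \<subseteq> {m \<in> Poly_Mapping.keys p. C m}"
    unfolding sum_monoms_def
    by (rule order_trans[OF keys_sum]) (auto split: if_splits)
  then show "m \<in> Poly_Mapping.keys p" "C m" using assms by auto
qed

lemma plus_scaling_finite: "a + b \<noteq> Infty \<longleftrightarrow> a \<noteq> Infty \<and> b \<noteq> Infty"
  by (cases a; cases b) auto

lemma monom_val_finite:
  assumes "monom_val m a \<noteq> Infty" "Poly_Mapping.lookup m i \<noteq> 0"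
  shows "a i \<noteq> Infty"
proof -
  have "monom_val m a = nat_scale (Poly_Mapping.lookup m i) (a i) + (\<Sum>i\<in>UNIV - {i}. nat_scale (Poly_Mapping.lookup m i) (a i))"
    unfolding monom_val_def by (rule sum.remove) auto
  then have "nat_scale (Poly_Mapping.lookup m i) (a i) \<noteq> Infty" using assms(1) plus_scaling_finite by metis
  then show ?thesis using assms(2) by auto
qed

lemma vals_finite_imp_level:
  "vals P \<sigma> l i \<noteq> Infty \<Longrightarrow> \<exists>k\<le>l. i \<in> level P \<sigma> k"
proof (induction l)
  case 0
  then show ?case by (auto split: if_splits)
next
  case (Suc l)
  show ?case
  proof (cases "i \<in> level P \<sigma> (Suc l)")
    case False
    then have "vals P \<sigma> l i \<noteq> Infty" using Suc.prems by (simp del: level.simps)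
    then show ?thesis using Suc.IH le_SucI by blast
  qed blast
qed

lemma level_disjoint:
  "j \<in> level P \<sigma> (Suc l) \<Longrightarrow> k \<le> l \<Longrightarrow> j \<notin> level P \<sigma> k"
  by (auto simp: next_level_def split: if_splits)

text \<open>
  A level that is not empty was chosen before the procedure stopped, so the minimum is attained at a finite value.
\<close>

lemma level_finite_values:
  assumes j: "j \<in> level P \<sigma> (Suc l)"
  shows "poly_val (P j) (vals P \<sigma> l) \<noteq> Infty"
    and "min_proj P (UNIV - (\<Union>k\<in>{..l}. level P \<sigma> k)) (vals P \<sigma> l) \<noteq> \<infinity>"
proof -
  define R where "R = UNIV - (\<Union>k\<in>{..l}. level P \<sigma> k)"
  have nl: "j \<in> next_level P R (vals P \<sigma> l)" using j by (simp add: R_def)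
  then have "\<exists>i\<in>R. poly_val (P i) (vals P \<sigma> l) \<noteq> Infty"
    and eq: "proj1 (poly_val (P j) (vals P \<sigma> l)) = min_proj P R (vals P \<sigma> l)"
    unfolding next_level_def by (auto split: if_splits)
  then obtain i where i: "i \<in> R" "poly_val (P i) (vals P \<sigma> l) \<noteq> Infty" by blast
  have "min_proj P R (vals P \<sigma> l) \<le> proj1 (poly_val (P i) (vals P \<sigma> l))"
    unfolding min_proj_def using i(1) by (intro Min_le) auto
  moreover have "proj1 (poly_val (P i) (vals P \<sigma> l)) \<noteq> \<infinity>" using i(2) by (cases "poly_val (P i) (vals P \<sigma> l)") auto
  ultimately have fin: "min_proj P R (vals P \<sigma> l) \<noteq> \<infinity>" by auto
  then show "min_proj P (UNIV - (\<Union>k\<in>{..l}. level P \<sigma> k)) (vals P \<sigma> l) \<noteq> \<infinity>" by (simp add: R_def)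
  show "poly_val (P j) (vals P \<sigma> l) \<noteq> Infty" using fin eq by auto
qed

text \<open>
  The levels are disjoint, so this is the level that contains \<open>j\<close>. If there is none, the value is arbitrary and
  harmless, as the component \<open>j\<close> of \<open>P\<^sub>L\<close> and \<open>P\<^sub>D\<close> is then zero.
\<close>

definition first_level :: "('n::finite \<Rightarrow> 'n rpoly) \<Rightarrow> real^'n \<Rightarrow> 'n \<Rightarrow> nat" where
  "first_level P \<sigma> j = (LEAST k. j \<in> level P \<sigma> k)"

text \<open>
  A monomial kept in the component \<open>j\<close> of level \<open>l + 1\<close> has finite value at \<open>a\<^sub>l\<close>, so each of its variables has
  finite value there, that is, belongs to a level at most \<open>l\<close>.
\<close>

lemma triangular_leading_part:
  fixes P :: "'n::finite \<Rightarrow> 'n rpoly"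
  assumes "Q \<in> {poly_field (P_L P \<sigma>), poly_field (P_D P \<sigma>)}"
  shows "triangular (first_level P \<sigma>) Q"
proof -
  have key: "first_level P \<sigma> i < first_level P \<sigma> j"
    if jl: "j \<in> level P \<sigma> (Suc l)" and fin: "monom_val m (vals P \<sigma> l) \<noteq> Infty"
      and i: "Poly_Mapping.lookup m i \<noteq> 0" for i j l m
  proof -
    have "first_level P \<sigma> j = Suc l" unfolding first_level_def
    proof (rule Least_equality[where P="\<lambda>k. j \<in> level P \<sigma> k", OF jl])
      fix k assume "j \<in> level P \<sigma> k"
      then show "Suc l \<le> k" using level_disjoint[OF jl, of k] by (meson not_less_eq_eq)
    qed
    moreover obtain k where k: "k \<le> l" "i \<in> level P \<sigma> k"
      using vals_finite_imp_level[OF monom_val_finite[OF fin i]] by blast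
    then have "first_level P \<sigma> i \<le> l" unfolding first_level_def using Least_le[of "\<lambda>k. i \<in> level P \<sigma> k" k] by simp
    ultimately show ?thesis by simp
  qed
  have L: "first_level P \<sigma> i < first_level P \<sigma> j"
    if m: "m \<in> Poly_Mapping.keys (P_L P \<sigma> j)" and i: "Poly_Mapping.lookup m i \<noteq> 0" for m i j
  proof -
    obtain l where l: "j \<in> level P \<sigma> (Suc l)" "monom_val m (vals P \<sigma> l) = poly_val (P j) (vals P \<sigma> l)"
      using keys_sum_monoms(2)[OF m[unfolded P_L_def]] by blast
    then show ?thesis using key[OF l(1) _ i] level_finite_values(1)[OF l(1)] by simp
  qed
  have D: "first_level P \<sigma> i < first_level P \<sigma> j"
    if m: "m \<in> Poly_Mapping.keys (P_D P \<sigma> j)" and i: "Poly_Mapping.lookup m i \<noteq> 0" for m i j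
  proof -
    obtain l where l: "j \<in> level P \<sigma> (Suc l)" "proj1 (monom_val m (vals P \<sigma> l)) =
          min_proj P (UNIV - (\<Union>k\<in>{..l}. level P \<sigma> k)) (vals P \<sigma> l)"
      using keys_sum_monoms(2)[OF m[unfolded P_D_def]] by blast
    have "monom_val m (vals P \<sigma> l) \<noteq> Infty"
    proof
      assume "monom_val m (vals P \<sigma> l) = Infty"
      then have "proj1 (monom_val m (vals P \<sigma> l)) = \<infinity>" by simp
      then show False using l(2) level_finite_values(2)[OF l(1)] by (simp del: level.simps)
    qed
    then show ?thesis using key[OF l(1) _ i] by simp
  qed
  consider "Q = poly_field (P_L P \<sigma>)" | "Q = poly_field (P_D P \<sigma>)" using assms by blast
  then show ?thesis
  proof cases
    case 1
    show ?thesis unfolding triangular_def 1 poly_field_def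
      using L by (auto intro!: poly_fun_cong)
  next
    case 2
    show ?thesis unfolding triangular_def 2 poly_field_def
      using D by (auto intro!: poly_fun_cong)
  qed
qed

section \<open>Controllability near the origin\<close>

text \<open>
  With \<open>\<epsilon>\<close> so small that \<open>\<epsilon>\<^sup>2 C \<le> 1\<close>, the endpoints of the controls \<open>\<epsilon> k\<close> arise from those of the controls \<open>k\<close> by
  multiplying the coordinates by positive constants, which maps a ball around \<open>0\<close> onto a neighbourhood of \<open>0\<close>.
\<close>

lemma homogeneous_scaling:
  fixes Q :: "real^'n::finite \<Rightarrow> real^'n"
  assumes hom: "component_homogeneous Q \<sigma>" and T: "0 < T" "T \<le> 1" and \<rho>: "0 < \<rho>"
    and ball: "\<And>y. y \<in> ball 0 \<rho> \<Longrightarrow> \<exists>k\<in>controls. energy k \<le> C \<and> flow Q \<sigma> k 0 T = y"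
  shows "\<exists>r>0. ball 0 r \<subseteq> A1 Q \<sigma> T 0"
proof -
  obtain \<alpha> where \<alpha>: "\<And>j \<epsilon> f. \<epsilon> > 0 \<Longrightarrow> f \<in> controls \<Longrightarrow>
      flow Q \<sigma> (\<lambda>s. \<epsilon> *\<^sub>R f s) 0 T $ j = \<epsilon> powr \<alpha> j * flow Q \<sigma> f 0 T $ j"
    using hom T unfolding component_homogeneous_def by metis
  have "\<exists>k\<in>controls. energy k \<le> C \<and> flow Q \<sigma> k 0 T = 0" by (rule ball) (use \<rho> in simp)
  then have C: "0 \<le> C" using energy_nonneg order_trans by blast
  define \<epsilon> where "\<epsilon> = 1 / sqrt (C + 1)"
  have \<epsilon>: "0 < \<epsilon>" "\<epsilon>\<^sup>2 * C \<le> 1" using C by (auto simp: \<epsilon>_def power_divide divide_simps)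
  define M where "M = (\<Sum>j\<in>UNIV. 1 / \<epsilon> powr \<alpha> j)"
  have M: "0 < M" unfolding M_def using \<epsilon> by (intro sum_pos) auto
  have "ball 0 (\<rho> / M) \<subseteq> A1 Q \<sigma> T 0"
  proof
    fix y :: "real^'n" assume y: "y \<in> ball 0 (\<rho> / M)"
    define z where "z = (\<chi> j. y $ j / \<epsilon> powr \<alpha> j)"
    have "norm z \<le> (\<Sum>j\<in>UNIV. \<bar>z $ j\<bar>)" by (rule norm_le_l1_cart)
    also have "\<dots> \<le> (\<Sum>j\<in>UNIV. 1 / \<epsilon> powr \<alpha> j * norm y)"
      unfolding z_def using \<epsilon> by (intro sum_mono) (simp add: divide_right_mono component_le_norm_cart)
    also have "\<dots> = M * norm y" by (simp add: M_def sum_distrib_right)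
    also have "\<dots> < \<rho>" using y M by (simp add: field_simps)
    finally have "z \<in> ball 0 \<rho>" by simp
    then obtain k where k: "k \<in> controls" "energy k \<le> C" "flow Q \<sigma> k 0 T = z" using ball by blast
    have "flow Q \<sigma> (\<lambda>s. \<epsilon> *\<^sub>R k s) 0 T = y"
      unfolding vec_eq_iff \<alpha>[OF \<epsilon>(1) k(1)] k(3) using \<epsilon> by (simp add: z_def)
    moreover have "(\<lambda>s. \<epsilon> *\<^sub>R k s) \<in> controls_le 1"
    proof -
      have "\<epsilon>\<^sup>2 * energy k \<le> \<epsilon>\<^sup>2 * C" using k(2) by (intro mult_left_mono) auto
      then show ?thesis using scaled_control[OF k(1), of \<epsilon>] \<epsilon>(2) by (simp add: controls_le_iff)
    qed
    ultimately show "y \<in> A1 Q \<sigma> T 0" unfolding A1_def by blast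
  qed
  then show ?thesis using \<rho> M by (intro exI[of _ "\<rho> / M"]) auto
qed

theorem theorem6p8:
  fixes P :: "'n::finite \<Rightarrow> 'n rpoly"
    and \<sigma> :: "real^'n"
    and Q :: "real^'n \<Rightarrow> real^'n"
    and t r1 :: real
  assumes "\<forall>j. \<sigma> $ j \<ge> 0"
    and "Q \<in> {poly_field (P_L P \<sigma>), poly_field (P_D P \<sigma>)}"
    and "noise_propagating P \<sigma>"
    and "component_homogeneous Q \<sigma>"
    and "span {V 0 | V. V \<in> bracket_list Q \<sigma>} = UNIV"
    and "r1 > 0" and "0 < t" and "t < 1"
    and "\<forall>x \<in> ball 0 r1. 0 \<in> A2 Q \<sigma> t x"
  shows "\<exists>s0>0. t + s0 \<le> 1 \<and>
           (\<forall>s. 0 < s \<and> s < s0 \<longrightarrow> (\<exists>r2>0. ball 0 r2 \<subseteq> A1 Q \<sigma> (t + s) 0))"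
proof -
  have "polynomial_function Q" using assms(2) polynomial_function_poly_field by blast
  then interpret polynomial_system Q \<sigma> "first_level P \<sigma>"
    using triangular_leading_part[OF assms(2)] by unfold_locales
  have "continuous_on UNIV (\<lambda>s. pflow s (1, 0) 0)"
    by (rule polynomial_continuous_on)
      (intro polynomial_function_pflow polynomial_function_id polynomial_function_const)
  then have "((\<lambda>s. pflow s (1, 0) 0) \<longlongrightarrow> pflow 0 (1, 0) 0) (at_right 0)"
    by (auto simp: continuous_on_def filterlim_at_split)
  then have "((\<lambda>s. norm (pflow s (1, 0) 0)) \<longlongrightarrow> 0) (at_right 0)"
    using tendsto_norm_zero by (simp add: pflow_0)
  then have "\<forall>\<^sub>F s in at_right 0. norm (pflow s (1, 0) 0) < r1 / 2"
    using order_tendstoD(2) assms(6) by (metis half_gt_zero)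
  then obtain b where b: "b > 0" "\<And>s. 0 < s \<Longrightarrow> s < b \<Longrightarrow> norm (pflow s (1, 0) 0) < r1 / 2"
    unfolding eventually_at_right_field by blast
  define s0 where "s0 = min b (1 - t)"
  have s0: "0 < s0" "t + s0 \<le> 1" using b assms(8) by (auto simp: s0_def)
  have "\<exists>r2>0. ball 0 r2 \<subseteq> A1 Q \<sigma> (t + s) 0" if s: "0 < s" "s < s0" for s
  proof -
    have s1: "s \<le> 1" "t + s \<le> 1" "s < b" using s s0 assms(7) by (auto simp: s0_def)
    have small: "norm (flow Q \<sigma> (\<lambda>_. 0) 0 s) < r1 / 2"
      using b(2)[OF s(1) s1(3)] flow_zero_control[of s 0] s s1 by simp
    obtain s' U E x where U: "0 \<le> s'" "s' < s" "open U" "x \<in> U"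
      "norm (flow Q \<sigma> (\<lambda>_. 0) x (s - s') - flow Q \<sigma> (\<lambda>_. 0) 0 s) < r1 / 2"
      "\<forall>u\<in>U. \<exists>f\<in>controls. energy f \<le> E \<and> flow Q \<sigma> f 0 s' = u"
      using accessible_at_exact_time[OF assms(5) s(1) s1(1), of "r1 / 2"] half_gt_zero[OF assms(6)] by blast
    define x2 where "x2 = flow Q \<sigma> (\<lambda>_. 0) x (s - s')"
    have "norm x2 < r1"
      using U(5) small norm_triangle_sub[of x2 "flow Q \<sigma> (\<lambda>_. 0) 0 s"] unfolding x2_def by linarith
    then have "0 \<in> A2 Q \<sigma> t x2" using assms(9) by simp
    then obtain f where f: "f \<in> controls" "flow Q \<sigma> f x2 t = 0" unfolding A2_def by auto
    \<comment> \<open>After time \<open>s'\<close> the control rests until time \<open>s\<close> and then follows \<open>f\<close>.\<close>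
    define g where "g = concat_control (\<lambda>_. 0) (s - s') f"
    have g: "g \<in> controls"
      unfolding g_def using concat_control(1)[OF zero_control(1) f(1)] U s1 by simp
    have times: "0 \<le> s - s' + t" "s - s' + t \<le> 1" "s' + (s - s' + t) \<le> 1" using U s1 assms(7) by auto
    have "flow Q \<sigma> g x (s - s' + t) = 0"
      unfolding g_def using flow_concat_control[OF continuous_Q tri zero_control(1) f(1), of "s - s'" t] f(2) U times assms(7)
      by (simp add: x2_def)
    then have "0 \<in> (\<lambda>x. flow Q \<sigma> g x (s - s' + t)) ` U" using U(4) by (metis image_eqI)
    moreover have "open ((\<lambda>x. flow Q \<sigma> g x (s - s' + t)) ` U)"
      by (rule open_flow_image[OF continuous_Q g tri _ U(3)]) (use times in simp)
    ultimately obtain \<rho> where \<rho>: "\<rho> > 0" "ball 0 \<rho> \<subseteq> (\<lambda>x. flow Q \<sigma> g x (s - s' + t)) ` U"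
      by (meson open_contains_ball)
    show ?thesis
    proof (rule homogeneous_scaling[OF assms(4) _ _ \<rho>(1)])
      fix y :: "real^'n" assume "y \<in> ball 0 \<rho>"
      then obtain u where u: "u \<in> U" "flow Q \<sigma> g u (s - s' + t) = y" using \<rho>(2) by blast
      obtain h where h: "h \<in> controls" "energy h \<le> E" "flow Q \<sigma> h 0 s' = u" using U(6) u(1) by blast
      have "s' \<le> 1" using U(2) s1 by simp
      show "\<exists>k\<in>controls. energy k \<le> E + energy g \<and> flow Q \<sigma> k 0 (t + s) = y"
      proof (rule bexI[of _ "concat_control h s' g"], intro conjI)
        show "concat_control h s' g \<in> controls" by (rule concat_control(1)[OF h(1) g U(1) \<open>s' \<le> 1\<close>])
        show "energy (concat_control h s' g) \<le> E + energy g"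
          using concat_control(2)[OF h(1) g U(1) \<open>s' \<le> 1\<close>] h(2) by simp
        have "flow Q \<sigma> (concat_control h s' g) 0 (s' + (s - s' + t)) = y"
          using flow_concat_control[OF continuous_Q tri h(1) g U(1) times(1,3)] h(3) u(2) by simp
        then show "flow Q \<sigma> (concat_control h s' g) 0 (t + s) = y" by (simp add: add.commute)
      qed
    qed (use s s1 assms(7) in auto)
  qed
  then show ?thesis using s0 by blast
qed

end
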